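(* For any one-dimensional random walk $S$ such that $\mathbb E X_1=0$ and $\sigma^2:=\mathbb E X_1^2\in(0,\infty)$, we have $$\lim_{n\to\infty}\mathbb P_x\Bigl(\frac{\sigma L_n}{\mathbb E|X_1|\sqrt n}\le y\Bigr)=2\Phi(y)-1,\qquad x\in\mathcal Z,\ y\ge0,$$ where $\Phi$ denotes the distribution function of a standard normal random variable.
   Context: $S_n=S_0+X_1+\dots+X_n$, where $X_1,X_2,\dots$ are i.i.d. real random variables and $S_0$ is independent of them. $\mathcal Z$ is the minimal topologically closed subgroup of $(\mathbb R,+)$ containing the topological support of the distribution of $X_1$. $\mathbb P_x$ is the law of the walk with $S_0=x$. The crossing times of the zero level are $\mathcal T_0:=0$, $\mathcal T_n:=\inf\{k>\mathcal T_{n-1}:S_{k-1}<0,S_k\ge0\ \text{or}\ S_{k-1}\ge0,S_k<0\}$ for $n\ge1$, and $L_n:=\max\{k\ge0:\mathcal T_k\le n\}$ is the number of zero-level crossings of the walk by time $n$. *)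

theory Defs
  imports "HOL-Probability.Probability" "HOL-Library.Extended_Nat"
begin

definition topological_support :: "'a::topological_space measure \<Rightarrow> 'a set" where
  "topological_support \<mu> = {u. \<forall>U. open U \<and> u \<in> U \<longrightarrow> emeasure \<mu> U > 0}"

definition closed_additive_subgroup :: "'a::{topological_space, ab_group_add} set \<Rightarrow> bool" where
  "closed_additive_subgroup H \<longleftrightarrow>
     closed H \<and> 0 \<in> H \<and> (\<forall>u\<in>H. \<forall>v\<in>H. u + v \<in> H) \<and> (\<forall>u\<in>H. - u \<in> H)"

text \<open>The minimal closed subgroup of the reals containing the support of the increment
  distribution \<open>\<mu>\<close>; \<open>hull\<close> is the intersection of all such subgroups.\<close>

definition walk_state_space :: "real measure \<Rightarrow> real set" where
  "walk_state_space \<mu> = closed_additive_subgroup hull topological_support \<mu>"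

text \<open>The increments are \<open>X 1, X 2, \<dots>\<close>; the value \<open>X 0\<close> is never used.\<close>

definition random_walk :: "real \<Rightarrow> (nat \<Rightarrow> 'a \<Rightarrow> real) \<Rightarrow> nat \<Rightarrow> 'a \<Rightarrow> real" where
  "random_walk x X n \<omega> = x + (\<Sum>i=1..n. X i \<omega>)"

definition crosses_zero_at :: "(nat \<Rightarrow> real) \<Rightarrow> nat \<Rightarrow> bool" where
  "crosses_zero_at s k \<longleftrightarrow>
     (s (k - 1) < 0 \<and> s k \<ge> 0) \<or> (s (k - 1) \<ge> 0 \<and> s k < 0)"

text \<open>Crossing times of a path \<open>s\<close>, with infinite value once there are no further crossings
  (the infimum of the empty set in \<^typ>\<open>enat\<close> is \<open>\<infinity>\<close>). In the recursion
  \<open>k\<close> is always at least 1, so \<open>k - 1\<close> does not truncate.\<close>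

primrec crossing_time :: "(nat \<Rightarrow> real) \<Rightarrow> nat \<Rightarrow> enat" where
  "crossing_time s 0 = 0"
| "crossing_time s (Suc n) =
     Inf {enat k | k. enat k > crossing_time s n \<and> crosses_zero_at s k}"

text \<open>The set below is finite and contains 0, because finite crossing times are strictly
  increasing, so the maximum is a genuine one.\<close>

definition num_crossings :: "(nat \<Rightarrow> real) \<Rightarrow> nat \<Rightarrow> nat" where
  "num_crossings s n = Max {k. crossing_time s k \<le> enat n}"

end

(*
  Write O_k = |S_k| if the walk crosses zero at step k and O_k = 0 otherwise. Tanaka's formula
  |S_n| = |S_0| + sum sgn(S_{k-1}) X_k + 2 sum O_k makes A_n = sum O_k a discrete local time.

  Limit of A_n: for l > 0 and real m the function
  exp (- l * L) * (cos (m * r) + l * sin (m * r) / m) of r = |S_n| / (sigma sqrt n) and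
  L = 2 A_n / (sigma sqrt n) is, up to the factor exp (m^2 t / 2), asymptotically a martingale, so
  its expectation tends to exp (- m^2 / 2). Integrating over m against the Cauchy density with scale l
  removes the dependence on r and leaves E exp (- l L) -> E exp (- l |N|), N standard normal.

  From A_n to L_n: with kappa = E|X_1| / sigma^2, both E L_n and 2 kappa E A_n = kappa (E|S_n| - |S_0|)
  are Fourier integrals against sum_{k<n} psi^k, where psi is the characteristic function of X_1. Up to a
  smoothing of the crossing indicator the difference of their symbols vanishes at the origin and is
  bounded by a multiple of |1 - psi|^(1/2) / t^2, which gives |E L_n - 2 kappa E A_n| = o(sqrt n)
  uniformly in the starting point. By the Markov property
  E (L_n - 2 kappa A_n)^2 = o(n), so that L_n and 2 kappa A_n have the same limit.
*)

theory Submission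
  imports Defs "HOL-Real_Asymp.Real_Asymp"
begin

section \<open>Fourier integrals\<close>

text \<open>The steps have two moments and possibly no density, so no local limit theorem is
  available in a form that covers all cases. Writing |x| as an integral of (1 - cos (t * x)) / t^2
  replaces it: the mean of any combination of absolute values of the walk becomes a Fourier integral
  in powers of the characteristic function, and the start enters only as a phase of modulus one. A
  crossing indicator is no such combination; as a jump function it has a transform decaying only
  like 1 / |t|. Averaging the level over [- h, 0] turns it into a second difference of absolute
  values, at the price of visits to (- h, 0). How rare these are is an arithmetic question: a
  nonlattice walk seldom visits a short interval, wherever it starts, and a walk on a lattice avoids
  the interval altogether for small h. The hypothesis on \<open>x\<close> enters there. The constant
  \<kappa> is forced: only for this value does the symbol vanish at the origin, where the sums of
  powers concentrate a mass of order sqrt n. Uniformity in the start matters because the second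
  moment restarts the walk at a random position.\<close>

lemma has_bochner_integral_one_minus_cos_over_square_Ioi:
  "set_integrable lborel {0<..} (\<lambda>t::real. (1 - cos t) / t\<^sup>2)"
  "(LINT t:{0<..}|lborel. (1 - cos t) / t\<^sup>2) = pi / 2"
proof -
  \<comment> \<open>Integration by parts against - 1 / t leads to the Dirichlet integral:
    \<open>Si\<close> carries the value pi / 2, and the boundary term vanishes at both ends.\<close>
  define F where "F = (\<lambda>t::real. Si t - (1 - cos t) / t)"
  have F: "DERIV F t :> (1 - cos t) / t\<^sup>2" if "t > 0" for t
    unfolding F_def using that
    by (auto intro!: derivative_eq_intros DERIV_Si simp: field_simps power2_eq_square)
  have "(\<lambda>t::real. (1 - cos t) / t) \<midarrow>0\<rightarrow> 0"
    using DERIV_cos[of 0] tendsto_minus[of "\<lambda>h. (cos h - 1) / h" 0 "at (0::real)"]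
    by (simp add: DERIV_def minus_divide_left)
  moreover have "(Si \<longlongrightarrow> Si 0) (at 0)"
    using isCont_Si[of 0] by (simp add: isCont_def)
  ultimately have "(F \<longlongrightarrow> Si 0 - 0) (at 0)"
    unfolding F_def by (intro tendsto_diff)
  moreover have "Si 0 = 0"
    unfolding Si_alt_def by (simp add: zero_ereal_def)
  ultimately have A: "(F \<longlongrightarrow> 0) (at_right 0)"
    by (simp add: filterlim_at_split)
  have "((\<lambda>t::real. (1 - cos t) / t) \<longlongrightarrow> 0) at_top"
  proof (rule Lim_null_comparison)
    show "\<forall>\<^sub>F t in at_top. norm ((1 - cos t) / t) \<le> 2 / (t::real)"
      using eventually_gt_at_top[of 0]
    proof eventually_elim
      case (elim t)
      have "1 - cos t \<le> 2" using cos_ge_minus_one[of t] by linarith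
      then show ?case using elim by (simp add: divide_right_mono)
    qed
    show "((\<lambda>t::real. 2 / t) \<longlongrightarrow> 0) at_top"
      by (intro tendsto_divide_0[OF tendsto_const] filterlim_at_top_imp_at_infinity filterlim_ident)
  qed
  then have B: "(F \<longlongrightarrow> pi / 2) at_top"
    unfolding F_def using tendsto_diff[OF Si_at_top] by fastforce
  have *: "set_integrable lborel (einterval 0 \<infinity>) (\<lambda>t::real. (1 - cos t) / t\<^sup>2)"
      "(LBINT t=0..\<infinity>. (1 - cos t) / t\<^sup>2) = pi / 2 - 0"
    using F A B
    by (intro interval_integral_FTC_nonneg[of 0 \<infinity> F];
        auto simp: ereal_tendsto_simps zero_ereal_def intro!: continuous_intros)+
  show "set_integrable lborel {0<..} (\<lambda>t::real. (1 - cos t) / t\<^sup>2)"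
    using *(1) by (simp add: zero_ereal_def)
  show "(LINT t:{0<..}|lborel. (1 - cos t) / t\<^sup>2) = pi / 2"
    using *(2) unfolding zero_ereal_def interval_integral_to_infinity_eq by simp
qed

lemma has_bochner_integral_even:
  fixes f :: "real \<Rightarrow> real"
  assumes "set_integrable lborel {0<..} f" "\<And>x. f (- x) = f x" "f \<in> borel_measurable borel"
  shows "has_bochner_integral lborel f (2 * (LINT x:{0<..}|lborel. f x))"
proof -
  let ?f = "\<lambda>x. indicator {0<..} x *\<^sub>R f x"
  have i: "integrable lborel ?f"
    using assms(1) by (simp add: set_integrable_def)
  have i': "integrable lborel (\<lambda>x. ?f (0 + (-1) * x))"
    by (rule lborel_integrable_real_affine[OF i]) simp
  have e: "integral\<^sup>L lborel (\<lambda>x. ?f (0 + (-1) * x)) = integral\<^sup>L lborel ?f"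
    by (subst (2) lborel_integral_real_affine[where c="-1" and t=0]) auto
  have "has_bochner_integral lborel (\<lambda>x. ?f x + ?f (0 + (-1) * x))
    (integral\<^sup>L lborel ?f + integral\<^sup>L lborel ?f)"
    using i i' e by (intro has_bochner_integral_add) (auto simp: has_bochner_integral_iff)
  \<comment> \<open>Both half-line indicators vanish at 0, so the two sides agree only away from
    that point.\<close>
  moreover have ae: "AE x in lborel. ?f x + ?f (0 + (-1) * x) = f x"
    using AE_lborel_singleton[of 0] by eventually_elim (auto simp: assms(2) indicator_def)
  ultimately have "has_bochner_integral lborel f (integral\<^sup>L lborel ?f + integral\<^sup>L lborel ?f)"
    using assms(3) by (subst (asm) has_bochner_integral_cong_AE[OF _ _ ae]) auto
  then show ?thesis
    by (simp add: set_lebesgue_integral_def)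
qed

text \<open>Scaling of the case x = 1. This is the bridge from absolute values to characteristic
  functions: averaging the integrand over a random x involves only means of cosines.\<close>

lemma has_bochner_integral_one_minus_cos_over_square:
  "has_bochner_integral lborel (\<lambda>t::real. (1 - cos (t * x)) / t\<^sup>2) (pi * \<bar>x\<bar>)"
proof (cases "x = 0")
  case False
  let ?f = "\<lambda>t::real. (1 - cos t) / t\<^sup>2"
  have *: "has_bochner_integral lborel ?f pi"
    using has_bochner_integral_even[OF has_bochner_integral_one_minus_cos_over_square_Ioi(1)]
    by (simp add: has_bochner_integral_one_minus_cos_over_square_Ioi(2))
  have "has_bochner_integral lborel (\<lambda>t. ?f (0 + x * t)) (pi / \<bar>x\<bar>)"
    using lborel_integral_real_affine[of x ?f 0] lborel_integrable_real_affine[of ?f x 0] * False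
    by (auto simp: has_bochner_integral_iff field_simps)
  then have "has_bochner_integral lborel (\<lambda>t. x\<^sup>2 * ?f (0 + x * t)) (x\<^sup>2 * (pi / \<bar>x\<bar>))"
    by (rule has_bochner_integral_mult_right)
  moreover have "x\<^sup>2 * (pi / \<bar>x\<bar>) = pi * \<bar>x\<bar>"
    using False by (simp add: power2_eq_square abs_if)
  moreover have "(\<lambda>t. x\<^sup>2 * ?f (0 + x * t)) = (\<lambda>t. (1 - cos (t * x)) / t\<^sup>2)"
    using False by (auto simp: fun_eq_iff power_mult_distrib mult.commute)
  ultimately show ?thesis by simp
qed (simp add: has_bochner_integral_iff)

text \<open>The tent \<open>max 0 (v - w)\<close> is half the second difference of the absolute
  value at w with span v, and the addition formulas give the same second difference of
  cosines.\<close>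

lemma has_bochner_integral_cos_mult_one_minus_cos:
  assumes "v \<ge> 0" "w \<ge> 0"
  shows "has_bochner_integral lborel (\<lambda>t::real. cos (t * w) * (1 - cos (t * v)) / t\<^sup>2) (pi * max 0 (v - w))"
proof -
  let ?g = "\<lambda>x t::real. (1 - cos (t * x)) / t\<^sup>2"
  have "has_bochner_integral lborel (\<lambda>t. (?g (w + v) t + ?g (w - v) t) / 2 - ?g w t)
     ((pi * \<bar>w + v\<bar> + pi * \<bar>w - v\<bar>) / 2 - pi * \<bar>w\<bar>)"
    by (intro has_bochner_integral_diff has_bochner_integral_add has_bochner_integral_divide
        has_bochner_integral_one_minus_cos_over_square)
  moreover have "(?g (w + v) t + ?g (w - v) t) / 2 - ?g w t = cos (t * w) * (1 - cos (t * v)) / t\<^sup>2" for t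
    by (cases "t = 0") (simp_all add: field_simps cos_add cos_diff)
  moreover have "(pi * \<bar>w + v\<bar> + pi * \<bar>w - v\<bar>) / 2 - pi * \<bar>w\<bar> = pi * max 0 (v - w)"
    using assms by (auto simp: max_def field_simps)
  ultimately show ?thesis by simp
qed

lemma tendsto_exp_neg_mult_at_top:
  fixes c :: real assumes "c > 0" shows "((\<lambda>v. exp (- c * v)) \<longlongrightarrow> 0) at_top"
  using assms by real_asymp

text \<open>The inner integral in the Fubini argument for the Cauchy density. As the integrand is
  nonnegative, a primitive vanishing at infinity yields integrability and value together.\<close>

lemma integral_exp_neg_mult_one_minus_cos:
  fixes l t :: real
  assumes l: "l > 0"
  shows "(LBINT v. indicator {0..} v * (exp (- l * v) * (1 - cos (t * v)))) = t\<^sup>2 / (l * (l\<^sup>2 + t\<^sup>2))"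
proof -
  define F where "F v = - exp (- l * v) / l - exp (- l * v) * (t * sin (t * v) - l * cos (t * v)) / (l\<^sup>2 + t\<^sup>2)" for v
  have nz: "l\<^sup>2 + t\<^sup>2 > 0" using l by (simp add: add_pos_nonneg)
  have F: "DERIV F v :> exp (- l * v) * (1 - cos (t * v))" for v
  proof -
    have "DERIV F v :> exp (- l * v) - (exp (- l * v) * (t * (cos (t * v) * t) + l * (sin (t * v) * t))
      - l * exp (- l * v) * (t * sin (t * v) - l * cos (t * v))) / (l\<^sup>2 + t\<^sup>2)"
      unfolding F_def using l nz by (auto intro!: derivative_eq_intros)
    also have "exp (- l * v) - (exp (- l * v) * (t * (cos (t * v) * t) + l * (sin (t * v) * t))
      - l * exp (- l * v) * (t * sin (t * v) - l * cos (t * v))) / (l\<^sup>2 + t\<^sup>2)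
       = exp (- l * v) - (l\<^sup>2 + t\<^sup>2) * (exp (- l * v) * cos (t * v)) / (l\<^sup>2 + t\<^sup>2)"
      by (simp add: algebra_simps power2_eq_square)
    also have "\<dots> = exp (- l * v) * (1 - cos (t * v))"
      using nz by (subst nonzero_mult_div_cancel_left) (auto simp: right_diff_distrib)
    finally show ?thesis .
  qed
  have b: "((\<lambda>v. exp (- l * v) * (t * sin (t * v) - l * cos (t * v))) \<longlongrightarrow> 0) at_top"
  proof (rule Lim_null_comparison)
    show "\<forall>\<^sub>F v in at_top. norm (exp (- l * v) * (t * sin (t * v) - l * cos (t * v))) \<le> exp (- l * v) * (\<bar>t\<bar> + l)"
    proof (intro always_eventually allI)
      fix v
      have "\<bar>t * sin (t * v) - l * cos (t * v)\<bar> \<le> \<bar>t * sin (t * v)\<bar> + \<bar>l * cos (t * v)\<bar>" by simp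
      also have "\<dots> \<le> \<bar>t\<bar> + l"
        using l by (intro add_mono) (auto simp: abs_mult intro: mult_left_le)
      finally show "norm (exp (- l * v) * (t * sin (t * v) - l * cos (t * v))) \<le> exp (- l * v) * (\<bar>t\<bar> + l)"
        by (simp add: abs_mult)
    qed
    show "((\<lambda>v. exp (- l * v) * (\<bar>t\<bar> + l)) \<longlongrightarrow> 0) at_top"
      using tendsto_mult_right[OF tendsto_exp_neg_mult_at_top[OF l], of "\<bar>t\<bar> + l"] by simp
  qed
  have "(F \<longlongrightarrow> - 0 / l - 0 / (l\<^sup>2 + t\<^sup>2)) at_top"
    unfolding F_def using l nz
    by (intro tendsto_diff tendsto_divide tendsto_minus tendsto_const b tendsto_exp_neg_mult_at_top) auto
  then have lim: "(F \<longlongrightarrow> 0) at_top" by simp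
  have "(\<integral>\<^sup>+v. ennreal (exp (- l * v) * (1 - cos (t * v))) * indicator {0..} v \<partial>lborel) = ennreal (0 - F 0)"
    by (rule nn_integral_FTC_atLeast[OF _ F _ lim]) auto
  moreover have "(\<integral>\<^sup>+v. ennreal (exp (- l * v) * (1 - cos (t * v))) * indicator {0..} v \<partial>lborel)
      = (\<integral>\<^sup>+v. ennreal (indicator {0..} v * (exp (- l * v) * (1 - cos (t * v)))) \<partial>lborel)"
    by (intro nn_integral_cong) (auto split: split_indicator)
  moreover have F0: "0 - F 0 = t\<^sup>2 / (l * (l\<^sup>2 + t\<^sup>2))"
  proof -
    have "0 - F 0 = 1 / l - l / (l\<^sup>2 + t\<^sup>2)" by (simp add: F_def)
    also have "\<dots> = t\<^sup>2 / (l * (l\<^sup>2 + t\<^sup>2))" using l nz by (simp add: divide_simps) (simp add: algebra_simps power2_eq_square)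
    finally show ?thesis .
  qed
  ultimately have "has_bochner_integral lborel (\<lambda>v. indicator {0..} v * (exp (- l * v) * (1 - cos (t * v)))) (t\<^sup>2 / (l * (l\<^sup>2 + t\<^sup>2)))"
    using l nz by (intro has_bochner_integral_nn_integral) auto
  then show ?thesis
    by (rule has_bochner_integral_integral_eq)
qed

text \<open>Exhibits \<open>exp (- l * w)\<close> as a positive mixture of tents, in the manner of
  Polya, so that its Fourier representation follows from that of the tents.\<close>

lemma has_bochner_integral_exp_neg_mult_excess:
  fixes l w :: real
  assumes l: "l > 0" and w: "w \<ge> 0"
  shows "has_bochner_integral lborel (\<lambda>v. indicator {0..} v * (exp (- l * v) * max 0 (v - w))) (exp (- l * w) / l\<^sup>2)"
proof -
  define F where "F v = - (v - w) * exp (- l * v) / l - exp (- l * v) / l\<^sup>2" for v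
  have F: "DERIV F v :> exp (- l * v) * (v - w)" for v
    unfolding F_def using l by (auto intro!: derivative_eq_intros simp: field_simps power2_eq_square)
  have lim: "(F \<longlongrightarrow> 0) at_top"
    unfolding F_def using l by real_asymp
  have "(\<integral>\<^sup>+v. ennreal (exp (- l * v) * (v - w)) * indicator {w..} v \<partial>lborel) = ennreal (0 - F w)"
    by (rule nn_integral_FTC_atLeast[OF _ F _ lim]) auto
  moreover have "(\<integral>\<^sup>+v. ennreal (exp (- l * v) * (v - w)) * indicator {w..} v \<partial>lborel)
      = (\<integral>\<^sup>+v. ennreal (indicator {0..} v * (exp (- l * v) * max 0 (v - w))) \<partial>lborel)"
    using w by (intro nn_integral_cong) (auto split: split_indicator simp: max_def)
  ultimately show ?thesis
    by (intro has_bochner_integral_nn_integral) (auto simp: F_def)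
qed

text \<open>Mixing the tent identity over v with weight exp (- l * v) gives a multiple of
  \<open>exp (- l * w)\<close> on one side; on the other, the integral over v carries a factor t^2
  that cancels the one in the denominator and leaves the Cauchy kernel.\<close>

lemma has_bochner_integral_cos_cauchy_density:
  fixes l w :: real
  assumes l: "l > 0" and w: "w \<ge> 0"
  shows "has_bochner_integral lborel (\<lambda>t. cos (t * w) * (l / (pi * (l\<^sup>2 + t\<^sup>2)))) (exp (- l * w))"
proof -
  define f where "f v t = indicator {0..} v * exp (- l * v) * (cos (t * w) * (1 - cos (t * v)) / t\<^sup>2)" for v t :: real
  have [measurable]: "case_prod f \<in> borel_measurable (lborel \<Otimes>\<^sub>M lborel)"
    unfolding f_def by measurable
  have in1: "has_bochner_integral lborel (f v) (pi * (indicator {0..} v * (exp (- l * v) * max 0 (v - w))))" for v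
  proof (cases "v \<ge> 0")
    case True
    show ?thesis
      unfolding f_def using has_bochner_integral_mult_right[OF has_bochner_integral_cos_mult_one_minus_cos[OF True w], of "exp (- l * v)"] True
      by (simp add: mult_ac)
  qed (simp add: f_def[abs_def] has_bochner_integral_iff)
  \<comment> \<open>Dropping the cosine leaves the case w = 0, which supplies the majorant for
    Fubini.\<close>
  have le: "(LBINT t. norm (f v t)) \<le> pi * (indicator {0..} v * (exp (- l * v) * max 0 (v - 0)))" for v
  proof -
    have "(LBINT t. norm (f v t)) \<le> (LBINT t. indicator {0..} v * exp (- l * v) * ((1 - cos (t * v)) / t\<^sup>2))"
    proof (intro integral_mono)
      show "integrable lborel (\<lambda>t. norm (f v t))" using in1 by (auto simp: has_bochner_integral_iff)
      show "integrable lborel (\<lambda>t. indicator {0..} v * exp (- l * v) * ((1 - cos (t * v)) / t\<^sup>2))"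
        using has_bochner_integral_one_minus_cos_over_square[of v]
        by (intro integrable_mult_right) (auto simp: has_bochner_integral_iff)
      show "norm (f v t) \<le> indicator {0..} v * exp (- l * v) * ((1 - cos (t * v)) / t\<^sup>2)" for t
        unfolding f_def real_norm_def abs_mult abs_divide
        by (auto simp: abs_mult intro!: mult_left_mono divide_right_mono mult_left_le_one_le)
    qed
    also have "\<dots> = indicator {0..} v * exp (- l * v) * (pi * \<bar>v\<bar>)"
      using has_bochner_integral_one_minus_cos_over_square[of v]
      by (subst integral_mult_right_zero) (auto simp: has_bochner_integral_iff)
    also have "\<dots> = pi * (indicator {0..} v * (exp (- l * v) * max 0 (v - 0)))"
      by (auto split: split_indicator)
    finally show ?thesis .
  qed
  have int: "integrable (lborel \<Otimes>\<^sub>M lborel) (case_prod f)"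
  proof (rule lborel_pair.Fubini_integrable)
    show "integrable lborel (\<lambda>v. LBINT t. norm (case_prod f (v, t)))"
    proof (rule Bochner_Integration.integrable_bound)
      show "integrable lborel (\<lambda>v. pi * (indicator {0..} v * (exp (- l * v) * max 0 (v - 0))))"
        using has_bochner_integral_exp_neg_mult_excess[OF l, of 0] by (auto simp: has_bochner_integral_iff)
      show "AE v in lborel. norm (LBINT t. norm (case_prod f (v, t))) \<le> norm (pi * (indicator {0..} v * (exp (- l * v) * max 0 (v - 0))))"
      proof (intro AE_I2)
        fix v :: real
        have "0 \<le> (LBINT t. norm (f v t))" by (intro Bochner_Integration.integral_nonneg) simp
        then show "norm (LBINT t. norm (case_prod f (v, t))) \<le> norm (pi * (indicator {0..} v * (exp (- l * v) * max 0 (v - 0))))"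
          using le[of v] by simp
      qed
    qed measurable
    show "AE v in lborel. integrable lborel (\<lambda>t. case_prod f (v, t))"
      using in1 by (auto simp: has_bochner_integral_iff)
  qed measurable
  have in2: "AE t in lborel. (LBINT v. f v t) = cos (t * w) / (l * (l\<^sup>2 + t\<^sup>2))"
    using AE_lborel_singleton[of 0]
  proof eventually_elim
    case (elim t)
    have "(LBINT v. f v t) = (LBINT v. (cos (t * w) / t\<^sup>2) * (indicator {0..} v * (exp (- l * v) * (1 - cos (t * v)))))"
      unfolding f_def by (intro Bochner_Integration.integral_cong) (auto simp: mult_ac)
    also have "\<dots> = (cos (t * w) / t\<^sup>2) * (t\<^sup>2 / (l * (l\<^sup>2 + t\<^sup>2)))"
      using integral_exp_neg_mult_one_minus_cos[OF l, of t] by simp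
    finally show ?case using elim by simp
  qed
  have "(LBINT t. LBINT v. f v t) = (LBINT v. LBINT t. f v t)"
    by (rule lborel_pair.Fubini_integral[OF int])
  also have "\<dots> = pi * (exp (- l * w) / l\<^sup>2)"
    using in1 has_bochner_integral_exp_neg_mult_excess[OF l w]
    by (simp add: has_bochner_integral_iff)
  finally have "(LBINT t. LBINT v. f v t) = pi * (exp (- l * w) / l\<^sup>2)" .
  then have "has_bochner_integral lborel (\<lambda>t. LBINT v. f v t) (pi * (exp (- l * w) / l\<^sup>2))"
    using lborel_pair.integrable_snd[OF int] by (simp add: has_bochner_integral_iff)
  then have "has_bochner_integral lborel (\<lambda>t. cos (t * w) / (l * (l\<^sup>2 + t\<^sup>2))) (pi * (exp (- l * w) / l\<^sup>2))"
    by (subst (asm) has_bochner_integral_cong_AE[OF _ _ in2]) auto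
  from has_bochner_integral_mult_right[OF this, of "l\<^sup>2 / pi"] show ?thesis
    using l by (simp add: power2_eq_square mult_ac)
qed

text \<open>Since sin (t * x) / t is the integral of cos (t * v) over v in [0, x], this is the
  cosine identity integrated over that interval and multiplied by l.\<close>

lemma has_bochner_integral_sin_cauchy_density:
  fixes l x :: real
  assumes l: "l > 0" and x: "x \<ge> 0"
  shows "has_bochner_integral lborel (\<lambda>t. l * sin (t * x) / t * (l / (pi * (l\<^sup>2 + t\<^sup>2)))) (1 - exp (- l * x))"
proof -
  define m where "m t = l / (pi * (l\<^sup>2 + t\<^sup>2))" for t :: real
  have m: "integrable lborel m" and m0: "m t \<ge> 0" for t
    using has_bochner_integral_cos_cauchy_density[OF l, of 0] l by (auto simp: m_def[abs_def] has_bochner_integral_iff)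
  have [measurable]: "m \<in> borel_measurable borel" unfolding m_def by measurable
  define f where "f v t = indicator {0..x} v * (cos (t * v) * m t)" for v t :: real
  have [measurable]: "case_prod f \<in> borel_measurable (lborel \<Otimes>\<^sub>M lborel)"
    unfolding f_def by measurable
  have in1: "has_bochner_integral lborel (f v) (indicator {0..x} v *\<^sub>R exp (- l * v))" for v
    unfolding f_def m_def using has_bochner_integral_cos_cauchy_density[OF l, of v]
    by (auto split: split_indicator)
  have int: "integrable (lborel \<Otimes>\<^sub>M lborel) (case_prod f)"
  proof (rule Bochner_Integration.integrable_bound)
    show "integrable (lborel \<Otimes>\<^sub>M lborel) (\<lambda>(v, t). indicator {0..x} v * m t)"
    proof (rule lborel_pair.Fubini_integrable)
      show "integrable lborel (\<lambda>v. LBINT t. norm (case (v, t) of (v, t) \<Rightarrow> indicat_real {0..x} v * m t))"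
        using m0 x integrable_real_indicator[of "{0..x}" lborel] by (simp add: abs_mult)
      show "AE v in lborel. integrable lborel (\<lambda>t. case (v, t) of (v, t) \<Rightarrow> indicator {0..x} v * m t)"
        using m by auto
    qed measurable
    show "AE z in lborel \<Otimes>\<^sub>M lborel. norm (case_prod f z) \<le> norm (case z of (v, t) \<Rightarrow> indicat_real {0..x} v * m t)"
      using m0 by (auto simp: f_def abs_mult mult_left_le_one_le split: split_indicator intro!: AE_I2)
  qed measurable
  have in2: "AE t in lborel. (LBINT v. f v t) = sin (t * x) / t * m t"
    using AE_lborel_singleton[of 0]
  proof eventually_elim
    case (elim t)
    have "(LBINT v. f v t) = m t * (LBINT v. cos (t * v) * indicator {0..x} v)"
      unfolding f_def by (subst integral_mult_right_zero[symmetric]) (simp add: mult_ac)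
    also have "(LBINT v. cos (t * v) * indicator {0..x} v) = sin (t * x) / t - sin (t * 0) / t"
      using elim by (intro integral_FTC_Icc_real[OF x]) (auto intro!: derivative_eq_intros)
    finally show ?case by simp
  qed
  have "(LBINT v. exp (- l * v) * indicator {0..x} v) = - exp (- l * x) / l - (- exp (- l * 0) / l)"
    using l by (intro integral_FTC_Icc_real[OF x]) (auto intro!: derivative_eq_intros)
  then have "(LBINT t. LBINT v. f v t) = (1 - exp (- l * x)) / l"
    unfolding lborel_pair.Fubini_integral[OF int]
    using in1 by (simp add: has_bochner_integral_iff mult.commute diff_divide_distrib)
  then have "has_bochner_integral lborel (\<lambda>t. LBINT v. f v t) ((1 - exp (- l * x)) / l)"
    using lborel_pair.integrable_snd[OF int] by (simp add: has_bochner_integral_iff)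
  then have "has_bochner_integral lborel (\<lambda>t. sin (t * x) / t * m t) ((1 - exp (- l * x)) / l)"
    by (subst (asm) has_bochner_integral_cong_AE[OF _ _ in2]) auto
  from has_bochner_integral_mult_right[OF this, of l] show ?thesis
    using l unfolding m_def by (simp add: mult_ac)
qed

section \<open>Crossings, overshoots and reflected modes\<close>

definition level_crossing :: "real \<Rightarrow> real \<Rightarrow> real" where
  "level_crossing s t = of_bool ((s < 0) \<noteq> (t < 0))"

definition overshoot :: "real \<Rightarrow> real \<Rightarrow> real" where
  "overshoot s t = \<bar>t\<bar> * level_crossing s t"

definition side :: "real \<Rightarrow> real" where
  "side s = (if s < 0 then -1 else 1)"

lemma level_crossing_measurable [measurable]: "case_prod level_crossing \<in> borel_measurable (borel \<Otimes>\<^sub>M borel)"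
  unfolding level_crossing_def of_bool_def by measurable

lemma overshoot_measurable [measurable]: "case_prod overshoot \<in> borel_measurable (borel \<Otimes>\<^sub>M borel)"
  unfolding overshoot_def by measurable

lemma side_measurable [measurable]: "side \<in> borel_measurable borel"
  unfolding side_def by measurable

text \<open>The product \<open>side s * t\<close> is |t| without a crossing and - |t| with one,
  hence the correction by twice |t|. Counting 0 to the nonnegative side agrees with
  \<open>crosses_zero_at\<close>.\<close>

lemma abs_eq_side_plus_overshoot: "\<bar>t\<bar> = \<bar>s\<bar> + side s * (t - s) + 2 * overshoot s t"
  by (auto simp: side_def overshoot_def level_crossing_def)

lemma level_crossing_bounds: "0 \<le> level_crossing s t" "level_crossing s t \<le> 1"
  by (auto simp: level_crossing_def)

lemma overshoot_nonneg: "0 \<le> overshoot s t"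
  by (auto simp: overshoot_def level_crossing_def)

text \<open>Finite crossing times enumerate the crossing indices, so the maximum in
  \<^const>\<open>num_crossings\<close> is a cardinality.\<close>

lemma crossing_time_Suc_le_iff:
  "crossing_time s (Suc k) \<le> enat n \<longleftrightarrow>
     (\<exists>m\<le>n. crossing_time s k < enat m \<and> crosses_zero_at s m)"
proof -
  let ?A = "{enat m |m. crossing_time s k < enat m \<and> crosses_zero_at s m}"
  have "Inf ?A \<in> ?A" if "Inf ?A \<le> enat n"
  proof -
    have ne: "?A \<noteq> {}"
    proof
      assume "?A = {}"
      with that show False unfolding Inf_enat_def by simp
    qed
    then obtain a where "a \<in> ?A" by blast
    then have "(LEAST x. x \<in> ?A) \<in> ?A" by (rule LeastI[of "\<lambda>x. x \<in> ?A"])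
    then show ?thesis unfolding Inf_enat_def using ne by (simp only: if_False)
  qed
  moreover have "Inf ?A \<le> enat n" if "m \<le> n" "crossing_time s k < enat m" "crosses_zero_at s m" for m
    using that by (intro Inf_lower2[of "enat m"]) auto
  ultimately show ?thesis
    unfolding crossing_time.simps by (smt (verit, ccfv_threshold) enat_ord_simps(1) mem_Collect_eq)
qed

text \<open>Induction on the horizon with k arbitrary: crossing number \<open>Suc j\<close> is
  gained at the new step exactly when that step crosses and the j-th crossing has already occurred,
  which is the induction hypothesis for j.\<close>

lemma crossing_time_le_iff:
  "crossing_time s k \<le> enat n \<longleftrightarrow> k \<le> card {m \<in> {1..n}. crosses_zero_at s m}"
proof (induction n arbitrary: k)
  case 0
  have "\<not> crossing_time s (Suc j) \<le> enat 0" for j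
    unfolding crossing_time_Suc_le_iff by (auto simp: enat_0)
  then show ?case by (cases k) (auto simp: enat_0)
next
  case (Suc n)
  let ?C = "\<lambda>n. {m \<in> {1..n}. crosses_zero_at s m}"
  have fin: "finite (?C n)" by simp
  have C: "card (?C (Suc n)) = card (?C n) + of_bool (crosses_zero_at s (Suc n))"
  proof (cases "crosses_zero_at s (Suc n)")
    case True
    then have "?C (Suc n) = insert (Suc n) (?C n)" by (auto simp: le_Suc_eq)
    then show ?thesis using True by simp
  next
    case False
    then have "?C (Suc n) = ?C n" by (auto simp: le_Suc_eq)
    then show ?thesis using False by simp
  qed
  show ?case
  proof (cases k)
    case 0 then show ?thesis by simp
  next
    case (Suc j)
    have "crossing_time s (Suc j) \<le> enat (Suc n) \<longleftrightarrow>
       crossing_time s (Suc j) \<le> enat n \<or> (crossing_time s j < enat (Suc n) \<and> crosses_zero_at s (Suc n))"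
      unfolding crossing_time_Suc_le_iff by (auto simp: le_Suc_eq)
    also have "crossing_time s j < enat (Suc n) \<longleftrightarrow> crossing_time s j \<le> enat n"
      by (cases "crossing_time s j") auto
    finally show ?thesis
      unfolding Suc Suc.IH C by auto
  qed
qed

lemma num_crossings_eq_sum: "real (num_crossings s n) = (\<Sum>k<n. level_crossing (s k) (s (Suc k)))"
proof -
  have "num_crossings s n = Max {..card {m \<in> {1..n}. crosses_zero_at s m}}"
    by (simp add: num_crossings_def crossing_time_le_iff atMost_def)
  also have "\<dots> = card {m \<in> {1..n}. crosses_zero_at s m}"
    by (intro Max_eqI) auto
  also have "{m \<in> {1..n}. crosses_zero_at s m} = Suc ` {k \<in> {..<n}. crosses_zero_at s (Suc k)}"
  proof -
    have "m \<in> Suc ` {k \<in> {..<n}. crosses_zero_at s (Suc k)}" if "m \<in> {1..n}" "crosses_zero_at s m" for m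
      using that by (cases m) auto
    then show ?thesis by auto
  qed
  also have "card \<dots> = (\<Sum>k<n. of_bool (crosses_zero_at s (Suc k)))"
    by (simp add: card_image) (intro arg_cong[where f=card], auto)
  finally have "real (num_crossings s n) = (\<Sum>k<n. of_bool (crosses_zero_at s (Suc k)))"
    by (simp del: sum_of_bool_eq)
  also have "\<dots> = (\<Sum>k<n. level_crossing (s k) (s (Suc k)))"
    by (intro sum.cong) (auto simp: level_crossing_def crosses_zero_at_def)
  finally show ?thesis .
qed

text \<open>For a reflected Brownian motion \<open>x\<close> with local time \<open>L\<close> at \<open>0\<close>, the process
  \<open>exp (m\<^sup>2 * t / 2) * exp (- l * L) * reflected_mode l m x\<close> is a martingale, because the slope of
  \<open>reflected_mode l m\<close> at \<open>0\<close> is \<open>l\<close>. The extension to negative arguments accounts for the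
  reflection of a step across \<open>0\<close>, which adds twice its overshoot to \<open>L\<close>; it is continuously
  differentiable at \<open>0\<close>.\<close>

definition reflected_mode :: "real \<Rightarrow> real \<Rightarrow> real \<Rightarrow> real" where
  "reflected_mode l m x = cos (m * x) + l * sin (m * x) / m"

definition reflected_mode_ext :: "real \<Rightarrow> real \<Rightarrow> real \<Rightarrow> real" where
  "reflected_mode_ext l m u = (if u < 0 then exp (2 * l * u) * reflected_mode l m (- u) else reflected_mode l m u)"

lemma reflected_mode_measurable [measurable]: "reflected_mode l m \<in> borel_measurable borel"
  unfolding reflected_mode_def by measurable

lemma reflected_mode_ext_measurable [measurable]: "reflected_mode_ext l m \<in> borel_measurable borel"
  unfolding reflected_mode_ext_def by measurable

definition reflected_mode_deriv :: "real \<Rightarrow> real \<Rightarrow> real \<Rightarrow> real" where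
  "reflected_mode_deriv l m x = l * cos (m * x) - m * sin (m * x)"

lemma reflected_mode_deriv_measurable [measurable]: "reflected_mode_deriv l m \<in> borel_measurable borel"
  unfolding reflected_mode_deriv_def by measurable

text \<open>Two bounds for two uses: for fixed m the first is uniform in the position and bounds the
  one-step recursion; the second has no singularity at m = 0 and survives the integration over
  m.\<close>

lemma abs_reflected_mode_le:
  assumes "m \<noteq> 0" "l > 0"
  shows "\<bar>reflected_mode l m x\<bar> \<le> 1 + l / \<bar>m\<bar>" "\<bar>reflected_mode l m x\<bar> \<le> 1 + l * \<bar>x\<bar>"
proof -
  have *: "\<bar>reflected_mode l m x\<bar> \<le> \<bar>cos (m * x)\<bar> + l * (\<bar>sin (m * x)\<bar> / \<bar>m\<bar>)"
    unfolding reflected_mode_def using assms(2)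
    by (intro order_trans[OF abs_triangle_ineq]) (simp add: abs_mult abs_divide)
  have "\<bar>sin (m * x)\<bar> / \<bar>m\<bar> \<le> 1 / \<bar>m\<bar>"
    by (intro divide_right_mono) auto
  then have "l * (\<bar>sin (m * x)\<bar> / \<bar>m\<bar>) \<le> l * (1 / \<bar>m\<bar>)" using assms by (intro mult_left_mono) auto
  then have "l * (\<bar>sin (m * x)\<bar> / \<bar>m\<bar>) \<le> l / \<bar>m\<bar>" by simp
  then show "\<bar>reflected_mode l m x\<bar> \<le> 1 + l / \<bar>m\<bar>" using * abs_cos_le_one[of "m * x"] by linarith
  have "\<bar>sin (m * x)\<bar> / \<bar>m\<bar> \<le> \<bar>x\<bar>"
    using abs_sin_x_le_abs_x[of "m * x"] assms by (simp add: abs_mult divide_le_eq mult.commute)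
  then have "l * (\<bar>sin (m * x)\<bar> / \<bar>m\<bar>) \<le> l * \<bar>x\<bar>" using assms by (intro mult_left_mono) auto
  then show "\<bar>reflected_mode l m x\<bar> \<le> 1 + l * \<bar>x\<bar>" using * abs_cos_le_one[of "m * x"] by linarith
qed

text \<open>Both orders of remainder are recorded because the steps have only a second moment: the
  cubic bound makes small steps negligible, the quadratic one keeps large steps integrable.\<close>

lemma sinusoid_taylor:
  fixes a b m :: real
  defines "f \<equiv> (\<lambda>x. a * cos (m * x) + b * sin (m * x))"
  defines "f' \<equiv> (\<lambda>x. m * (b * cos (m * x) - a * sin (m * x)))"
  shows "\<bar>f (x + h) - f x - h * f' x\<bar> \<le> m\<^sup>2 * (\<bar>a\<bar> + \<bar>b\<bar>) * h\<^sup>2 / 2"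
    and "\<bar>f (x + h) - f x - h * f' x + h\<^sup>2 * m\<^sup>2 * f x / 2\<bar> \<le> \<bar>m\<bar> ^ 3 * (\<bar>a\<bar> + \<bar>b\<bar>) * \<bar>h\<bar> ^ 3 / 6"
proof -
  \<comment> \<open>The second derivative is - m^2 times the function, so four entries suffice for
    Taylor's theorem of order three.\<close>
  define d where "d k x = (case k of 0 \<Rightarrow> f x | Suc 0 \<Rightarrow> f' x | Suc (Suc 0) \<Rightarrow> - m\<^sup>2 * f x | _ \<Rightarrow> - m\<^sup>2 * f' x)" for k :: nat and x
  have d0: "d 0 = f" by (auto simp: d_def)
  have D0: "DERIV f x :> f' x" for x unfolding f_def f'_def
    by (auto intro!: derivative_eq_intros simp: algebra_simps)
  have D1: "DERIV f' x :> - m\<^sup>2 * f x" for x unfolding f_def f'_def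
    by (auto intro!: derivative_eq_intros simp: algebra_simps power2_eq_square)
  have D2: "DERIV (\<lambda>x. - m\<^sup>2 * f x) x :> - m\<^sup>2 * f' x" for x
    by (intro DERIV_cmult D0)
  have f: "\<bar>f x\<bar> \<le> \<bar>a\<bar> + \<bar>b\<bar>" for x
    unfolding f_def by (rule order_trans[OF abs_triangle_ineq], rule add_mono) (auto simp: abs_mult intro: mult_left_le)
  have f': "\<bar>f' x\<bar> \<le> \<bar>m\<bar> * (\<bar>a\<bar> + \<bar>b\<bar>)" for x
    unfolding f'_def abs_mult
    by (intro mult_left_mono, rule order_trans[OF abs_triangle_ineq4], subst add.commute, rule add_mono) (auto simp: abs_mult intro: mult_left_le)
  have D: "DERIV (d k) x :> d (Suc k) x" if "k < 3" for k x
    using that D0 D1 D2 by (auto simp: d_def[abs_def] numeral_3_eq_3 less_Suc_eq)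
  have T2: "\<exists>t. f (x + h) = (\<Sum>k<2. d k x / fact k * h ^ k) + d 2 t / fact 2 * h ^ 2"
  proof (cases "h = 0")
    case False
    then show ?thesis
      using Taylor[of 2 d f "min x (x + h)" "max x (x + h)" x "x + h"] D d0
      by (auto split: if_splits)
  qed (auto simp: d_def numeral_2_eq_2)
  then obtain t where t: "f (x + h) = (\<Sum>k<2. d k x / fact k * h ^ k) + d 2 t / fact 2 * h ^ 2" by blast
  then have "f (x + h) - f x - h * f' x = - m\<^sup>2 * f t / 2 * h\<^sup>2"
    by (simp add: numeral_2_eq_2 d_def)
  then have "\<bar>f (x + h) - f x - h * f' x\<bar> = m\<^sup>2 * \<bar>f t\<bar> * h\<^sup>2 / 2" by (simp add: abs_mult)
  also have "\<dots> \<le> m\<^sup>2 * (\<bar>a\<bar> + \<bar>b\<bar>) * h\<^sup>2 / 2"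
    using f[of t] by (intro divide_right_mono mult_right_mono mult_left_mono) auto
  finally show "\<bar>f (x + h) - f x - h * f' x\<bar> \<le> m\<^sup>2 * (\<bar>a\<bar> + \<bar>b\<bar>) * h\<^sup>2 / 2" .
  have T3: "\<exists>t. f (x + h) = (\<Sum>k<3. d k x / fact k * h ^ k) + d 3 t / fact 3 * h ^ 3"
  proof (cases "h = 0")
    case False
    then show ?thesis
      using Taylor[of 3 d f "min x (x + h)" "max x (x + h)" x "x + h"] D d0
      by (auto split: if_splits)
  qed (auto simp: d_def numeral_3_eq_3)
  then obtain t where t: "f (x + h) = (\<Sum>k<3. d k x / fact k * h ^ k) + d 3 t / fact 3 * h ^ 3" by blast
  then have "f (x + h) - f x - h * f' x + h\<^sup>2 * m\<^sup>2 * f x / 2 = - m\<^sup>2 * f' t / 6 * h ^ 3"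
    by (simp add: numeral_3_eq_3 numeral_2_eq_2 d_def fact_numeral field_simps)
  then have "\<bar>f (x + h) - f x - h * f' x + h\<^sup>2 * m\<^sup>2 * f x / 2\<bar> = m\<^sup>2 * \<bar>f' t\<bar> * \<bar>h\<bar> ^ 3 / 6" by (simp add: abs_mult power_abs)
  also have "\<dots> \<le> m\<^sup>2 * (\<bar>m\<bar> * (\<bar>a\<bar> + \<bar>b\<bar>)) * \<bar>h\<bar> ^ 3 / 6"
    using f'[of t] by (intro divide_right_mono mult_right_mono mult_left_mono) auto
  finally show "\<bar>f (x + h) - f x - h * f' x + h\<^sup>2 * m\<^sup>2 * f x / 2\<bar> \<le> \<bar>m\<bar> ^ 3 * (\<bar>a\<bar> + \<bar>b\<bar>) * \<bar>h\<bar> ^ 3 / 6"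
    by (simp add: power3_eq_cube power2_eq_square mult_ac)
qed

lemma reflected_mode_eq_sinusoid:
  "reflected_mode l m x = 1 * cos (m * x) + (l / m) * sin (m * x)"
  by (simp add: reflected_mode_def)

lemma reflected_mode_deriv_eq_sinusoid:
  "m \<noteq> 0 \<Longrightarrow> reflected_mode_deriv l m x = m * ((l / m) * cos (m * x) - 1 * sin (m * x))"
  by (simp add: reflected_mode_deriv_def algebra_simps)

text \<open>On the nonnegative side the mode is smooth and the remainder is of Taylor type. Across
  the origin only value and slope match, so the remainder is merely of order h^2; this occurs only
  if the step is at least as long as the distance to the origin, which the indicator
  records.\<close>

lemma reflected_mode_ext_taylor:
  assumes m: "m \<noteq> 0" and l: "l > 0"
  obtains C where "C > 0"
    "\<And>x h. x \<ge> 0 \<Longrightarrow> \<bar>reflected_mode_ext l m (x + h) - reflected_mode l m x - h * reflected_mode_deriv l m x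
        + h\<^sup>2 * m\<^sup>2 * reflected_mode l m x / 2\<bar> \<le> C * (min (h\<^sup>2) (\<bar>h\<bar> ^ 3) + h\<^sup>2 * of_bool (x \<le> \<bar>h\<bar>))"
proof -
  let ?K = "reflected_mode l m" and ?K' = "reflected_mode_deriv l m"
  define B where "B = \<bar>1\<bar> + \<bar>l / m\<bar>"
  have B: "B \<ge> 1" by (simp add: B_def)
  \<comment> \<open>The first two summands serve steps that stay nonnegative, in the quadratic and
    the cubic estimate; the others serve steps across the origin.\<close>
  define C where "C = m\<^sup>2 * B + \<bar>m\<bar> ^ 3 * B + 2 * m\<^sup>2 * B + (2 * l\<^sup>2 + m\<^sup>2 * B / 2)"
  have nn: "0 \<le> m\<^sup>2 * B" "0 \<le> \<bar>m\<bar> ^ 3 * B" "0 \<le> 2 * l\<^sup>2" "2 * l\<^sup>2 > 0" using B l by auto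
  then have C: "C > 0" unfolding C_def by linarith
  have K: "\<bar>?K x\<bar> \<le> B" for x
    using abs_reflected_mode_le(1)[OF m l, of x] l by (simp add: B_def abs_divide)
  have t2: "\<bar>?K (x + h) - ?K x - h * ?K' x\<bar> \<le> m\<^sup>2 * B * h\<^sup>2 / 2" for x h
    unfolding B_def reflected_mode_eq_sinusoid reflected_mode_deriv_eq_sinusoid[OF m]
    by (rule sinusoid_taylor(1))
  have t3: "\<bar>?K (x + h) - ?K x - h * ?K' x + h\<^sup>2 * m\<^sup>2 * ?K x / 2\<bar> \<le> \<bar>m\<bar> ^ 3 * B * \<bar>h\<bar> ^ 3 / 6" for x h
    unfolding B_def reflected_mode_eq_sinusoid reflected_mode_deriv_eq_sinusoid[OF m]
    by (rule sinusoid_taylor(2))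
  have q: "\<bar>h\<^sup>2 * m\<^sup>2 * ?K x / 2\<bar> \<le> m\<^sup>2 * B * h\<^sup>2 / 2" for x h
  proof -
    have "\<bar>h\<^sup>2 * m\<^sup>2 * ?K x / 2\<bar> = h\<^sup>2 * m\<^sup>2 / 2 * \<bar>?K x\<bar>" by (simp add: abs_mult)
    also have "\<dots> \<le> h\<^sup>2 * m\<^sup>2 / 2 * B" by (intro mult_left_mono K) auto
    finally show ?thesis by (simp add: mult_ac)
  qed
  have K00: "?K 0 = 1" "?K' 0 = l" using m by (auto simp: reflected_mode_def reflected_mode_deriv_def)
  \<comment> \<open>With value 1 and slope l at 0 the mode is 1 + l * w up to second order, and the
    factor exp (- 2 * l * w) turns this into 1 - l * w: the rate 2 * l is what makes the slope
    continuous at 0.\<close>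
  have neg: "\<bar>exp (- 2 * l * w) * ?K w - (1 - l * w)\<bar> \<le> (2 * l\<^sup>2 + m\<^sup>2 * B / 2) * w\<^sup>2" if w: "w \<ge> 0" for w
  proof -
    have t: "l * w \<ge> 0" using l w by simp
    have r: "\<bar>?K w - (1 + l * w)\<bar> \<le> m\<^sup>2 * B * w\<^sup>2 / 2"
      using t2[of 0 w] by (simp add: K00 algebra_simps)
    have e1: "exp (- 2 * l * w) \<le> 1" using t by simp
    have "\<bar>exp (- 2 * l * w) * (?K w - (1 + l * w))\<bar> \<le> 1 * (m\<^sup>2 * B * w\<^sup>2 / 2)"
      unfolding abs_mult using e1 r by (intro mult_mono) auto
    moreover have "\<bar>exp (- 2 * l * w) * (1 + l * w) - (1 - l * w)\<bar> \<le> 2 * (l * w)\<^sup>2"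
    proof -
      have "exp (- 2 * l * w) * (1 + l * w) \<le> exp (- 2 * l * w) * exp (l * w)"
        using exp_ge_add_one_self[of "l * w"] by (intro mult_left_mono) auto
      also have "\<dots> = exp (- (l * w))" by (simp add: exp_add[symmetric])
      also have "\<dots> \<le> 1 - l * w + (l * w)\<^sup>2 / 2"
      proof -
        have "\<exists>t. \<bar>t\<bar> \<le> \<bar>- (l * w)\<bar> \<and> exp (- (l * w)) = (\<Sum>k<2. (- (l * w)) ^ k / fact k) + exp t / fact 2 * (- (l * w)) ^ 2"
          by (rule Maclaurin_exp_le)
        then have ?thesis if "l * w \<le> 0" using that t by (auto simp: numeral_2_eq_2)
        moreover have ?thesis if "l * w > 0"
        proof -
          have "DERIV (\<lambda>s. 1 - s + s\<^sup>2 / 2 - exp (- s)) s :> s - 1 + exp (- s)" for s :: real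
            by (auto intro!: derivative_eq_intros)
          moreover have "s - 1 + exp (- s) \<ge> 0" for s :: real using exp_ge_add_one_self[of "- s"] by linarith
          ultimately have "1 - 0 + 0\<^sup>2 / 2 - exp (- 0) \<le> 1 - l * w + (l * w)\<^sup>2 / 2 - exp (- (l * w))"
            using that by (intro DERIV_nonneg_imp_nondecreasing[of 0 "l * w" "\<lambda>s. 1 - s + s\<^sup>2 / 2 - exp (- s)"]) auto
          then show ?thesis by simp
        qed
        ultimately show ?thesis by linarith
      qed
      finally have 1: "exp (- 2 * l * w) * (1 + l * w) \<le> 1 - l * w + (l * w)\<^sup>2 / 2" .
      have "(1 - 2 * l * w) * (1 + l * w) \<le> exp (- 2 * l * w) * (1 + l * w)"
        using exp_ge_add_one_self[of "- 2 * l * w"] t by (intro mult_right_mono) auto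
      then have 2: "1 - l * w - 2 * (l * w)\<^sup>2 \<le> exp (- 2 * l * w) * (1 + l * w)"
        by (simp add: algebra_simps power2_eq_square)
      have "(l * w)\<^sup>2 \<ge> 0" by simp
      with 1 2 show ?thesis by linarith
    qed
    ultimately have "\<bar>exp (- 2 * l * w) * (?K w - (1 + l * w)) + (exp (- 2 * l * w) * (1 + l * w) - (1 - l * w))\<bar>
        \<le> m\<^sup>2 * B * w\<^sup>2 / 2 + 2 * (l * w)\<^sup>2" by linarith
    then show ?thesis by (simp add: algebra_simps power_mult_distrib)
  qed
  have main: "\<bar>reflected_mode_ext l m (x + h) - ?K x - h * ?K' x + h\<^sup>2 * m\<^sup>2 * ?K x / 2\<bar>
      \<le> C * (min (h\<^sup>2) (\<bar>h\<bar> ^ 3) + h\<^sup>2 * of_bool (x \<le> \<bar>h\<bar>))" if x: "x \<ge> 0" for x h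
  proof (cases "x + h < 0")
    case False
    have "\<bar>?K (x + h) - ?K x - h * ?K' x + h\<^sup>2 * m\<^sup>2 * ?K x / 2\<bar> \<le> C * h\<^sup>2"
    proof -
      have "\<bar>?K (x + h) - ?K x - h * ?K' x + h\<^sup>2 * m\<^sup>2 * ?K x / 2\<bar> \<le> m\<^sup>2 * B * h\<^sup>2 / 2 + m\<^sup>2 * B * h\<^sup>2 / 2"
        using t2[of x h] q[of h x] by linarith
      also have "\<dots> = (m\<^sup>2 * B) * h\<^sup>2" by simp
      also have "\<dots> \<le> C * h\<^sup>2"
      proof (rule mult_right_mono)
        show "m\<^sup>2 * B \<le> C" using nn unfolding C_def by linarith
      qed simp
      finally show ?thesis .
    qed
    moreover have "\<bar>?K (x + h) - ?K x - h * ?K' x + h\<^sup>2 * m\<^sup>2 * ?K x / 2\<bar> \<le> C * \<bar>h\<bar> ^ 3"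
    proof -
      have "\<bar>m\<bar> ^ 3 * B / 6 \<le> C" using nn unfolding C_def by linarith
      then have "\<bar>m\<bar> ^ 3 * B / 6 * \<bar>h\<bar> ^ 3 \<le> C * \<bar>h\<bar> ^ 3" by (intro mult_right_mono) auto
      then show ?thesis using t3[of x h] by simp
    qed
    ultimately have "\<bar>?K (x + h) - ?K x - h * ?K' x + h\<^sup>2 * m\<^sup>2 * ?K x / 2\<bar> \<le> C * min (h\<^sup>2) (\<bar>h\<bar> ^ 3)"
      by (auto simp: min_def)
    also have "\<dots> \<le> C * (min (h\<^sup>2) (\<bar>h\<bar> ^ 3) + h\<^sup>2 * of_bool (x \<le> \<bar>h\<bar>))"
      using C by (intro mult_left_mono) auto
    finally show ?thesis using False by (simp add: reflected_mode_ext_def)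
  next
    case True
    \<comment> \<open>The distance by which the step passes the origin. Both w and x are at most
      |h|, so every quadratic term is of order h^2.\<close>
    define w where "w = - (x + h)"
    have w: "w \<ge> 0" "w \<le> \<bar>h\<bar>" and xh: "x \<le> \<bar>h\<bar>" using True x by (auto simp: w_def)
    have w2: "w\<^sup>2 \<le> h\<^sup>2" "x\<^sup>2 \<le> h\<^sup>2" using w xh x by (auto simp: abs_le_square_iff[symmetric])
    have 1: "\<bar>exp (- 2 * l * w) * ?K w - (1 - l * w)\<bar> \<le> (2 * l\<^sup>2 + m\<^sup>2 * B / 2) * h\<^sup>2"
      using nn by (intro order_trans[OF neg[OF w(1)]] mult_left_mono w2) auto
    have 2: "\<bar>?K x - 1 - x * l\<bar> \<le> m\<^sup>2 * B / 2 * h\<^sup>2"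
    proof -
      have "\<bar>?K x - 1 - x * l\<bar> \<le> m\<^sup>2 * B / 2 * x\<^sup>2" using t2[of 0 x] by (simp add: K00)
      also have "\<dots> \<le> m\<^sup>2 * B / 2 * h\<^sup>2" using nn by (intro mult_left_mono w2) auto
      finally show ?thesis .
    qed
    have 3: "\<bar>?K' x - l\<bar> \<le> m\<^sup>2 * B * \<bar>h\<bar>"
    proof -
      have "\<bar>?K' x - l\<bar> \<le> m\<^sup>2 * B * x"
      proof -
        have "\<bar>sin (m * x)\<bar> \<le> \<bar>m\<bar> * x" using abs_sin_x_le_abs_x[of "m * x"] x by (simp add: abs_mult)
        then have s: "\<bar>m * sin (m * x)\<bar> \<le> m\<^sup>2 * x"
          using mult_left_mono[of "\<bar>sin (m * x)\<bar>" "\<bar>m\<bar> * x" "\<bar>m\<bar>"] by (simp add: abs_mult power2_eq_square mult.assoc[symmetric])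
        have "\<bar>cos (m * x) - 1\<bar> \<le> \<bar>m\<bar> * x"
        proof -
          have "1 - cos (m * x) = 2 * (sin (m * x / 2))\<^sup>2" using cos_double_sin[of "m * x / 2"] by simp
          moreover have "(sin (m * x / 2))\<^sup>2 \<le> \<bar>sin (m * x / 2)\<bar>"
            using abs_sin_le_one[of "m * x / 2"] mult_left_le[of "\<bar>sin (m * x / 2)\<bar>" "\<bar>sin (m * x / 2)\<bar>"]
            by (simp add: power2_eq_square)
          moreover have "\<bar>sin (m * x / 2)\<bar> \<le> \<bar>m\<bar> * x / 2" using abs_sin_x_le_abs_x[of "m * x / 2"] x by (simp add: abs_mult)
          moreover have "\<bar>cos (m * x) - 1\<bar> = 1 - cos (m * x)" using cos_le_one[of "m * x"] by simp
          ultimately show ?thesis by linarith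
        qed
        then have "\<bar>l * (cos (m * x) - 1)\<bar> \<le> l * (\<bar>m\<bar> * x)" using l by (simp add: abs_mult)
        moreover have "m\<^sup>2 * B * x = m\<^sup>2 * x + l * (\<bar>m\<bar> * x)"
          using m l by (simp add: B_def abs_divide divide_simps power2_eq_square algebra_simps abs_mult_self_eq)
        moreover have "?K' x - l = l * (cos (m * x) - 1) - m * sin (m * x)" by (simp add: reflected_mode_deriv_def algebra_simps)
        ultimately show ?thesis using s by linarith
      qed
      also have "\<dots> \<le> m\<^sup>2 * B * \<bar>h\<bar>" using nn xh by (intro mult_left_mono) auto
      finally show ?thesis .
    qed
    have 4: "\<bar>h * (?K' x - l)\<bar> \<le> m\<^sup>2 * B * h\<^sup>2"
    proof -
      have "\<bar>h * (?K' x - l)\<bar> \<le> \<bar>h\<bar> * (m\<^sup>2 * B * \<bar>h\<bar>)" unfolding abs_mult using 3 by (intro mult_left_mono) auto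
      also have "\<dots> = m\<^sup>2 * B * h\<^sup>2" by (simp add: power2_eq_square)
      finally show ?thesis .
    qed
    have E: "reflected_mode_ext l m (x + h) = exp (- 2 * l * w) * ?K w"
      using True by (simp add: reflected_mode_ext_def w_def algebra_simps)
    have "exp (- 2 * l * w) * ?K w - ?K x - h * ?K' x + h\<^sup>2 * m\<^sup>2 * ?K x / 2
       = (exp (- 2 * l * w) * ?K w - (1 - l * w)) - (?K x - 1 - x * l) - h * (?K' x - l) + h\<^sup>2 * m\<^sup>2 * ?K x / 2"
      by (simp add: w_def algebra_simps)
    then have "\<bar>exp (- 2 * l * w) * ?K w - ?K x - h * ?K' x + h\<^sup>2 * m\<^sup>2 * ?K x / 2\<bar>
      \<le> (2 * l\<^sup>2 + m\<^sup>2 * B / 2) * h\<^sup>2 + m\<^sup>2 * B / 2 * h\<^sup>2 + m\<^sup>2 * B * h\<^sup>2 + m\<^sup>2 * B * h\<^sup>2 / 2"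
      using 1 2 4 q[of h x] by linarith
    also have "\<dots> = (2 * m\<^sup>2 * B + (2 * l\<^sup>2 + m\<^sup>2 * B / 2)) * h\<^sup>2" by (simp add: algebra_simps)
    also have "\<dots> \<le> C * h\<^sup>2"
    proof (rule mult_right_mono)
      show "2 * m\<^sup>2 * B + (2 * l\<^sup>2 + m\<^sup>2 * B / 2) \<le> C" using nn unfolding C_def by linarith
    qed simp
    also have "\<dots> \<le> C * (min (h\<^sup>2) (\<bar>h\<bar> ^ 3) + h\<^sup>2 * of_bool (x \<le> \<bar>h\<bar>))"
      using C xh by (intro mult_left_mono) auto
    finally show ?thesis using E by simp
  qed
  show ?thesis using C main by (rule that)
qed

section \<open>The walk\<close>

locale centered_walk = prob_space M for M :: "'a measure" +
  fixes X :: "nat \<Rightarrow> 'a \<Rightarrow> real" and \<sigma> :: real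
  assumes indep: "indep_vars (\<lambda>_. borel) X {1..}"
    and ident: "\<And>n. n \<ge> 1 \<Longrightarrow> distr M borel (X n) = distr M borel (X 1)"
    and integrable_step: "integrable M (X 1)"
    and mean_zero: "expectation (X 1) = 0"
    and integrable_step_square: "integrable M (\<lambda>\<omega>. (X 1 \<omega>)\<^sup>2)"
    and sigma_pos: "\<sigma> > 0"
    and sigma_square: "\<sigma>\<^sup>2 = (\<integral>\<omega>. (X 1 \<omega>)\<^sup>2 \<partial>M)"
begin

definition \<mu> :: "real measure" where "\<mu> = distr M borel (X 1)"

definition T :: "nat \<Rightarrow> 'a \<Rightarrow> real" where "T k w = (\<Sum>i=1..k. X i w)"

text \<open>The filtration of the walk, encoded as the pullback of a product sigma-algebra:
  independence of the next step then comes from grouping the coordinates of an independent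
  family.\<close>

definition hist :: "nat \<Rightarrow> 'a measure" where
  "hist k = vimage_algebra (space M) (\<lambda>w. restrict (\<lambda>i. X i w) {1..k}) (PiM {1..k} (\<lambda>_. borel))"

lemma step_measurable: "i \<ge> 1 \<Longrightarrow> X i \<in> borel_measurable M"
  using indep by (auto simp: indep_vars_def2)

lemma step1_measurable [measurable]: "X 1 \<in> borel_measurable M" "X (Suc k) \<in> borel_measurable M"
  using step_measurable by auto

lemma mu_eq: "distr M borel (X (Suc k)) = \<mu>"
  using ident[of "Suc k"] by (simp add: \<mu>_def)

sublocale mu: real_distribution \<mu>
  unfolding \<mu>_def by (rule real_distribution_distr) measurable

lemma sets_mu [measurable_cong, simp]: "sets \<mu> = sets borel" and space_mu [simp]: "space \<mu> = UNIV"
  by (auto simp: \<mu>_def)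

lemma integrable_mu_step:
  fixes f :: "real \<Rightarrow> 'b :: {banach, second_countable_topology}"
  shows "f \<in> borel_measurable borel \<Longrightarrow> integrable \<mu> f \<longleftrightarrow> integrable M (\<lambda>w. f (X (Suc k) w))"
  unfolding mu_eq[of k, symmetric] by (rule integrable_distr_eq) auto

lemma integral_mu_step:
  fixes f :: "real \<Rightarrow> 'b :: {banach, second_countable_topology}"
  shows "f \<in> borel_measurable borel \<Longrightarrow> (\<integral>r. f r \<partial>\<mu>) = (\<integral>w. f (X (Suc k) w) \<partial>M)"
  unfolding mu_eq[of k, symmetric] by (rule integral_distr) auto

lemma mu_integrable [simp, intro]: "integrable \<mu> (\<lambda>r. r)" "integrable \<mu> (\<lambda>r. r\<^sup>2)" "integrable \<mu> (\<lambda>r. \<bar>r\<bar>)"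
proof -
  show "integrable \<mu> (\<lambda>r. r)"
    using integrable_step by (subst integrable_mu_step[of _ 0]) simp_all
  then show "integrable \<mu> (\<lambda>r. \<bar>r\<bar>)" by (rule integrable_abs)
  show "integrable \<mu> (\<lambda>r. r\<^sup>2)"
    using integrable_step_square by (subst integrable_mu_step[of _ 0]) simp_all
qed

lemma mu_mean [simp]: "(\<integral>r. r \<partial>\<mu>) = 0"
  using mean_zero by (subst integral_mu_step[of _ 0]) simp_all

lemma mu_square [simp]: "(\<integral>r. r\<^sup>2 \<partial>\<mu>) = \<sigma>\<^sup>2"
  using sigma_square by (subst integral_mu_step[of _ 0]) simp_all

lemma space_hist [simp]: "space (hist k) = space M"
  by (simp add: hist_def)

lemma sets_hist_subset: "sets (hist k) \<subseteq> sets M"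
  unfolding hist_def
  by (rule sets_image_in_sets) (auto intro!: measurable_restrict step_measurable)

lemma hist_measurable_imp: "f \<in> measurable (hist k) N \<Longrightarrow> f \<in> measurable M N"
  using sets_hist_subset[of k] measurable_mono[of N N "hist k" M] by auto

lemma step_measurable_hist:
  assumes "i \<in> {1..k}"
  shows "X i \<in> borel_measurable (hist k)"
proof -
  have "(\<lambda>w. restrict (\<lambda>i. X i w) {1..k}) \<in> measurable (hist k) (PiM {1..k} (\<lambda>_. borel))"
    unfolding hist_def by (rule measurable_vimage_algebra1) (auto simp: space_PiM)
  from measurable_compose[OF this measurable_component_singleton[OF assms]] show ?thesis
    using assms by simp
qed

lemma T_measurable_hist: "j \<le> k \<Longrightarrow> T j \<in> borel_measurable (hist k)"
  unfolding T_def[abs_def] by (intro borel_measurable_sum step_measurable_hist) auto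

lemma T_measurable [measurable]: "T k \<in> borel_measurable M"
  by (rule hist_measurable_imp[OF T_measurable_hist[of k k]]) simp

lemma T_0 [simp]: "T 0 w = 0" and T_Suc: "T (Suc k) w = T k w + X (Suc k) w"
  by (simp_all add: T_def)

lemma random_walk_eq: "random_walk x X k w = x + T k w"
  by (simp add: random_walk_def T_def)

lemma prob_hist_step:
  assumes A: "A \<in> sets (hist k)" and B: "B \<in> sets borel"
  shows "prob (A \<inter> (X (Suc k) -` B \<inter> space M)) = prob A * prob (X (Suc k) -` B \<inter> space M)"
proof -
  let ?g = "\<lambda>w. restrict (\<lambda>i. X i w) {1..k}" and ?P = "PiM {1..k} (\<lambda>_. borel :: real measure)"
  let ?h = "\<lambda>w. restrict (\<lambda>i. X i w) {Suc k}" and ?Q = "PiM {Suc k} (\<lambda>_. borel :: real measure)"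
  have ind: "indep_var ?P ?g ?Q ?h"
    by (rule indep_var_restrict[OF indep]) auto
  obtain A' where A': "A' \<in> sets ?P" "A = ?g -` A' \<inter> space M"
    using A unfolding hist_def by (subst (asm) sets_vimage_algebra2) (auto simp: space_PiM)
  define B' where "B' = (\<lambda>f. f (Suc k)) -` B \<inter> space ?Q"
  have B': "B' \<in> sets ?Q"
    unfolding B'_def using B by (intro measurable_sets[OF measurable_component_singleton]) auto
  have "X (Suc k) -` B \<inter> space M = ?h -` B' \<inter> space M"
    by (auto simp: B'_def space_PiM)
  moreover have "(\<lambda>w. (?g w, ?h w)) -` (A' \<times> B') \<inter> space M = A \<inter> (?h -` B' \<inter> space M)"
    by (auto simp: A'(2))
  ultimately show ?thesis
    using indep_varD[OF ind A'(1) B'] A'(2) by simp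
qed

lemma distr_hist_step:
  assumes Y: "Y \<in> measurable (hist k) N"
  shows "distr M N Y \<Otimes>\<^sub>M \<mu> = distr M (N \<Otimes>\<^sub>M borel) (\<lambda>w. (Y w, X (Suc k) w))"
proof -
  note YM = hist_measurable_imp[OF Y]
  interpret Y: prob_space "distr M N Y" by (rule prob_space_distr[OF YM])
  show ?thesis
  proof (rule pair_measure_eqI)
    show "sigma_finite_measure (distr M N Y)" "sigma_finite_measure \<mu>" by unfold_locales
    show "sets (distr M N Y \<Otimes>\<^sub>M \<mu>) = sets (distr M (N \<Otimes>\<^sub>M borel) (\<lambda>w. (Y w, X (Suc k) w)))"
      by (simp cong: sets_pair_measure_cong)
    fix A B assume A: "A \<in> sets (distr M N Y)" and B: "B \<in> sets \<mu>"
    have pm: "(\<lambda>w. (Y w, X (Suc k) w)) \<in> measurable M (N \<Otimes>\<^sub>M borel)"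
      by (rule measurable_Pair[OF YM step1_measurable(2)])
    have hA: "Y -` A \<inter> space M \<in> sets (hist k)"
      using measurable_sets[OF Y, of A] A by simp
    have AB: "A \<times> B \<in> sets (N \<Otimes>\<^sub>M borel)" using A B by auto
    have "(\<lambda>w. (Y w, X (Suc k) w)) -` (A \<times> B) \<inter> space M = (Y -` A \<inter> space M) \<inter> (X (Suc k) -` B \<inter> space M)"
      by auto
    moreover have "emeasure \<mu> B = emeasure M (X (Suc k) -` B \<inter> space M)"
      using B unfolding mu_eq[of k, symmetric] by (subst emeasure_distr) auto
    moreover have "emeasure (distr M N Y) A = emeasure M (Y -` A \<inter> space M)"
      using A by (subst emeasure_distr[OF YM]) auto
    ultimately show "emeasure (distr M N Y) A * emeasure \<mu> B = emeasure (distr M (N \<Otimes>\<^sub>M borel) (\<lambda>w. (Y w, X (Suc k) w))) (A \<times> B)"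
      using prob_hist_step[OF hA, of B] B
      by (subst emeasure_distr[OF pm AB]) (simp add: emeasure_eq_measure ennreal_mult)
  qed
qed

text \<open>Fubini for the product law of past and next step. It stands in for conditional
  expectation: the martingale and Markov arguments below are instances with a suitable
  \<open>Y\<close> recording the past.\<close>

lemma expectation_step:
  fixes \<Phi> :: "'b \<Rightarrow> real \<Rightarrow> real"
  assumes Y: "Y \<in> measurable (hist k) N" and \<Phi>: "case_prod \<Phi> \<in> borel_measurable (N \<Otimes>\<^sub>M borel)"
    and int: "integrable M (\<lambda>w. \<Phi> (Y w) (X (Suc k) w))"
  shows "expectation (\<lambda>w. \<Phi> (Y w) (X (Suc k) w)) = expectation (\<lambda>w. \<integral>r. \<Phi> (Y w) r \<partial>\<mu>)"
    and "integrable M (\<lambda>w. \<integral>r. \<Phi> (Y w) r \<partial>\<mu>)"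
proof -
  note YM = hist_measurable_imp[OF Y]
  note D = distr_hist_step[OF Y]
  have \<Phi>': "case_prod \<Phi> \<in> borel_measurable (N \<Otimes>\<^sub>M \<mu>)"
    using \<Phi> by (subst measurable_cong_sets[OF sets_pair_measure_cong[OF refl sets_mu] refl])
  interpret Y: prob_space "distr M N Y" by (rule prob_space_distr[OF YM])
  interpret P: pair_prob_space "distr M N Y" \<mu> ..
  have pm: "(\<lambda>w. (Y w, X (Suc k) w)) \<in> measurable M (N \<Otimes>\<^sub>M borel)"
    using YM by measurable
  have i: "integrable (distr M N Y \<Otimes>\<^sub>M \<mu>) (case_prod \<Phi>)"
    unfolding D by (subst integrable_distr_eq[OF pm \<Phi>]) (use int in simp)
  have m: "(\<lambda>y. \<integral>r. \<Phi> y r \<partial>\<mu>) \<in> borel_measurable N"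
    using \<Phi>' by (rule mu.borel_measurable_lebesgue_integral)
  have "expectation (\<lambda>w. \<Phi> (Y w) (X (Suc k) w)) = integral\<^sup>L (distr M N Y \<Otimes>\<^sub>M \<mu>) (case_prod \<Phi>)"
    unfolding D by (subst integral_distr[OF pm \<Phi>]) simp
  also have "\<dots> = (\<integral>y. \<integral>r. \<Phi> y r \<partial>\<mu> \<partial>distr M N Y)"
    using P.integral_fst'[OF i] by simp
  also have "\<dots> = expectation (\<lambda>w. \<integral>r. \<Phi> (Y w) r \<partial>\<mu>)"
    by (rule integral_distr[OF YM m])
  finally show "expectation (\<lambda>w. \<Phi> (Y w) (X (Suc k) w)) = expectation (\<lambda>w. \<integral>r. \<Phi> (Y w) r \<partial>\<mu>)" .
  have "integrable (distr M N Y) (\<lambda>y. \<integral>r. \<Phi> y r \<partial>\<mu>)"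
    using P.integrable_fst'[OF i] by simp
  then show "integrable M (\<lambda>w. \<integral>r. \<Phi> (Y w) r \<partial>\<mu>)"
    by (subst (asm) integrable_distr_eq[OF YM m])
qed

lemma T_square: "integrable M (\<lambda>w. (T k w)\<^sup>2) \<and> integrable M (T k) \<and> expectation (\<lambda>w. (T k w)\<^sup>2) = real k * \<sigma>\<^sup>2"
proof (induction k)
  case (Suc k)
  have x2: "integrable M (\<lambda>w. (X (Suc k) w)\<^sup>2)" "integrable M (\<lambda>w. X (Suc k) w)"
    by (subst integrable_mu_step[symmetric, of _ k], simp, simp)+
  have int: "integrable M (\<lambda>w. (T k w + X (Suc k) w)\<^sup>2)"
  proof (rule Bochner_Integration.integrable_bound)
    show "integrable M (\<lambda>w. 2 * (T k w)\<^sup>2 + 2 * (X (Suc k) w)\<^sup>2)" using Suc x2 by auto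
    have "norm ((a + b)\<^sup>2) \<le> norm (2 * a\<^sup>2 + 2 * b\<^sup>2)" for a b :: real
      using sum_squares_bound[of a b] zero_le_power2[of "a + b"] unfolding power2_sum real_norm_def by linarith
    then show "AE w in M. norm ((T k w + X (Suc k) w)\<^sup>2) \<le> norm (2 * (T k w)\<^sup>2 + 2 * (X (Suc k) w)\<^sup>2)"
      by auto
  qed measurable
  have sq: "(\<integral>r. (t + r)\<^sup>2 \<partial>\<mu>) = t\<^sup>2 + \<sigma>\<^sup>2" for t
    using mu.prob_space by (simp add: power2_sum)
  have "expectation (\<lambda>w. (T k w + X (Suc k) w)\<^sup>2) = expectation (\<lambda>w. \<integral>r. (T k w + r)\<^sup>2 \<partial>\<mu>)"
    using T_measurable_hist[of k k] by (intro expectation_step(1)[where N=borel] int) auto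
  then show ?case
    using int Suc x2 unfolding T_Suc[abs_def] sq by (simp add: algebra_simps prob_space)
qed simp

lemma integrable_T [simp, intro]: "integrable M (T k)" "integrable M (\<lambda>w. \<bar>T k w\<bar>)"
  using T_square[of k] by auto

lemma expectation_abs_T_le: "expectation (\<lambda>w. \<bar>T k w\<bar>) \<le> \<sigma> * sqrt (real k)"
proof -
  have "(expectation (\<lambda>w. \<bar>T k w\<bar>))\<^sup>2 \<le> expectation (\<lambda>w. \<bar>T k w\<bar>\<^sup>2)"
  proof -
    have "variance (\<lambda>w. \<bar>T k w\<bar>) = expectation (\<lambda>w. \<bar>T k w\<bar>\<^sup>2) - (expectation (\<lambda>w. \<bar>T k w\<bar>))\<^sup>2"
      by (rule variance_eq) (use T_square[of k] in simp_all)
    moreover have "0 \<le> variance (\<lambda>w. \<bar>T k w\<bar>)" by (rule variance_positive)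
    ultimately show ?thesis by linarith
  qed
  also have "\<dots> = (\<sigma> * sqrt (real k))\<^sup>2" using T_square[of k] by (simp add: power_mult_distrib)
  finally show ?thesis by (rule power2_le_imp_le) (use sigma_pos in simp)
qed

lemma char_T: "(CLINT w|M. iexp (t * (y + T k w))) = iexp (t * y) * char \<mu> t ^ k"
proof -
  have "char (distr M borel (T k)) t = (\<Prod>i\<in>{1..k}. char (distr M borel (X i)) t)"
    unfolding T_def[abs_def] by (intro char_distr_sum indep_vars_subset[OF indep]) auto
  also have "\<dots> = (\<Prod>i\<in>{1..k}. char \<mu> t)"
  proof (rule prod.cong[OF refl])
    fix i assume "i \<in> {1..k}"
    then have "distr M borel (X i) = \<mu>" unfolding \<mu>_def by (intro ident) simp
    then show "char (distr M borel (X i)) t = char \<mu> t" by simp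
  qed
  finally have "(CLINT w|M. iexp (t * T k w)) = char \<mu> t ^ k"
    by (simp add: char_def integral_distr)
  moreover have "(CLINT w|M. iexp (t * (y + T k w))) = iexp (t * y) * (CLINT w|M. iexp (t * T k w))"
    by (subst integral_mult_right_zero[symmetric]) (simp add: exp_add distrib_left)
  ultimately show ?thesis by simp
qed

text \<open>The Markov property at time j. The inner expectation runs over the same space with an
  unrelated sample point, which acts as an independent copy of the walk. Induction on i removes the
  last step by replacing \<phi> with its one-step mean, so \<phi> has to vary.\<close>

lemma expectation_transition:
  fixes \<phi> :: "real \<Rightarrow> real"
  assumes [measurable]: "\<phi> \<in> borel_measurable borel" and b: "\<And>s. \<bar>\<phi> s\<bar> \<le> B"
    and Y: "Y \<in> borel_measurable (hist j)" "integrable M Y"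
  shows "expectation (\<lambda>w. Y w * \<phi> (x + T (j + i) w)) = expectation (\<lambda>w. Y w * expectation (\<lambda>w'. \<phi> (x + T j w + T i w')))"
  using assms(1) b
proof (induction i arbitrary: \<phi>)
  case (Suc i)
  note [measurable] = Suc.prems(1)
  define P where "P s = (\<integral>r. \<phi> (s + r) \<partial>\<mu>)" for s
  have [measurable]: "P \<in> borel_measurable borel"
    unfolding P_def[abs_def] by measurable
  have Pb: "\<bar>P s\<bar> \<le> B" for s
    unfolding P_def using Suc.prems(2)
    by (intro order_trans[OF integral_abs_bound] mu.integral_le_const mu.integrable_const_bound[of _ B]) auto
  have int\<phi>: "integrable \<mu> (\<lambda>r. \<phi> (s + r))" for s
    by (rule mu.integrable_const_bound[of _ B]) (use Suc.prems(2) in auto)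
  have sub: "sets (hist j) \<subseteq> sets (hist (j + i))"
  proof -
    have "(\<lambda>w. restrict (\<lambda>i. X i w) {1..j}) \<in> measurable (hist (j + i)) (PiM {1..j} (\<lambda>_. borel))"
      by (intro measurable_restrict step_measurable_hist) auto
    then show ?thesis
      unfolding hist_def[of j] by (intro sets_image_in_sets) auto
  qed
  have Yh: "Y \<in> borel_measurable (hist (j + i))"
    using measurable_mono[of borel borel "hist j" "hist (j + i)"] sub Y(1) by auto
  have YM[measurable]: "Y \<in> borel_measurable M" by (rule hist_measurable_imp[OF Y(1)])
  have pr: "(\<lambda>w. (Y w, x + T (j + i) w)) \<in> measurable (hist (j + i)) (borel \<Otimes>\<^sub>M borel)"
    using Yh T_measurable_hist[of "j + i" "j + i"] by measurable
  have int: "integrable M (\<lambda>w. Y w * \<phi> (x + T (j + i) w + X (Suc (j + i)) w))"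
  proof (rule Bochner_Integration.integrable_bound)
    show "integrable M (\<lambda>w. B * \<bar>Y w\<bar>)" using Y by auto
    have "\<bar>y * \<phi> s\<bar> \<le> \<bar>B * \<bar>y\<bar>\<bar>" for y s
      using mult_left_mono[OF Suc.prems(2)[of s], of "\<bar>y\<bar>"] order_trans[OF abs_ge_zero Suc.prems(2)[of s]]
      by (simp add: abs_mult mult.commute)
    then show "AE w in M. norm (Y w * \<phi> (x + T (j + i) w + X (Suc (j + i)) w)) \<le> norm (B * \<bar>Y w\<bar>)" by auto
  qed measurable
  \<comment> \<open>The same removal for the copy, so that the one-step mean can be undone after the
    induction hypothesis.\<close>
  have PT: "expectation (\<lambda>w'. P (z + T i w')) = expectation (\<lambda>w'. \<phi> (z + T (Suc i) w'))" for z
  proof -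
    have "expectation (\<lambda>w'. (\<lambda>s r. \<phi> (s + r)) (z + T i w') (X (Suc i) w')) = expectation (\<lambda>w'. \<integral>r. (\<lambda>s r. \<phi> (s + r)) (z + T i w') r \<partial>\<mu>)"
    proof (rule expectation_step(1)[where N=borel])
      show "(\<lambda>w'. z + T i w') \<in> borel_measurable (hist i)" using T_measurable_hist[of i i] by measurable
      show "integrable M (\<lambda>w'. \<phi> (z + T i w' + X (Suc i) w'))"
        by (rule integrable_const_bound[of _ B]) (use Suc.prems(2) in auto)
    qed measurable
    then show ?thesis by (simp add: P_def T_Suc add.assoc)
  qed
  have "expectation (\<lambda>w. Y w * \<phi> (x + T (j + i) w + X (Suc (j + i)) w))
    = expectation (\<lambda>w. \<integral>r. (\<lambda>p r. fst p * \<phi> (snd p + r)) (Y w, x + T (j + i) w) r \<partial>\<mu>)"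
  proof -
    have "(\<lambda>(p, r). fst p * \<phi> (snd p + r)) \<in> borel_measurable ((borel \<Otimes>\<^sub>M borel) \<Otimes>\<^sub>M borel)"
      by measurable
    from expectation_step(1)[OF pr, of "\<lambda>p r. fst p * \<phi> (snd p + r)", OF this] int show ?thesis by simp
  qed
  also have "\<dots> = expectation (\<lambda>w. Y w * P (x + T (j + i) w))"
    by (simp add: P_def)
  also have "\<dots> = expectation (\<lambda>w. Y w * expectation (\<lambda>w'. P (x + T j w + T i w')))"
    by (rule Suc.IH) (use Pb in auto)
  finally show ?case unfolding PT by (simp add: T_Suc add.assoc)
qed (simp add: prob_space)

end

section \<open>Fejer kernel and expected numbers of visits to balls\<close>

lemma tendsto_inverse_sqrt: "(\<lambda>n. c / sqrt (real n)) \<longlonglongrightarrow> 0"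
  by (intro tendsto_divide_0[OF tendsto_const] filterlim_at_top_imp_at_infinity
      filterlim_compose[OF sqrt_at_top filterlim_real_sequentially])

lemma has_bochner_integral_inverse_one_plus_square:
  fixes a :: real assumes "a > 0"
  shows "has_bochner_integral lborel (\<lambda>t. 1 / (1 + a * t\<^sup>2)) (pi / sqrt a)"
proof -
  define l where "l = 1 / sqrt a"
  have l: "l > 0" "l\<^sup>2 = 1 / a" using assms by (auto simp: l_def power_divide)
  have "has_bochner_integral lborel (\<lambda>t. pi * l * (l / (pi * (l\<^sup>2 + t\<^sup>2)))) (pi * l * 1)"
    using has_bochner_integral_mult_right[OF has_bochner_integral_cos_cauchy_density[OF l(1), of 0], of "pi * l"] by simp
  moreover have "pi * l * (l / (pi * (l\<^sup>2 + t\<^sup>2))) = 1 / (1 + a * t\<^sup>2)" for t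
  proof -
    have "pi * l * (l / (pi * (l\<^sup>2 + t\<^sup>2))) = l\<^sup>2 / (l\<^sup>2 + t\<^sup>2)" by (simp add: power2_eq_square)
    also have "\<dots> = 1 / (1 + a * t\<^sup>2)" using assms unfolding l(2) by (simp add: field_simps)
    finally show ?thesis .
  qed
  ultimately show ?thesis by (simp add: l_def)
qed

text \<open>The triangle function and its transform, the Fejer kernel: compact support on one side
  and nonnegativity on the other allow visits to a ball to be bounded by frequencies in
  [- K, K].\<close>

lemma integral_tent_mult_cos:
  fixes K s :: real
  assumes K: "K > 0"
  shows "has_bochner_integral lborel (\<lambda>t. indicator {-K..K} t * (1 - \<bar>t\<bar> / K) * cos (t * s))
     (if s = 0 then K else 2 * (1 - cos (K * s)) / (K * s\<^sup>2))"
proof -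
  let ?f = "\<lambda>t. indicator {-K..K} t * (1 - \<bar>t\<bar> / K) * cos (t * s) :: real"
  define F where "F t = (if s = 0 then t - t\<^sup>2 / (2 * K) else (1 - t / K) * sin (t * s) / s - cos (t * s) / (K * s\<^sup>2))" for t
  have D: "DERIV F t :> (1 - t / K) * cos (t * s)" for t
  proof (cases "s = 0")
    case True
    then show ?thesis using K unfolding F_def by (auto intro!: derivative_eq_intros simp: field_simps)
  next
    case False
    then show ?thesis using K unfolding F_def
      by (auto intro!: derivative_eq_intros simp: field_simps power2_eq_square)
  qed
  have eq: "indicator {0<..} t *\<^sub>R ?f t = ((1 - t / K) * cos (t * s)) * indicator {0..K} t" if "t \<noteq> 0" for t
    using that K by (cases "0 < t"; cases "t \<le> K") (simp_all add: indicator_def)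
  have "(LBINT t. ((1 - t / K) * cos (t * s)) * indicator {0..K} t) = F K - F 0"
    using K by (intro integral_FTC_Icc_real D) (auto intro!: continuous_intros)
  moreover have "integrable lborel (\<lambda>t. ((1 - t / K) * cos (t * s)) * indicator {0..K} t)"
  proof (rule Bochner_Integration.integrable_bound)
    show "integrable lborel (indicator {0..K} :: real \<Rightarrow> real)" using K by (intro integrable_real_indicator) auto
    show "AE t in lborel. norm ((1 - t / K) * cos (t * s) * indicator {0..K} t) \<le> norm (indicator {0..K} t :: real)"
      using K by (auto simp: indicator_def abs_mult intro!: mult_le_one)
  qed measurable
  ultimately have "has_bochner_integral lborel (\<lambda>t. ((1 - t / K) * cos (t * s)) * indicator {0..K} t) (F K - F 0)"
    by (simp add: has_bochner_integral_iff)
  moreover have "AE t in lborel. ((1 - t / K) * cos (t * s)) * indicator {0..K} t = indicator {0<..} t *\<^sub>R ?f t"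
    using AE_lborel_singleton[of 0] by eventually_elim (rule eq[symmetric])
  ultimately have *: "has_bochner_integral lborel (\<lambda>t. indicator {0<..} t *\<^sub>R ?f t) (F K - F 0)"
    by (subst (asm) has_bochner_integral_cong_AE) auto
  have "has_bochner_integral lborel ?f (2 * (LINT t:{0<..}|lborel. ?f t))"
    using * by (intro has_bochner_integral_even) (auto simp: set_integrable_def has_bochner_integral_iff indicator_def)
  moreover have "(LINT t:{0<..}|lborel. ?f t) = F K - F 0"
    using * by (simp add: set_lebesgue_integral_def has_bochner_integral_iff)
  moreover have "2 * (F K - F 0) = (if s = 0 then K else 2 * (1 - cos (K * s)) / (K * s\<^sup>2))"
    using K by (auto simp: F_def field_simps power2_eq_square)
  ultimately show ?thesis by simp
qed

text \<open>The Fejer kernel is nonnegative everywhere, and on the ball it is bounded below through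
  1 - cos u >= u^2 / 4 for |u| <= 1; this is the source of the factor 2 / K.\<close>

lemma of_bool_le_integral_tent:
  fixes K s :: real
  assumes K: "K > 0"
  shows "of_bool (\<bar>s\<bar> \<le> 1 / K) \<le> 2 / K * (LBINT \<theta>. indicator {-K..K} \<theta> * (1 - \<bar>\<theta>\<bar> / K) * cos (\<theta> * s))"
proof -
  have c: "2 * (1 - cos u) \<ge> u\<^sup>2 / 2" if "\<bar>u\<bar> \<le> 1" for u :: real
  proof -
    have "cos u \<le> 1 - u\<^sup>2 / 2 + u ^ 4 / 24"
    proof -
      obtain t where "cos u = (\<Sum>m<4. cos_coeff m * u ^ m) + cos (t + 1/2 * real 4 * pi) / fact 4 * u ^ 4"
        using Maclaurin_cos_expansion[of u 4] by auto
      moreover have "cos (t + 1/2 * real 4 * pi) / fact 4 * u ^ 4 \<le> 1 / fact 4 * u ^ 4"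
        by (intro mult_right_mono divide_right_mono) auto
      moreover have "(\<Sum>m<4. cos_coeff m * u ^ m) = cos_coeff 0 + cos_coeff 1 * u + cos_coeff 2 * u\<^sup>2 + cos_coeff 3 * u ^ 3"
        by (simp add: numeral_eq_Suc)
      moreover have "cos_coeff 0 = 1" "cos_coeff 1 = 0" "cos_coeff 2 = - 1 / 2" "cos_coeff 3 = 0" "fact 4 = (24 :: real)"
        by (simp_all add: cos_coeff_def fact_numeral)
      ultimately show ?thesis by simp
    qed
    moreover have "u ^ 4 \<le> u\<^sup>2"
      using that power_decreasing[of 2 4 "\<bar>u\<bar>"] by simp
    moreover have "u\<^sup>2 \<ge> 0" by simp
    moreover have "p / 2 \<le> 2 * (1 - z)" if "z \<le> 1 - p / 2 + q / 24" "q \<le> p" "0 \<le> p" for p q z :: real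
      using that by simp
    ultimately show ?thesis by blast
  qed
  show ?thesis
  proof (cases "s = 0")
    case True
    then show ?thesis using integral_tent_mult_cos[OF K, of s] K by (simp add: has_bochner_integral_iff)
  next
    case False
    have "of_bool (\<bar>s\<bar> \<le> 1 / K) \<le> 2 / K * (2 * (1 - cos (K * s)) / (K * s\<^sup>2))"
    proof (cases "\<bar>s\<bar> \<le> 1 / K")
      case True
      then have "\<bar>K * s\<bar> \<le> 1" using K by (simp add: abs_mult field_simps)
      from c[OF this] have "(K * s)\<^sup>2 \<le> 4 * (1 - cos (K * s))" by simp
      then have "1 \<le> 4 * (1 - cos (K * s)) / (K * s)\<^sup>2"
        using False K by (subst pos_le_divide_eq) auto
      then show ?thesis using True K by (simp add: power2_eq_square mult_ac)
    qed (use K in simp)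
    then show ?thesis using integral_tent_mult_cos[OF K, of s] False by (simp add: has_bochner_integral_iff)
  qed
qed

context centered_walk
begin

text \<open>The Fourier transform of the expected occupation measure of the walk from 0 over the
  times 0, ..., m - 1.\<close>

definition char_sum :: "nat \<Rightarrow> real \<Rightarrow> complex" where "char_sum m t = (\<Sum>i<m. char \<mu> t ^ i)"

lemma char_sum_measurable [measurable]: "char_sum m \<in> borel_measurable borel"
  unfolding char_sum_def[abs_def] by measurable

lemma norm_char_sum_le: "cmod (char_sum m t) \<le> real m"
proof -
  have "cmod (char_sum m t) \<le> (\<Sum>i<m. 1)"
    unfolding char_sum_def using mu.cmod_char_le_1[of t]
    by (intro sum_norm_le) (auto simp: norm_power intro: power_le_one)
  then show ?thesis by simp
qed

lemma char_sum_mult: "(1 - char \<mu> t) * char_sum m t = 1 - char \<mu> t ^ m"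
  unfolding char_sum_def by (rule one_diff_power_eq[symmetric])

lemma norm_char_sum_mult_le: "cmod (char_sum m t) * cmod (1 - char \<mu> t) \<le> 2"
proof -
  have "cmod (char_sum m t) * cmod (1 - char \<mu> t) = cmod (1 - char \<mu> t ^ m)"
    using char_sum_mult[of t m] by (metis norm_mult mult.commute)
  also have "\<dots> \<le> 1 + cmod (char \<mu> t) ^ m" by (rule order_trans[OF norm_triangle_ineq4]) (simp add: norm_power)
  also have "\<dots> \<le> 2" using power_le_one[OF norm_ge_zero mu.cmod_char_le_1[of t], of m] by simp
  finally show ?thesis .
qed

text \<open>The remainder in \<open>char_approx3\<close> is the mean of the minimum of a multiple of
  r^2 and |\<theta>| |r|^3, which tends to 0 by dominated convergence even if the third moment is
  infinite.\<close>

lemma char_quotient_tendsto: "((\<lambda>\<theta>. (1 - char \<mu> \<theta>) / of_real (\<theta>\<^sup>2)) \<longlongrightarrow> of_real (\<sigma>\<^sup>2 / 2)) (at 0)"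
proof -
  define e where "e \<theta> = (\<integral>r. min (6 * r\<^sup>2) (\<bar>\<theta>\<bar> * \<bar>r\<bar> ^ 3) \<partial>\<mu>)" for \<theta> :: real
  have var: "mu.variance (\<lambda>r. r) = \<sigma>\<^sup>2" by simp
  have approx: "cmod (char \<mu> \<theta> - (1 - \<theta>\<^sup>2 * \<sigma>\<^sup>2 / 2)) \<le> \<theta>\<^sup>2 / 6 * e \<theta>" for \<theta>
    using mu.char_approx3[OF mu_integrable(1) _ mu_integrable(2) var, of \<theta>] by (simp add: e_def)
  have e: "(e \<longlongrightarrow> 0) (at 0)"
    unfolding tendsto_at_iff_sequentially comp_def
  proof (intro allI impI)
    fix t :: "nat \<Rightarrow> real" assume t: "\<forall>i. t i \<in> UNIV - {0}" "t \<longlonglongrightarrow> 0"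
    have "(\<lambda>i. e (t i)) \<longlonglongrightarrow> (\<integral>r. 0 \<partial>\<mu>)"
      unfolding e_def
    proof (rule integral_dominated_convergence)
      show "integrable \<mu> (\<lambda>r. 6 * r\<^sup>2)" by auto
      show "AE r in \<mu>. (\<lambda>i. min (6 * r\<^sup>2) (\<bar>t i\<bar> * \<bar>r\<bar> ^ 3)) \<longlonglongrightarrow> 0"
      proof (intro AE_I2)
        fix r
        have "(\<lambda>i. min (6 * r\<^sup>2) (\<bar>t i\<bar> * \<bar>r\<bar> ^ 3)) \<longlonglongrightarrow> min (6 * r\<^sup>2) (\<bar>0\<bar> * \<bar>r\<bar> ^ 3)"
          by (intro tendsto_intros t)
        moreover have "min (6 * r\<^sup>2) (\<bar>0\<bar> * \<bar>r\<bar> ^ 3) = 0" by simp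
        ultimately show "(\<lambda>i. min (6 * r\<^sup>2) (\<bar>t i\<bar> * \<bar>r\<bar> ^ 3)) \<longlonglongrightarrow> 0" by (simp only:)
      qed
    qed (auto simp: min_def abs_mult)
    then show "(\<lambda>i. e (t i)) \<longlonglongrightarrow> 0" by simp
  qed
  have "((\<lambda>\<theta>. (1 - char \<mu> \<theta>) / of_real (\<theta>\<^sup>2) - of_real (\<sigma>\<^sup>2 / 2)) \<longlongrightarrow> 0) (at 0)"
  proof (rule Lim_null_comparison)
    show "((\<lambda>\<theta>. e \<theta> / 6) \<longlongrightarrow> 0) (at 0)" using tendsto_divide[OF e tendsto_const[of 6]] by simp
    show "\<forall>\<^sub>F \<theta> in at 0. norm ((1 - char \<mu> \<theta>) / of_real (\<theta>\<^sup>2) - of_real (\<sigma>\<^sup>2 / 2)) \<le> e \<theta> / 6"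
    proof -
      have "norm ((1 - char \<mu> \<theta>) / of_real (\<theta>\<^sup>2) - of_real (\<sigma>\<^sup>2 / 2)) \<le> e \<theta> / 6" if "\<theta> \<noteq> 0" for \<theta>
      proof -
        have "(1 - char \<mu> \<theta>) / of_real (\<theta>\<^sup>2) - of_real (\<sigma>\<^sup>2 / 2) = - (char \<mu> \<theta> - (1 - \<theta>\<^sup>2 * \<sigma>\<^sup>2 / 2)) / of_real (\<theta>\<^sup>2)"
          using that by (simp add: field_simps)
        then have "norm ((1 - char \<mu> \<theta>) / of_real (\<theta>\<^sup>2) - of_real (\<sigma>\<^sup>2 / 2)) = cmod (char \<mu> \<theta> - (1 - \<theta>\<^sup>2 * \<sigma>\<^sup>2 / 2)) / \<theta>\<^sup>2"
          by (simp add: norm_divide norm_minus_commute norm_power)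
        also have "\<dots> \<le> (\<theta>\<^sup>2 / 6 * e \<theta>) / \<theta>\<^sup>2" by (intro divide_right_mono approx) simp
        finally show ?thesis using that by simp
      qed
      then show ?thesis by (auto simp: eventually_at_filter)
    qed
  qed
  then show ?thesis by (simp only: LIM_zero_iff)
qed

lemma char_away_from_one:
  obtains \<delta> c where "\<delta> > 0" "c > 0" "\<And>t. \<bar>t\<bar> \<le> \<delta> \<Longrightarrow> c * t\<^sup>2 \<le> cmod (1 - char \<mu> t)"
proof -
  have "((\<lambda>t. cmod ((1 - char \<mu> t) / of_real (t\<^sup>2))) \<longlongrightarrow> cmod (of_real (\<sigma>\<^sup>2 / 2))) (at 0)"
    by (intro tendsto_norm char_quotient_tendsto)
  moreover have "\<sigma>\<^sup>2 / 4 < cmod (of_real (\<sigma>\<^sup>2 / 2))" using sigma_pos by (simp add: norm_divide norm_power)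
  ultimately have "\<forall>\<^sub>F t in at 0. \<sigma>\<^sup>2 / 4 < cmod ((1 - char \<mu> t) / of_real (t\<^sup>2))" by (rule order_tendstoD)
  then obtain d where d: "d > 0" "\<And>t. t \<noteq> 0 \<Longrightarrow> \<bar>t\<bar> < d \<Longrightarrow> \<sigma>\<^sup>2 / 4 < cmod ((1 - char \<mu> t) / of_real (t\<^sup>2))"
    unfolding eventually_at by (auto simp: dist_real_def)
  show ?thesis
  proof
    show "d / 2 > 0" "\<sigma>\<^sup>2 / 4 > 0" using d sigma_pos by auto
    fix t :: real assume "\<bar>t\<bar> \<le> d / 2"
    then have "\<bar>t\<bar> < d" using d by linarith
    then show "\<sigma>\<^sup>2 / 4 * t\<^sup>2 \<le> cmod (1 - char \<mu> t)"
      using d(2)[of t] by (cases "t = 0") (auto simp: norm_divide norm_power field_simps)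
  qed
qed

lemma integrable_norm_char_sum_Icc [simp, intro]: "integrable lborel (\<lambda>t. indicator {a..b} t * cmod (char_sum m t))"
proof (rule Bochner_Integration.integrable_bound)
  show "integrable lborel (\<lambda>t. real m * indicator {a..b} t)"
    by (intro integrable_mult_right integrable_real_indicator) (auto simp: emeasure_lborel_Icc_eq)
  show "AE t in lborel. norm (indicator {a..b} t * cmod (char_sum m t)) \<le> norm (real m * indicator {a..b} t)"
    using norm_char_sum_le by (auto simp: indicator_def)
qed measurable

text \<open>The trivial bound m and the bound 2 / (c t^2) combine to 2 m / (1 + m c t^2 / 2), a
  Cauchy kernel of height 2 m and width of order 1 / sqrt m; its mass gives the order sqrt
  m.\<close>

lemma integral_norm_char_sum_near_zero:
  obtains \<delta> C where "\<delta> > 0" "C > 0" "\<And>m. (LBINT t. indicator {-\<delta>..\<delta>} t * cmod (char_sum m t)) \<le> C * sqrt (real m)"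
proof -
  obtain \<delta> c where \<delta>: "\<delta> > 0" "c > 0" "\<And>t. \<bar>t\<bar> \<le> \<delta> \<Longrightarrow> c * t\<^sup>2 \<le> cmod (1 - char \<mu> t)"
    using char_away_from_one by blast
  have "(LBINT t. indicator {-\<delta>..\<delta>} t * cmod (char_sum m t)) \<le> (2 * pi * sqrt (2 / c)) * sqrt (real m)" for m
  proof (cases "m = 0")
    case True
    then show ?thesis by (simp add: char_sum_def)
  next
    case False
    define a where "a = real m * c / 2"
    have a: "a > 0" using False \<delta> by (simp add: a_def)
    have le: "indicator {-\<delta>..\<delta>} t * cmod (char_sum m t) \<le> 2 * real m * (1 / (1 + a * t\<^sup>2))" for t
    proof (cases "\<bar>t\<bar> \<le> \<delta>")
      case True
      have "cmod (char_sum m t) * (c * t\<^sup>2) \<le> cmod (char_sum m t) * cmod (1 - char \<mu> t)"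
        using \<delta>(3)[OF True] by (intro mult_left_mono) auto
      then have "cmod (char_sum m t) * (c * t\<^sup>2) \<le> 2" using norm_char_sum_mult_le[of m t] by linarith
      then have "real m / 2 * (cmod (char_sum m t) * (c * t\<^sup>2)) \<le> real m / 2 * 2" by (intro mult_left_mono) auto
      then have "cmod (char_sum m t) * (1 + a * t\<^sup>2) \<le> 2 * real m"
        using norm_char_sum_le[of m t] by (simp add: a_def algebra_simps)
      moreover have "1 + a * t\<^sup>2 > 0" using a by (simp add: add_pos_nonneg)
      ultimately have "cmod (char_sum m t) \<le> 2 * real m / (1 + a * t\<^sup>2)" by (simp add: pos_le_divide_eq)
      then show ?thesis using True by (simp add: indicator_def abs_le_iff)
    next
      case F: False
      have "0 \<le> 2 * real m * (1 / (1 + a * t\<^sup>2))" using a by auto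
      moreover have "indicator {-\<delta>..\<delta>} t = (0::real)" using F by (auto simp: indicator_def)
      ultimately show ?thesis by (simp only: mult_zero_left)
    qed
    have i: "has_bochner_integral lborel (\<lambda>t. 2 * real m * (1 / (1 + a * t\<^sup>2))) (2 * real m * (pi / sqrt a))"
      by (intro has_bochner_integral_mult_right has_bochner_integral_inverse_one_plus_square a)
    have "(LBINT t. indicator {-\<delta>..\<delta>} t * cmod (char_sum m t)) \<le> (LBINT t. 2 * real m * (1 / (1 + a * t\<^sup>2)))"
      by (intro integral_mono le integrable_norm_char_sum_Icc) (use i in \<open>simp only: has_bochner_integral_iff\<close>)
    also have "\<dots> = 2 * real m * (pi / sqrt a)" using i by (rule has_bochner_integral_integral_eq)
    also have "\<dots> = (2 * pi * sqrt (2 / c)) * sqrt (real m)"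
      using False \<delta> by (simp add: a_def real_sqrt_mult real_sqrt_divide field_simps)
    finally show ?thesis .
  qed
  moreover have "2 * pi * sqrt (2 / c) > 0" using \<delta> by simp
  ultimately show ?thesis using \<delta>(1) that by blast
qed

lemma prob_eq_expectation_of_bool:
  shows "prob {w \<in> space M. P w} = expectation (\<lambda>w. of_bool (P w))"
proof -
  have "expectation (\<lambda>w. of_bool (P w) :: real) = expectation (indicator {w \<in> space M. P w})"
    by (intro Bochner_Integration.integral_cong) (auto simp: indicator_def of_bool_def)
  moreover have "{w \<in> space M. P w} \<inter> space M = {w \<in> space M. P w}" by auto
  moreover have "expectation (indicator {w \<in> space M. P w}) = prob ({w \<in> space M. P w} \<inter> space M)"
    by (rule Bochner_Integration.integral_indicator)
  ultimately show ?thesis by (simp only:)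
qed

lemma expectation_Re_iexp: "expectation (\<lambda>w. Re (c * iexp (t * (y + T i w)))) = Re (c * (iexp (t * y) * char \<mu> t ^ i))"
proof -
  have i: "integrable M (\<lambda>w. c * iexp (t * (y + T i w)))"
    by (intro integrable_mult_right integrable_iexp) auto
  have "expectation (\<lambda>w. Re (c * iexp (t * (y + T i w)))) = Re (CLINT w|M. c * iexp (t * (y + T i w)))"
    by (rule integral_Re[OF i])
  also have "(CLINT w|M. c * iexp (t * (y + T i w))) = c * (iexp (t * y) * char \<mu> t ^ i)"
    unfolding integral_mult_right_zero char_T ..
  finally show ?thesis .
qed

lemma expectation_cos: "expectation (\<lambda>w. cos (t * (y + T i w))) = Re (iexp (t * y) * char \<mu> t ^ i)"
  using expectation_Re_iexp[of 1 t y i] by (simp add: Re_exp)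

lemma expectation_fourier:
  fixes w :: "real \<Rightarrow> real"
  assumes w: "integrable lborel w"
  shows "expectation (\<lambda>\<omega>. LBINT t. w t * cos (t * (y + T i \<omega>))) = (LBINT t. w t * Re (iexp (t * y) * char \<mu> t ^ i))"
proof -
  interpret MP: pair_sigma_finite M lborel ..
  define f where "f \<omega> t = w t * cos (t * (y + T i \<omega>))" for \<omega> t
  have [measurable]: "w \<in> borel_measurable borel" using w by auto
  have int: "integrable (M \<Otimes>\<^sub>M lborel) (case_prod f)"
  proof (rule MP.Fubini_integrable)
    have "integrable lborel (f \<omega>)" for \<omega>
      unfolding f_def[abs_def] by (rule Bochner_Integration.integrable_bound[OF w]) (auto simp: abs_mult mult_left_le)
    then show "AE \<omega> in M. integrable lborel (\<lambda>t. case_prod f (\<omega>, t))" by simp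
    show "integrable M (\<lambda>\<omega>. LBINT t. norm (case_prod f (\<omega>, t)))"
    proof (rule integrable_const_bound[where B="LBINT t. \<bar>w t\<bar>"])
      show "AE \<omega> in M. norm (LBINT t. norm (case_prod f (\<omega>, t))) \<le> (LBINT t. \<bar>w t\<bar>)"
      proof (intro AE_I2)
        fix \<omega>
        have "(LBINT t. norm (f \<omega> t)) \<le> (LBINT t. \<bar>w t\<bar>)"
          by (intro integral_mono')  (use w in \<open>auto simp: f_def abs_mult mult_left_le\<close>)
        then show "norm (LBINT t. norm (case_prod f (\<omega>, t))) \<le> (LBINT t. \<bar>w t\<bar>)" by simp
      qed
      show "(\<lambda>\<omega>. LBINT t. norm (case_prod f (\<omega>, t))) \<in> borel_measurable M"
        unfolding f_def by measurable
    qed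
  qed (unfold f_def, measurable)
  have "expectation (\<lambda>\<omega>. LBINT t. f \<omega> t) = (LBINT t. expectation (\<lambda>\<omega>. f \<omega> t))"
    by (rule MP.Fubini_integral[symmetric, OF int])
  also have "(\<lambda>t. expectation (\<lambda>\<omega>. f \<omega> t)) = (\<lambda>t. w t * Re (iexp (t * y) * char \<mu> t ^ i))"
    by (simp only: f_def integral_mult_right_zero expectation_cos)
  finally show ?thesis by (simp add: f_def)
qed

text \<open>The sum over i of the powers is \<open>char_sum\<close>, and taking moduli discards the
  phase \<open>iexp (t * y)\<close>, so the bound does not depend on the centre of the ball.\<close>

lemma sum_prob_ball_le:
  assumes K: "K > 0"
  shows "(\<Sum>i<m. prob {\<omega> \<in> space M. \<bar>y + T i \<omega>\<bar> \<le> 1 / K}) \<le> 2 / K * (LBINT t. indicator {-K..K} t * cmod (char_sum m t))"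
proof -
  define w where "w t = indicator {-K..K} t * (1 - \<bar>t\<bar> / K)" for t :: real
  have w: "integrable lborel w"
    using integral_tent_mult_cos[OF K, of 0] by (simp add: w_def[abs_def] has_bochner_integral_iff)
  have [measurable]: "w \<in> borel_measurable borel" using w by auto
  have w_bound: "0 \<le> w t" "w t \<le> indicator {-K..K} t" for t
    using K by (auto simp: w_def indicator_def field_simps)
  have "prob {\<omega> \<in> space M. \<bar>y + T i \<omega>\<bar> \<le> 1 / K} \<le> 2 / K * (LBINT t. w t * Re (iexp (t * y) * char \<mu> t ^ i))" for i
  proof -
    have "prob {\<omega> \<in> space M. \<bar>y + T i \<omega>\<bar> \<le> 1 / K} = expectation (\<lambda>\<omega>. of_bool (\<bar>y + T i \<omega>\<bar> \<le> 1 / K))"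
      by (rule prob_eq_expectation_of_bool)
    also have "\<dots> \<le> expectation (\<lambda>\<omega>. 2 / K * (LBINT t. w t * cos (t * (y + T i \<omega>))))"
    proof (rule integral_mono)
      show "integrable M (\<lambda>\<omega>. of_bool (\<bar>y + T i \<omega>\<bar> \<le> 1 / K) :: real)"
        by (rule integrable_const_bound[of _ 1]) auto
      show "integrable M (\<lambda>\<omega>. 2 / K * (LBINT t. w t * cos (t * (y + T i \<omega>))))"
      proof (intro integrable_mult_right integrable_const_bound[where B="LBINT t. w t"] AE_I2)
        fix \<omega>
        have "\<bar>LBINT t. w t * cos (t * (y + T i \<omega>))\<bar> \<le> (LBINT t. w t)"
          by (rule order_trans[OF integral_abs_bound], rule integral_mono')
            (use w w_bound in \<open>auto simp: abs_mult mult_left_le\<close>)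
        then show "norm (LBINT t. w t * cos (t * (y + T i \<omega>))) \<le> (LBINT t. w t)" by simp
      qed measurable
      show "of_bool (\<bar>y + T i \<omega>\<bar> \<le> 1 / K) \<le> 2 / K * (LBINT t. w t * cos (t * (y + T i \<omega>)))" for \<omega>
        unfolding w_def by (rule of_bool_le_integral_tent[OF K])
    qed
    also have "\<dots> = 2 / K * (LBINT t. w t * Re (iexp (t * y) * char \<mu> t ^ i))"
      by (subst integral_mult_right_zero) (simp add: expectation_fourier[OF w])
    finally show ?thesis .
  qed
  then have "(\<Sum>i<m. prob {\<omega> \<in> space M. \<bar>y + T i \<omega>\<bar> \<le> 1 / K}) \<le> (\<Sum>i<m. 2 / K * (LBINT t. w t * Re (iexp (t * y) * char \<mu> t ^ i)))"
    by (intro sum_mono)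
  also have "\<dots> = 2 / K * (LBINT t. (\<Sum>i<m. w t * Re (iexp (t * y) * char \<mu> t ^ i)))"
  proof -
    have "integrable lborel (\<lambda>t. w t * Re (iexp (t * y) * char \<mu> t ^ i))" for i
    proof (rule Bochner_Integration.integrable_bound[OF w])
      have "\<bar>Re (iexp (t * y) * char \<mu> t ^ i)\<bar> \<le> 1" for t
        by (rule order_trans[OF abs_Re_le_cmod])
          (simp add: norm_mult norm_power power_le_one mu.cmod_char_le_1)
      then show "AE t in lborel. norm (w t * Re (iexp (t * y) * char \<mu> t ^ i)) \<le> norm (w t)"
        by (simp add: abs_mult mult_left_le)
    qed measurable
    then show ?thesis by (subst Bochner_Integration.integral_sum) (simp_all only: sum_distrib_left)
  qed
  also have "\<dots> \<le> 2 / K * (LBINT t. indicator {-K..K} t * cmod (char_sum m t))"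
  proof (intro mult_left_mono integral_mono')
    fix t
    have "(\<Sum>i<m. w t * Re (iexp (t * y) * char \<mu> t ^ i)) = w t * Re (iexp (t * y) * char_sum m t)"
      unfolding char_sum_def sum_distrib_left Re_sum ..
    also have "\<dots> \<le> w t * cmod (char_sum m t)"
      using complex_Re_le_cmod[of "iexp (t * y) * char_sum m t"] w_bound by (intro mult_left_mono) (auto simp: norm_mult)
    also have "\<dots> \<le> indicator {-K..K} t * cmod (char_sum m t)"
      using w_bound by (intro mult_right_mono) auto
    finally show "(\<Sum>i<m. w t * Re (iexp (t * y) * char \<mu> t ^ i)) \<le> indicator {-K..K} t * cmod (char_sum m t)" .
  qed (use K in auto)
  finally show ?thesis .
qed

text \<open>A larger ball corresponds to a narrower band of frequencies: after enlarging the radius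
  to \<open>1 / K\<close> the band lies in the neighbourhood of 0 where \<open>char_sum\<close> has
  an integral of order sqrt m.\<close>

lemma sum_prob_ball_le_sqrt:
  obtains C where "C > 0" "\<And>m. (\<Sum>i<m. prob {w \<in> space M. \<bar>y + T i w\<bar> \<le> \<rho>}) \<le> C * sqrt (real m)"
proof -
  obtain \<delta> C where \<delta>: "\<delta> > 0" "C > 0" "\<And>m. (LBINT t. indicator {-\<delta>..\<delta>} t * cmod (char_sum m t)) \<le> C * sqrt (real m)"
    using integral_norm_char_sum_near_zero by blast
  define K where "K = min \<delta> (1 / (\<bar>\<rho>\<bar> + 1))"
  have K: "K > 0" "K \<le> \<delta>" "K \<le> 1 / (\<bar>\<rho>\<bar> + 1)"
    using \<delta> by (auto simp: K_def)
  have "\<bar>\<rho>\<bar> + 1 \<le> 1 / K"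
    using K by (simp add: field_simps)
  then have \<rho>: "\<rho> \<le> 1 / K" by linarith
  have "(\<Sum>i<m. prob {w \<in> space M. \<bar>y + T i w\<bar> \<le> \<rho>}) \<le> (2 / K * C) * sqrt (real m)" for m
  proof -
    have "(\<Sum>i<m. prob {w \<in> space M. \<bar>y + T i w\<bar> \<le> \<rho>}) \<le> (\<Sum>i<m. prob {w \<in> space M. \<bar>y + T i w\<bar> \<le> 1 / K})"
      using \<rho> by (intro sum_mono finite_measure_mono) auto
    also have "\<dots> \<le> 2 / K * (LBINT t. indicator {-K..K} t * cmod (char_sum m t))" by (rule sum_prob_ball_le[OF K(1)])
    also have "\<dots> \<le> 2 / K * (LBINT t. indicator {-\<delta>..\<delta>} t * cmod (char_sum m t))"
      using K by (intro mult_left_mono integral_mono integrable_norm_char_sum_Icc) (auto simp: indicator_def)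
    also have "\<dots> \<le> 2 / K * (C * sqrt (real m))" using K \<delta> by (intro mult_left_mono) auto
    finally show ?thesis by simp
  qed
  moreover have "2 / K * C > 0" using K \<delta> by simp
  ultimately show ?thesis using that by blast
qed

text \<open>Shrinking the ball gains the prefactor 2 / K. Frequencies near 0 cost order sqrt m
  whatever K is; on the compact remainder of the band \<open>char \<mu>\<close> stays away from 1,
  and the cost is bounded in m.\<close>

lemma sum_prob_ball_nonlattice:
  assumes nl: "\<And>\<theta>. \<theta> \<noteq> 0 \<Longrightarrow> char \<mu> \<theta> \<noteq> 1" and \<epsilon>: "\<epsilon> > 0"
  obtains \<eta> C where "\<eta> > 0" "\<And>y m. (\<Sum>i<m. prob {w \<in> space M. \<bar>y + T i w\<bar> \<le> \<eta>}) \<le> \<epsilon> * sqrt (real m) + C"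
proof -
  obtain \<delta> C where \<delta>: "\<delta> > 0" "C > 0" "\<And>m. (LBINT \<theta>. indicator {-\<delta>..\<delta>} \<theta> * cmod (char_sum m \<theta>)) \<le> C * sqrt (real m)"
    using integral_norm_char_sum_near_zero by blast
  \<comment> \<open>The second entry makes 2 * C / K at most \<epsilon>; the first keeps K beyond
    \<delta>, so that the set \<open>?A\<close> below is nonempty.\<close>
  define K where "K = max (\<delta> + 1) (2 * C / \<epsilon>)"
  have K: "K > 0" "K > \<delta>" "2 / K * C \<le> \<epsilon>"
    using \<delta> \<epsilon> by (auto simp: K_def max_def field_simps)
  let ?A = "{-K..-\<delta>} \<union> {\<delta>..K}"
  have ne: "\<delta> \<in> ?A" using K by auto
  have "compact ?A" by (intro compact_Un compact_Icc)
  moreover have "continuous_on ?A (\<lambda>\<theta>. cmod (1 - char \<mu> \<theta>))"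
    using mu.isCont_char by (intro continuous_intros continuous_at_imp_continuous_on ballI) auto
  ultimately obtain t where t: "t \<in> ?A" "\<And>\<theta>. \<theta> \<in> ?A \<Longrightarrow> cmod (1 - char \<mu> t) \<le> cmod (1 - char \<mu> \<theta>)"
    using continuous_attains_inf[of ?A] ne by blast
  define b where "b = cmod (1 - char \<mu> t)"
  have b: "b > 0" using nl[of t] t(1) \<delta> by (auto simp: b_def)
  have G: "cmod (char_sum m \<theta>) \<le> 2 / b" if "\<theta> \<in> ?A" for m \<theta>
  proof -
    have "cmod (char_sum m \<theta>) * b \<le> cmod (char_sum m \<theta>) * cmod (1 - char \<mu> \<theta>)"
      using t(2)[OF that] by (intro mult_left_mono) (auto simp: b_def)
    then have "cmod (char_sum m \<theta>) * b \<le> 2" using norm_char_sum_mult_le[of m \<theta>] by linarith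
    then show ?thesis using b by (simp add: pos_le_divide_eq)
  qed
  have "(\<Sum>i<m. prob {w \<in> space M. \<bar>y + T i w\<bar> \<le> 1 / K}) \<le> \<epsilon> * sqrt (real m) + 2 / K * (2 / b * (2 * K))" for y m
  proof -
    have ii: "integrable lborel (\<lambda>\<theta>. 2 / b * indicator {-K..K} \<theta>)"
      by (intro integrable_mult_right integrable_real_indicator) (auto simp: emeasure_lborel_Icc_eq)
    have "(LBINT \<theta>. indicator {-K..K} \<theta> * cmod (char_sum m \<theta>)) \<le> (LBINT \<theta>. indicator {-\<delta>..\<delta>} \<theta> * cmod (char_sum m \<theta>) + 2 / b * indicator {-K..K} \<theta>)"
    proof (rule integral_mono)
      show "integrable lborel (\<lambda>\<theta>. indicator {-\<delta>..\<delta>} \<theta> * cmod (char_sum m \<theta>) + 2 / b * indicator {-K..K} \<theta>)"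
        by (intro Bochner_Integration.integrable_add integrable_norm_char_sum_Icc ii)
      show "indicator {-K..K} \<theta> * cmod (char_sum m \<theta>) \<le> indicator {-\<delta>..\<delta>} \<theta> * cmod (char_sum m \<theta>) + 2 / b * indicator {-K..K} \<theta>" for \<theta>
        using G[of \<theta> m] b by (auto simp: indicator_def)
    qed auto
    also have "\<dots> = (LBINT \<theta>. indicator {-\<delta>..\<delta>} \<theta> * cmod (char_sum m \<theta>)) + (LBINT \<theta>. 2 / b * indicator {-K..K} \<theta>)"
      by (rule Bochner_Integration.integral_add[OF integrable_norm_char_sum_Icc ii])
    also have "\<dots> \<le> C * sqrt (real m) + 2 / b * (2 * K)"
      using \<delta>(3)[of m] K b by simp
    finally have "2 / K * (LBINT \<theta>. indicator {-K..K} \<theta> * cmod (char_sum m \<theta>)) \<le> 2 / K * (C * sqrt (real m) + 2 / b * (2 * K))"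
      using K by (intro mult_left_mono) auto
    also have "\<dots> = (2 / K * C) * sqrt (real m) + 2 / K * (2 / b * (2 * K))" by (simp only: distrib_left mult.assoc)
    also have "\<dots> \<le> \<epsilon> * sqrt (real m) + 2 / K * (2 / b * (2 * K))"
      using K(3) by (intro add_right_mono mult_right_mono) auto
    finally show ?thesis using sum_prob_ball_le[OF K(1), of y m] by linarith
  qed
  then show ?thesis using K that[of "1 / K"] by auto
qed

end

section \<open>Comparing smoothed crossings with overshoots\<close>

text \<open>The crossing indicator for a step \<open>r\<close> from \<open>s\<close>, averaged over the levels in \<open>[- h, 0]\<close>.\<close>

definition smooth_crossing :: "real \<Rightarrow> real \<Rightarrow> real \<Rightarrow> real" where
  "smooth_crossing h s r = side r * (\<bar>s + r + h\<bar> - \<bar>s + r\<bar> - \<bar>s + h\<bar> + \<bar>s\<bar>) / (2 * h)"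

text \<open>If neither end of the step lies strictly between - h and 0, the levels in between are
  crossed together or not at all, and the average equals the indicator. Otherwise both are in [0, 1]
  and the right side is at least 1.\<close>

lemma smooth_crossing_approx:
  assumes h: "h > 0"
  shows "\<bar>level_crossing s (s + r) - smooth_crossing h s r\<bar> \<le> of_bool (- h < s \<and> s < 0) + of_bool (- h < s + r \<and> s + r < 0)"
proof -
  \<comment> \<open>The proportion of levels in [- h, 0] below u, a ramp from 0 at - h to 1 at 0;
    \<open>smooth_crossing\<close> is its increment along the step, signed by the direction.\<close>
  define q where "q u = (\<bar>u + h\<bar> - \<bar>u\<bar>) / (2 * h) + 1 / 2" for u
  have q1: "q u = 1" if "u \<ge> 0" for u using that h by (simp add: q_def)
  have q0: "q u = 0" if "u \<le> - h" for u using that h by (simp add: q_def field_simps)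
  have qm: "q u \<le> q v" if "u \<le> v" for u v
    unfolding q_def using that h by (intro add_right_mono divide_right_mono) auto
  have qb: "0 \<le> q u" "q u \<le> 1" for u
    using qm[of "min u (- h)" u] q0[of "min u (- h)"] qm[of u "max u 0"] q1[of "max u 0"] by auto
  have c: "smooth_crossing h s r = side r * (q (s + r) - q s)"
    using h by (simp add: smooth_crossing_def q_def diff_divide_distrib add_divide_distrib algebra_simps)
  have cb: "0 \<le> smooth_crossing h s r \<and> smooth_crossing h s r \<le> 1"
    unfolding c using qm[of s "s + r"] qm[of "s + r" s] qb[of s] qb[of "s + r"] by (auto simp: side_def)
  show ?thesis
  proof (cases "(- h < s \<and> s < 0) \<or> (- h < s + r \<and> s + r < 0)")
    case True
    then have "1 \<le> of_bool (- h < s \<and> s < 0) + (of_bool (- h < s + r \<and> s + r < 0) :: real)" by auto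
    moreover have "\<bar>level_crossing s (s + r) - smooth_crossing h s r\<bar> \<le> 1"
      using cb level_crossing_bounds[of s "s + r"] by linarith
    ultimately show ?thesis by linarith
  next
    case False
    then have "s \<le> - h \<or> s \<ge> 0" "s + r \<le> - h \<or> s + r \<ge> 0" by auto
    then have "level_crossing s (s + r) = smooth_crossing h s r"
      unfolding c using q0[of s] q1[of s] q0[of "s + r"] q1[of "s + r"] h
      by (auto simp: level_crossing_def side_def)
    then show ?thesis by simp
  qed
qed

lemma one_minus_cos_eq: "(cmod (iexp u - 1))\<^sup>2 = 2 * (1 - cos u)"
proof -
  have "(cmod (iexp u - 1))\<^sup>2 = (cos u - 1)\<^sup>2 + (sin u)\<^sup>2"
    by (simp add: cmod_power2 Re_exp Im_exp)
  also have "\<dots> = 2 * (1 - cos u)"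
    using sin_cos_squared_add[of u] by (simp add: power2_diff)
  finally show ?thesis .
qed

lemma norm_iexp_minus_one_le: "cmod (iexp u - 1) \<le> 2"
  using norm_triangle_ineq4[of "iexp u" 1] by simp

lemma norm_iexp_linear_le: "cmod (iexp u - 1 - \<i> * u) \<le> u\<^sup>2 / 2"
  using iexp_approx1[of u 1] by (simp add: diff_diff_eq numeral_2_eq_2)

section \<open>The Fourier symbol: behaviour at the origin and decay\<close>

context centered_walk
begin

definition \<kappa> :: real where "\<kappa> = (\<integral>r. \<bar>r\<bar> \<partial>\<mu>) / \<sigma>\<^sup>2"

text \<open>The transform of a step difference weighted by the direction of the step. The sign makes
  smoothed crossings count positively in both directions and brings |r| instead of r into the
  expansion at 0.\<close>

definition \<beta> :: "real \<Rightarrow> complex" where "\<beta> t = (CLINT r|\<mu>. of_real (side r) * (iexp (t * r) - 1))"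

text \<open>The Fourier symbol of the expected one-step value of the smoothed crossing indicator minus
  \<open>2 * \<kappa>\<close> times the overshoot.\<close>

definition symbol :: "real \<Rightarrow> real \<Rightarrow> complex" where
  "symbol h t = (- (iexp (t * h) - 1) * \<beta> t / of_real (2 * h) - of_real \<kappa> * (1 - char \<mu> t)) / of_real (t\<^sup>2)"

lemma \<beta>_measurable [measurable]: "\<beta> \<in> borel_measurable borel"
  unfolding \<beta>_def[abs_def] by measurable

lemma symbol_measurable [measurable]: "symbol h \<in> borel_measurable borel"
  unfolding symbol_def[abs_def] by measurable

lemma \<kappa>_nonneg: "\<kappa> \<ge> 0"
  by (simp add: \<kappa>_def)

lemma integrable_iexp_diff: "integrable \<mu> (\<lambda>r. of_real (side r) * (iexp (t * r) - 1))"
proof (rule mu.integrable_const_bound[where B=2])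
  show "AE r in \<mu>. norm (of_real (side r) * (iexp (t * r) - 1)) \<le> 2"
  proof (rule AE_I2)
    fix r show "norm (of_real (side r) * (iexp (t * r) - 1)) \<le> 2"
      using norm_iexp_minus_one_le[of "t * r"] by (simp add: norm_mult side_def)
  qed
qed measurable

text \<open>Cauchy-Schwarz: the squared mean of |iexp (t * r) - 1| is at most the mean of its
  square, which is 2 * (1 - Re (char \<mu> t)). The exponent 1/2 in the symbol bound originates
  here.\<close>

lemma norm_\<beta>_le: "cmod (\<beta> t) \<le> sqrt 2 * sqrt (cmod (1 - char \<mu> t))"
proof -
  let ?f = "\<lambda>r. cmod (iexp (t * r) - 1)"
  have i1: "integrable \<mu> ?f"
    by (rule mu.integrable_const_bound[where B=2, OF AE_I2]) (simp_all only: norm_iexp_minus_one_le real_norm_def abs_norm_cancel, measurable)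
  have i2: "integrable \<mu> (\<lambda>r. (?f r)\<^sup>2)"
    by (rule mu.integrable_const_bound[where B="2\<^sup>2", OF AE_I2])
      (simp_all only: real_norm_def abs_power2 power_mono[OF norm_iexp_minus_one_le norm_ge_zero], measurable)
  have ic: "integrable \<mu> (\<lambda>r. iexp (t * r))" by (rule mu.integrable_iexp) auto
  have "cmod (\<beta> t) \<le> (\<integral>r. cmod (of_real (side r) * (iexp (t * r) - 1)) \<partial>\<mu>)"
    unfolding \<beta>_def by (rule integral_norm_bound)
  also have "\<dots> = (\<integral>r. ?f r \<partial>\<mu>)" by (intro Bochner_Integration.integral_cong refl) (auto simp: norm_mult side_def)
  finally have 1: "cmod (\<beta> t) \<le> (\<integral>r. ?f r \<partial>\<mu>)" .
  have "(\<integral>r. ?f r \<partial>\<mu>)\<^sup>2 \<le> (\<integral>r. (?f r)\<^sup>2 \<partial>\<mu>)"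
    using mu.variance_eq[OF i1 i2] mu.variance_positive[of ?f] by linarith
  also have "\<dots> = (\<integral>r. 2 * (1 - cos (t * r)) \<partial>\<mu>)" by (simp only: one_minus_cos_eq)
  also have "\<dots> = 2 * (1 - (\<integral>r. cos (t * r) \<partial>\<mu>))"
  proof -
    have "integrable \<mu> (\<lambda>r. cos (t * r))" by (rule mu.integrable_const_bound[where B=1]) auto
    then show ?thesis using mu.prob_space by simp
  qed
  also have "(\<integral>r. cos (t * r) \<partial>\<mu>) = (\<integral>r. Re (iexp (t * r)) \<partial>\<mu>)" by (simp add: Re_exp)
  also have "\<dots> = Re (char \<mu> t)" unfolding char_def by (rule integral_Re[OF ic])
  also have "2 * (1 - Re (char \<mu> t)) \<le> 2 * cmod (1 - char \<mu> t)"
    using complex_Re_le_cmod[of "1 - char \<mu> t"] by simp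
  finally have "(\<integral>r. ?f r \<partial>\<mu>) \<le> sqrt (2 * cmod (1 - char \<mu> t))" by (rule real_le_rsqrt)
  with 1 show ?thesis by (simp add: real_sqrt_mult)
qed

text \<open>As \<open>side r * r\<close> is |r|, the first-order term is the first absolute moment;
  the remainder is quadratic in t with an integrable coefficient.\<close>

lemma \<beta>_quotient_tendsto: "((\<lambda>t. \<beta> t / of_real t) \<longlongrightarrow> \<i> * of_real (\<integral>r. \<bar>r\<bar> \<partial>\<mu>)) (at 0)"
proof -
  define a where "a = (\<integral>r. \<bar>r\<bar> \<partial>\<mu>)"
  have b: "cmod (\<beta> t - \<i> * of_real t * of_real a) \<le> t\<^sup>2 * \<sigma>\<^sup>2 / 2" for t
  proof -
    have i: "integrable \<mu> (\<lambda>r. \<i> * of_real t * complex_of_real \<bar>r\<bar>)" by (intro integrable_mult_right integrable_of_real) auto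
    have a: "complex_of_real a = (CLINT r|\<mu>. complex_of_real \<bar>r\<bar>)" unfolding a_def by simp
    have "\<beta> t - \<i> * of_real t * of_real a = (CLINT r|\<mu>. of_real (side r) * (iexp (t * r) - 1) - \<i> * of_real t * complex_of_real \<bar>r\<bar>)"
      unfolding \<beta>_def a by (subst Bochner_Integration.integral_diff[OF integrable_iexp_diff i]) (simp only: integral_mult_right_zero)
    also have "cmod \<dots> \<le> (\<integral>r. t\<^sup>2 * r\<^sup>2 / 2 \<partial>\<mu>)"
    proof (rule order_trans[OF integral_norm_bound], rule integral_mono)
      show "integrable \<mu> (\<lambda>r. t\<^sup>2 * r\<^sup>2 / 2)" by auto
      show "integrable \<mu> (\<lambda>r. cmod (of_real (side r) * (iexp (t * r) - 1) - \<i> * of_real t * complex_of_real \<bar>r\<bar>))"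
        using integrable_iexp_diff i by auto
      fix r
      have "of_real (side r) * (iexp (t * r) - 1) - \<i> * of_real t * complex_of_real \<bar>r\<bar> = of_real (side r) * (iexp (t * r) - 1 - \<i> * of_real (t * r))"
        by (auto simp: side_def algebra_simps)
      then have "cmod (of_real (side r) * (iexp (t * r) - 1) - \<i> * of_real t * complex_of_real \<bar>r\<bar>) = cmod (iexp (t * r) - 1 - \<i> * of_real (t * r))"
        by (simp only: norm_mult) (simp add: side_def)
      then show "cmod (of_real (side r) * (iexp (t * r) - 1) - \<i> * of_real t * complex_of_real \<bar>r\<bar>) \<le> t\<^sup>2 * r\<^sup>2 / 2"
        using norm_iexp_linear_le[of "t * r"] by (simp only: power_mult_distrib)
    qed
    finally show ?thesis by simp
  qed
  have "((\<lambda>t. \<beta> t / of_real t - \<i> * of_real a) \<longlongrightarrow> 0) (at 0)"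
  proof (rule Lim_null_comparison)
    have "cmod (\<beta> t / of_real t - \<i> * of_real a) \<le> \<bar>t\<bar> * \<sigma>\<^sup>2 / 2" if "t \<noteq> 0" for t
    proof -
      have "\<beta> t / of_real t - \<i> * of_real a = (\<beta> t - \<i> * of_real t * of_real a) / of_real t"
        using that by (simp add: field_simps)
      then have "cmod (\<beta> t / of_real t - \<i> * of_real a) = cmod (\<beta> t - \<i> * of_real t * of_real a) / \<bar>t\<bar>"
        by (simp only: norm_divide norm_of_real)
      also have "\<dots> \<le> (t\<^sup>2 * \<sigma>\<^sup>2 / 2) / \<bar>t\<bar>" by (intro divide_right_mono b) simp
      also have "\<dots> = \<bar>t\<bar> * \<sigma>\<^sup>2 / 2" using that by (simp add: power2_eq_square abs_if)
      finally show ?thesis .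
    qed
    then show "\<forall>\<^sub>F t in at 0. cmod (\<beta> t / of_real t - \<i> * of_real a) \<le> \<bar>t\<bar> * \<sigma>\<^sup>2 / 2"
      by (auto simp: eventually_at_filter)
    show "((\<lambda>t. \<bar>t\<bar> * \<sigma>\<^sup>2 / 2) \<longlongrightarrow> 0) (at 0)" by (auto intro!: tendsto_eq_intros)
  qed
  then show ?thesis unfolding a_def by (simp only: LIM_zero_iff)
qed

lemma iexp_quotient_tendsto: "((\<lambda>t. (iexp (t * h) - 1) / of_real t) \<longlongrightarrow> \<i> * of_real h) (at 0)"
proof -
  have "((\<lambda>t. (iexp (t * h) - 1) / of_real t - \<i> * of_real h) \<longlongrightarrow> 0) (at 0)"
  proof (rule Lim_null_comparison)
    have "cmod ((iexp (t * h) - 1) / of_real t - \<i> * of_real h) \<le> \<bar>t\<bar> * h\<^sup>2 / 2" if "t \<noteq> 0" for t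
    proof -
      have "(iexp (t * h) - 1) / of_real t - \<i> * of_real h = (iexp (t * h) - 1 - \<i> * of_real (t * h)) / of_real t"
        using that by (simp add: field_simps)
      then have "cmod ((iexp (t * h) - 1) / of_real t - \<i> * of_real h) = cmod (iexp (t * h) - 1 - \<i> * of_real (t * h)) / \<bar>t\<bar>"
        by (simp only: norm_divide norm_of_real)
      also have "\<dots> \<le> ((t * h)\<^sup>2 / 2) / \<bar>t\<bar>" by (intro divide_right_mono norm_iexp_linear_le) simp
      also have "\<dots> = \<bar>t\<bar> * h\<^sup>2 / 2" using that by (simp add: power2_eq_square abs_if)
      finally show ?thesis .
    qed
    then show "\<forall>\<^sub>F t in at 0. cmod ((iexp (t * h) - 1) / of_real t - \<i> * of_real h) \<le> \<bar>t\<bar> * h\<^sup>2 / 2"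
      by (auto simp: eventually_at_filter)
    show "((\<lambda>t. \<bar>t\<bar> * h\<^sup>2 / 2) \<longlongrightarrow> 0) (at 0)" by (auto intro!: tendsto_eq_intros)
  qed
  then show ?thesis by (simp only: LIM_zero_iff)
qed

text \<open>The smoothing factor and \<beta>, divided by t, tend to i h and i E|X_1|, so the first
  part tends to E|X_1| / 2. The second part tends to \<kappa> \<sigma>^2 / 2, and the definition of
  \<kappa> makes the two equal.\<close>

lemma symbol_tendsto_zero:
  assumes h: "h > 0"
  shows "(symbol h \<longlongrightarrow> 0) (at 0)"
proof -
  define a where "a = (\<integral>r. \<bar>r\<bar> \<partial>\<mu>)"
  have "((\<lambda>t. - ((iexp (t * h) - 1) / of_real t) * (\<beta> t / of_real t) / of_real (2 * h) - of_real \<kappa> * ((1 - char \<mu> t) / of_real (t\<^sup>2)))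
    \<longlongrightarrow> - (\<i> * of_real h) * (\<i> * of_real a) / of_real (2 * h) - of_real \<kappa> * of_real (\<sigma>\<^sup>2 / 2)) (at 0)"
    unfolding a_def using h
    by (intro tendsto_diff tendsto_mult tendsto_divide tendsto_minus tendsto_const
      iexp_quotient_tendsto \<beta>_quotient_tendsto char_quotient_tendsto) auto
  moreover have "- (\<i> * of_real h) * (\<i> * of_real a) / of_real (2 * h) - of_real \<kappa> * complex_of_real (\<sigma>\<^sup>2 / 2) = 0"
  proof -
    have "- (\<i> * of_real h) * (\<i> * of_real a) / of_real (2 * h) = complex_of_real (a / 2)"
      using h by (simp add: field_simps)
    moreover have "of_real \<kappa> * complex_of_real (\<sigma>\<^sup>2 / 2) = complex_of_real (a / 2)"
      using sigma_pos unfolding of_real_mult[symmetric] by (simp add: \<kappa>_def a_def)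
    ultimately show ?thesis by simp
  qed
  moreover have "(\<lambda>t. - ((iexp (t * h) - 1) / of_real t) * (\<beta> t / of_real t) / of_real (2 * h) - of_real \<kappa> * ((1 - char \<mu> t) / of_real (t\<^sup>2))) = symbol h"
  proof
    have alg: "- (e / z) * (b / z) / H - k * (d / z\<^sup>2) = (- e * b / H - k * d) / z\<^sup>2" for e b d z H k :: complex
      by (simp add: diff_divide_distrib power2_eq_square)
    show "- ((iexp (t * h) - 1) / of_real t) * (\<beta> t / of_real t) / of_real (2 * h) - of_real \<kappa> * ((1 - char \<mu> t) / of_real (t\<^sup>2)) = symbol h t" for t
      unfolding symbol_def of_real_power by (rule alg)
  qed
  ultimately show ?thesis by (simp only:)
qed

text \<open>The bound on \<beta> already carries the square root; since |1 - char \<mu> t| is at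
  most 2, the other summand can be lowered to the same power. The decay 1 / t^2 at infinity is what
  the smoothing buys.\<close>

lemma norm_symbol_le:
  assumes h: "h > 0"
  shows "cmod (symbol h t) \<le> sqrt 2 * (1 / h + \<kappa>) * (sqrt (cmod (1 - char \<mu> t)) / t\<^sup>2)"
proof -
  let ?s = "sqrt (cmod (1 - char \<mu> t))"
  have "cmod (1 - char \<mu> t) \<le> 2"
    using norm_triangle_ineq4[of 1 "char \<mu> t"] mu.cmod_char_le_1[of t] by simp
  then have "?s \<le> sqrt 2" by simp
  then have s: "cmod (1 - char \<mu> t) \<le> sqrt 2 * ?s"
    using mult_right_mono[of ?s "sqrt 2" ?s] by simp
  have "cmod (- (iexp (t * h) - 1) * \<beta> t / of_real (2 * h)) = cmod (iexp (t * h) - 1) * cmod (\<beta> t) / (2 * h)"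
    using h by (simp add: norm_mult norm_divide norm_minus_commute del: of_real_mult)
  also have "\<dots> \<le> 2 * (sqrt 2 * ?s) / (2 * h)"
    using h by (intro divide_right_mono mult_mono norm_iexp_minus_one_le norm_\<beta>_le) auto
  also have "\<dots> = sqrt 2 * (1 / h) * ?s" by simp
  finally have 1: "cmod (- (iexp (t * h) - 1) * \<beta> t / of_real (2 * h)) \<le> sqrt 2 * (1 / h) * ?s" .
  have "cmod (of_real \<kappa> * (1 - char \<mu> t)) = \<kappa> * cmod (1 - char \<mu> t)"
    using \<kappa>_nonneg by (simp only: norm_mult norm_of_real abs_of_nonneg)
  also have "\<dots> \<le> \<kappa> * (sqrt 2 * ?s)" by (intro mult_left_mono s \<kappa>_nonneg)
  finally have 2: "cmod (of_real \<kappa> * (1 - char \<mu> t)) \<le> \<kappa> * (sqrt 2 * ?s)" .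
  have "cmod (symbol h t) = cmod (- (iexp (t * h) - 1) * \<beta> t / of_real (2 * h) - of_real \<kappa> * (1 - char \<mu> t)) / t\<^sup>2"
    unfolding symbol_def norm_divide norm_of_real by simp
  also have "\<dots> \<le> (sqrt 2 * (1 / h) * ?s + \<kappa> * (sqrt 2 * ?s)) / t\<^sup>2"
    using 1 2 by (intro divide_right_mono order_trans[OF norm_triangle_ineq4]) auto
  also have "\<dots> = sqrt 2 * (1 / h + \<kappa>) * (?s / t\<^sup>2)" by (simp add: algebra_simps add_divide_distrib)
  finally show ?thesis .
qed

text \<open>The geometric mean of the two bounds on \<open>char_sum\<close>, namely m and 2 / |1 -
  char \<mu> t|, has order sqrt m and consumes exactly the square root that the symbol
  provides.\<close>

lemma norm_char_sum_symbol_le: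
  assumes h: "h > 0"
  shows "cmod (char_sum m t) * cmod (symbol h t) \<le> 2 * (1 / h + \<kappa>) * (sqrt (real m) / t\<^sup>2)"
proof -
  let ?g = "cmod (char_sum m t)" and ?d = "cmod (1 - char \<mu> t)"
  have "?g * (?g * ?d) \<le> real m * 2" by (intro mult_mono norm_char_sum_le norm_char_sum_mult_le) auto
  then have "(?g * sqrt ?d)\<^sup>2 \<le> 2 * real m" by (simp add: power_mult_distrib power2_eq_square mult_ac)
  then have gd: "?g * sqrt ?d \<le> sqrt 2 * sqrt (real m)"
    using real_le_rsqrt[of "?g * sqrt ?d" "2 * real m"] by (simp add: real_sqrt_mult)
  have "?g * cmod (symbol h t) \<le> ?g * (sqrt 2 * (1 / h + \<kappa>) * (sqrt ?d / t\<^sup>2))"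
    by (intro mult_left_mono norm_symbol_le h) auto
  also have "\<dots> = sqrt 2 * (1 / h + \<kappa>) * ((?g * sqrt ?d) / t\<^sup>2)" by simp
  also have "\<dots> \<le> sqrt 2 * (1 / h + \<kappa>) * ((sqrt 2 * sqrt (real m)) / t\<^sup>2)"
    using h \<kappa>_nonneg by (intro mult_left_mono divide_right_mono gd) auto
  also have "\<dots> = (sqrt 2 * sqrt 2) * ((1 / h + \<kappa>) * (sqrt (real m) / t\<^sup>2))" by (simp only: mult_ac times_divide_eq_right)
  also have "\<dots> = 2 * (1 / h + \<kappa>) * (sqrt (real m) / t\<^sup>2)" by simp
  finally show ?thesis .
qed

text \<open>Near 0 the symbol is small while \<open>char_sum\<close> has an integral of order sqrt
  m. Away from 0 the product divided by sqrt m is dominated and tends to 0 pointwise: where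
  \<open>char \<mu> t\<close> differs from 1 because \<open>char_sum\<close> stays bounded, where it
  equals 1 because the symbol vanishes. The latter covers the dual periods of a lattice
  walk.\<close>

lemma integral_norm_char_sum_symbol:
  assumes h: "h > 0"
  shows "integrable lborel (\<lambda>t. cmod (char_sum m t) * cmod (symbol h t))"
    and "\<epsilon> > 0 \<Longrightarrow> \<exists>C. \<forall>m. (LBINT t. cmod (char_sum m t) * cmod (symbol h t)) \<le> \<epsilon> * sqrt (real m) + C"
proof -
  define c where "c = 2 * (1 / h + \<kappa>)"
  have c: "c \<ge> 0" using h \<kappa>_nonneg by (simp add: c_def)
  define tail where "tail \<delta> m t = indicator (- {-\<delta>..\<delta>}) t * (cmod (char_sum m t) * cmod (symbol h t))" for \<delta> m t
  \<comment> \<open>For |t| > \<delta>, 1 / t^2 is at most (1 + 1 / \<delta>^2) / (1 + t^2), which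
    is integrable over the whole line.\<close>
  define dom where "dom \<delta> t = c * (1 + 1 / \<delta>\<^sup>2) * (1 / (1 + 1 * t\<^sup>2))" for \<delta> t :: real
  have dom: "integrable lborel (dom \<delta>)" for \<delta>
    unfolding dom_def[abs_def] using has_bochner_integral_inverse_one_plus_square[of 1]
    by (intro integrable_mult_right) (simp add: has_bochner_integral_iff)
  have tail_le: "tail \<delta> m t \<le> sqrt (real m) * dom \<delta> t" if "\<delta> > 0" for \<delta> m t
  proof (cases "\<bar>t\<bar> \<le> \<delta>")
    case True
    then have "tail \<delta> m t = 0" by (auto simp: tail_def abs_le_iff)
    then show ?thesis using c by (simp add: dom_def)
  next
    case False
    have "\<delta>\<^sup>2 \<le> t\<^sup>2" using False that by (auto simp: abs_le_square_iff[symmetric])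
    moreover have "t \<noteq> 0" using False that by auto
    ultimately have "1 + 1 / t\<^sup>2 \<le> 1 + 1 / \<delta>\<^sup>2"
      using that by (simp add: frac_le)
    then have "(1 + 1 / t\<^sup>2) * (1 / (1 + 1 * t\<^sup>2)) \<le> (1 + 1 / \<delta>\<^sup>2) * (1 / (1 + 1 * t\<^sup>2))"
      by (rule mult_right_mono) simp
    moreover have "(1 + 1 / t\<^sup>2) * (1 / (1 + 1 * t\<^sup>2)) = 1 / t\<^sup>2"
    proof -
      have "1 + t\<^sup>2 > 0" by (simp add: add_pos_nonneg)
      moreover have "1 + 1 / t\<^sup>2 = (1 + t\<^sup>2) / t\<^sup>2" using \<open>t \<noteq> 0\<close> by (simp add: field_simps)
      ultimately show ?thesis by simp
    qed
    ultimately have "1 / t\<^sup>2 \<le> (1 + 1 / \<delta>\<^sup>2) * (1 / (1 + 1 * t\<^sup>2))" by simp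
    then have "(c * sqrt (real m)) * (1 / t\<^sup>2) \<le> (c * sqrt (real m)) * ((1 + 1 / \<delta>\<^sup>2) * (1 / (1 + 1 * t\<^sup>2)))"
      using c by (intro mult_left_mono) auto
    moreover have "tail \<delta> m t \<le> c * (sqrt (real m) / t\<^sup>2)"
    proof -
      have "indicator (- {-\<delta>..\<delta>}) t = (1::real)" using False by (auto simp: abs_le_iff)
      then show ?thesis using norm_char_sum_symbol_le[OF h, of m t] by (simp only: tail_def c_def mult_1_left)
    qed
    ultimately show ?thesis by (simp add: dom_def mult_ac)
  qed
  have tail0: "0 \<le> tail \<delta> m t" for \<delta> m t by (simp add: tail_def)
  have tail_meas [measurable]: "tail \<delta> m \<in> borel_measurable borel" for \<delta> m unfolding tail_def[abs_def] by measurable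
  have dom_meas [measurable]: "dom \<delta> \<in> borel_measurable borel" for \<delta> unfolding dom_def[abs_def] by measurable
  have tail_int: "integrable lborel (tail \<delta> m)" if "\<delta> > 0" for \<delta> m
  proof (rule Bochner_Integration.integrable_bound)
    show "integrable lborel (\<lambda>t. sqrt (real m) * dom \<delta> t)" using dom by auto
    show "AE t in lborel. norm (tail \<delta> m t) \<le> norm (sqrt (real m) * dom \<delta> t)"
    proof (rule AE_I2)
      fix t show "norm (tail \<delta> m t) \<le> norm (sqrt (real m) * dom \<delta> t)"
        using tail_le[OF that, of m t] tail0[of \<delta> m t] unfolding real_norm_def by linarith
    qed
  qed measurable
  have near: "\<exists>\<delta>>0. \<delta> \<le> d \<and> (\<forall>t. \<bar>t\<bar> \<le> \<delta> \<longrightarrow> cmod (symbol h t) \<le> e)" if "e > 0" "d > 0" for e d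
  proof -
    have "\<forall>\<^sub>F t in at 0. dist (symbol h t) 0 < e" using symbol_tendsto_zero[OF h] that by (simp add: tendsto_iff)
    then obtain \<delta> where \<delta>: "\<delta> > 0" "\<And>t. t \<noteq> 0 \<Longrightarrow> \<bar>t\<bar> < \<delta> \<Longrightarrow> cmod (symbol h t) < e"
      unfolding eventually_at by (auto simp: dist_real_def)
    \<comment> \<open>Division by zero yields 0 at the origin, in agreement with the limit
      there.\<close>
    have "symbol h 0 = 0" by (simp add: symbol_def)
    then have "cmod (symbol h t) \<le> e" if "\<bar>t\<bar> \<le> min (\<delta> / 2) d" for t
      using \<delta>(2)[of t] that \<delta>(1) \<open>e > 0\<close> by (cases "t = 0") auto
    then show ?thesis using \<delta>(1) that by (intro exI[of _ "min (\<delta> / 2) d"]) auto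
  qed
  have split: "cmod (char_sum m t) * cmod (symbol h t) \<le> e * (indicator {-\<delta>..\<delta>} t * cmod (char_sum m t)) + tail \<delta> m t"
    if "\<And>t. \<bar>t\<bar> \<le> \<delta> \<Longrightarrow> cmod (symbol h t) \<le> e" for \<delta> e m t
    using mult_left_mono[OF that[of t], of "cmod (char_sum m t)"]
    by (cases "\<bar>t\<bar> \<le> \<delta>") (auto simp: tail_def indicator_def abs_le_iff mult_ac)
  obtain \<delta>1 where \<delta>1: "\<delta>1 > 0" "\<And>t. \<bar>t\<bar> \<le> \<delta>1 \<Longrightarrow> cmod (symbol h t) \<le> 1" using near[of 1 1] by auto
  show int: "integrable lborel (\<lambda>t. cmod (char_sum m t) * cmod (symbol h t))" for m
  proof (rule Bochner_Integration.integrable_bound)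
    show "integrable lborel (\<lambda>t. 1 * (indicator {-\<delta>1..\<delta>1} t * cmod (char_sum m t)) + tail \<delta>1 m t)"
      by (intro Bochner_Integration.integrable_add integrable_mult_right integrable_norm_char_sum_Icc tail_int \<delta>1)
    show "AE t in lborel. norm (cmod (char_sum m t) * cmod (symbol h t)) \<le> norm (1 * (indicator {-\<delta>1..\<delta>1} t * cmod (char_sum m t)) + tail \<delta>1 m t)"
    proof (rule AE_I2)
      fix t show "norm (cmod (char_sum m t) * cmod (symbol h t)) \<le> norm (1 * (indicator {-\<delta>1..\<delta>1} t * cmod (char_sum m t)) + tail \<delta>1 m t)"
      proof -
        have "cmod (char_sum m t) * cmod (symbol h t) \<le> 1 * (indicator {-\<delta>1..\<delta>1} t * cmod (char_sum m t)) + tail \<delta>1 m t"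
          by (rule split) (rule \<delta>1(2))
        then show ?thesis unfolding real_norm_def by (smt (verit) mult_nonneg_nonneg norm_ge_zero)
      qed
    qed
  qed measurable
  assume \<epsilon>: "\<epsilon> > 0"
  obtain \<delta>0 C0 where C0: "\<delta>0 > 0" "C0 > 0" "\<And>m. (LBINT t. indicator {-\<delta>0..\<delta>0} t * cmod (char_sum m t)) \<le> C0 * sqrt (real m)"
    using integral_norm_char_sum_near_zero by blast
  obtain \<delta> where \<delta>: "\<delta> > 0" "\<delta> \<le> \<delta>0" "\<And>t. \<bar>t\<bar> \<le> \<delta> \<Longrightarrow> cmod (symbol h t) \<le> \<epsilon> / (2 * C0)"
    using near[of "\<epsilon> / (2 * C0)" \<delta>0] \<epsilon> C0 by auto
  have lim: "(\<lambda>m. LBINT t. tail \<delta> m t / sqrt (real m)) \<longlonglongrightarrow> integral\<^sup>L lborel (\<lambda>_::real. 0)"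
  proof (rule integral_dominated_convergence[where w="dom \<delta>"])
    show "integrable lborel (dom \<delta>)" by (rule dom)
    show "AE t in lborel. norm (tail \<delta> m t / sqrt (real m)) \<le> dom \<delta> t" for m
    proof (rule AE_I2)
      fix t show "norm (tail \<delta> m t / sqrt (real m)) \<le> dom \<delta> t"
      proof (cases "m = 0")
        case True
        have "0 \<le> dom \<delta> t" using c by (simp add: dom_def)
        then show ?thesis using True by simp
      next
        case False
        then have "tail \<delta> m t / sqrt (real m) \<le> dom \<delta> t"
          using tail_le[OF \<delta>(1), of m t] by (subst pos_divide_le_eq) (simp_all add: mult.commute)
        then show ?thesis using tail0[of \<delta> m t] by simp
      qed
    qed
    show "AE t in lborel. (\<lambda>m. tail \<delta> m t / sqrt (real m)) \<longlonglongrightarrow> 0"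
    proof (rule AE_I2)
      fix t
      show "(\<lambda>m. tail \<delta> m t / sqrt (real m)) \<longlonglongrightarrow> 0"
      proof (cases "char \<mu> t = 1")
        case True
        have "cmod (symbol h t) \<le> 0" using norm_symbol_le[OF h, of t] True by simp
        then show ?thesis by (simp add: tail_def)
      next
        case False
        define B where "B = 2 / cmod (1 - char \<mu> t) * cmod (symbol h t)"
        have "tail \<delta> m t \<le> B" for m
        proof -
          have "cmod (char_sum m t) \<le> 2 / cmod (1 - char \<mu> t)"
            using norm_char_sum_mult_le[of m t] False by (subst pos_le_divide_eq) auto
          then have "cmod (char_sum m t) * cmod (symbol h t) \<le> B" unfolding B_def by (intro mult_right_mono) auto
          moreover have "tail \<delta> m t \<le> 1 * (cmod (char_sum m t) * cmod (symbol h t))"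
            unfolding tail_def by (intro mult_right_mono) (auto simp: indicator_def)
          ultimately show ?thesis by linarith
        qed
        then have le: "norm (tail \<delta> m t / sqrt (real m)) \<le> B / sqrt (real m)" for m
          using tail0[of \<delta> m t] by (simp add: divide_right_mono)
        have "(\<lambda>m. B / sqrt (real m)) \<longlonglongrightarrow> 0"
    by (rule tendsto_inverse_sqrt)
        then show ?thesis
          by (rule Lim_null_comparison[OF always_eventually, rotated]) (use le in simp)
      qed
    qed
  qed measurable
  have "\<forall>\<^sub>F m in sequentially. (LBINT t. tail \<delta> m t / sqrt (real m)) < \<epsilon> / 2"
  proof (rule order_tendstoD(2))
    show "(\<lambda>m. LBINT t. tail \<delta> m t / sqrt (real m)) \<longlonglongrightarrow> 0" using lim by (simp only: integral_zero)
    show "0 < \<epsilon> / 2" using \<epsilon> by simp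
  qed
  then obtain N where N: "\<And>m. m \<ge> N \<Longrightarrow> (LBINT t. tail \<delta> m t / sqrt (real m)) < \<epsilon> / 2"
    by (auto simp: eventually_sequentially)
  define I where "I m = (LBINT t. cmod (char_sum m t) * cmod (symbol h t))" for m
  have I0: "I m \<ge> 0" for m unfolding I_def by (intro Bochner_Integration.integral_nonneg) auto
  have big: "I m \<le> \<epsilon> * sqrt (real m)" if "m \<ge> N" "m > 0" for m
  proof -
    have "I m \<le> (LBINT t. \<epsilon> / (2 * C0) * (indicator {-\<delta>..\<delta>} t * cmod (char_sum m t)) + tail \<delta> m t)"
      unfolding I_def using int split[OF \<delta>(3)] tail_int[OF \<delta>(1)]
      by (intro integral_mono Bochner_Integration.integrable_add integrable_mult_right integrable_norm_char_sum_Icc)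
    also have "\<dots> = \<epsilon> / (2 * C0) * (LBINT t. indicator {-\<delta>..\<delta>} t * cmod (char_sum m t)) + (LBINT t. tail \<delta> m t)"
      by (subst Bochner_Integration.integral_add[OF integrable_mult_right[OF integrable_norm_char_sum_Icc] tail_int[OF \<delta>(1)]])
        (simp only: integral_mult_right_zero)
    finally have 1: "I m \<le> \<epsilon> / (2 * C0) * (LBINT t. indicator {-\<delta>..\<delta>} t * cmod (char_sum m t)) + (LBINT t. tail \<delta> m t)" .
    have "(LBINT t. indicator {-\<delta>..\<delta>} t * cmod (char_sum m t)) \<le> (LBINT t. indicator {-\<delta>0..\<delta>0} t * cmod (char_sum m t))"
      using \<delta> by (intro integral_mono integrable_norm_char_sum_Icc) (auto simp: indicator_def)
    also have "\<dots> \<le> C0 * sqrt (real m)" by (rule C0)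
    finally have "\<epsilon> / (2 * C0) * (LBINT t. indicator {-\<delta>..\<delta>} t * cmod (char_sum m t)) \<le> \<epsilon> / (2 * C0) * (C0 * sqrt (real m))"
      using \<epsilon> C0 by (intro mult_left_mono) auto
    also have "\<dots> = \<epsilon> / 2 * sqrt (real m)" using C0 by simp
    finally have 2: "\<epsilon> / (2 * C0) * (LBINT t. indicator {-\<delta>..\<delta>} t * cmod (char_sum m t)) \<le> \<epsilon> / 2 * sqrt (real m)" .
    have "(LBINT t. tail \<delta> m t / sqrt (real m)) = (LBINT t. tail \<delta> m t) / sqrt (real m)" by simp
    then have "(LBINT t. tail \<delta> m t) \<le> \<epsilon> / 2 * sqrt (real m)"
      using N[OF that(1)] that(2) by (simp add: pos_divide_less_eq)
    with 1 2 have "I m \<le> \<epsilon> / 2 * sqrt (real m) + \<epsilon> / 2 * sqrt (real m)" by linarith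
    then show ?thesis by simp
  qed
  \<comment> \<open>The finitely many indices up to N are absorbed by the additive constant.\<close>
  have "I m \<le> \<epsilon> * sqrt (real m) + (\<Sum>k\<le>N. I k)" for m
  proof (cases "m \<le> N")
    case True
    then have "I m \<le> (\<Sum>k\<le>N. I k)" using I0 by (intro member_le_sum) auto
    moreover have "\<epsilon> * sqrt (real m) \<ge> 0" using \<epsilon> by simp
    ultimately show ?thesis by linarith
  next
    case False
    then show ?thesis using big[of m] sum_nonneg[of "{..N}" I] I0 by auto
  qed
  then show "\<exists>C. \<forall>m. (LBINT t. cmod (char_sum m t) * cmod (symbol h t)) \<le> \<epsilon> * sqrt (real m) + C"
    unfolding I_def by blast
qed

section \<open>Mean positions and mean smoothed crossings as Fourier integrals\<close>

lemma integrable_abs_walk [simp, intro]: "integrable M (\<lambda>w. \<bar>y + T i w\<bar>)"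
  by (intro integrable_abs Bochner_Integration.integrable_add integrable_T) auto

text \<open>Subtracting the representation of |y| cancels the constant 1 and leaves the factor 1 -
  \<open>char \<mu> t ^ m\<close>, which is (1 - char \<mu> t) times
  \<open>char_sum\<close>.\<close>

lemma expectation_abs_walk:
  "has_bochner_integral lborel (\<lambda>t. Re (iexp (t * y) * (1 - char \<mu> t ^ m)) / t\<^sup>2)
     (pi * (expectation (\<lambda>w. \<bar>y + T m w\<bar>) - \<bar>y\<bar>))"
proof -
  interpret MP: pair_sigma_finite M lborel ..
  define f where "f w t = (1 - cos (t * (y + T m w))) / t\<^sup>2" for w t
  have [measurable]: "case_prod f \<in> borel_measurable (M \<Otimes>\<^sub>M lborel)" unfolding f_def by measurable
  have f1: "has_bochner_integral lborel (f w) (pi * \<bar>y + T m w\<bar>)" for w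
    unfolding f_def[abs_def] by (rule has_bochner_integral_one_minus_cos_over_square)
  have nf: "norm (f w t) = f w t" for w t by (simp add: f_def)
  have int: "integrable (M \<Otimes>\<^sub>M lborel) (case_prod f)"
  proof (rule MP.Fubini_integrable)
    show "integrable M (\<lambda>w. LBINT t. norm (case_prod f (w, t)))"
      unfolding prod.case nf has_bochner_integral_integral_eq[OF f1] by auto
    show "AE w in M. integrable lborel (\<lambda>t. case_prod f (w, t))"
      using f1 by (simp add: has_bochner_integral_iff)
  qed measurable
  have f2: "expectation (\<lambda>w. f w t) = (1 - Re (iexp (t * y) * char \<mu> t ^ m)) / t\<^sup>2" for t
  proof -
    have i: "integrable M (\<lambda>w. cos (t * (y + T m w)))" by (rule integrable_const_bound[of _ 1]) auto
    have "expectation (\<lambda>w. f w t) = expectation (\<lambda>w. 1 - cos (t * (y + T m w))) / t\<^sup>2"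
      unfolding f_def by (rule integral_divide_zero)
    also have "expectation (\<lambda>w. 1 - cos (t * (y + T m w))) = 1 - Re (iexp (t * y) * char \<mu> t ^ m)"
      unfolding expectation_cos[symmetric] using i by (subst Bochner_Integration.integral_diff) (auto simp: prob_space)
    finally show ?thesis .
  qed
  have "(LBINT t. expectation (\<lambda>w. f w t)) = expectation (\<lambda>w. LBINT t. f w t)"
    by (rule MP.Fubini_integral[OF int])
  also have "\<dots> = pi * expectation (\<lambda>w. \<bar>y + T m w\<bar>)"
    unfolding has_bochner_integral_integral_eq[OF f1] by simp
  finally have "has_bochner_integral lborel (\<lambda>t. expectation (\<lambda>w. f w t)) (pi * expectation (\<lambda>w. \<bar>y + T m w\<bar>))"
    using MP.integrable_snd[OF int] by (simp add: has_bochner_integral_iff)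
  from has_bochner_integral_diff[OF this has_bochner_integral_one_minus_cos_over_square[of y]]
  have "has_bochner_integral lborel (\<lambda>t. (1 - Re (iexp (t * y) * char \<mu> t ^ m)) / t\<^sup>2 - (1 - cos (t * y)) / t\<^sup>2)
     (pi * (expectation (\<lambda>w. \<bar>y + T m w\<bar>) - \<bar>y\<bar>))"
    unfolding f2 right_diff_distrib[symmetric] .
  moreover have "(1 - Re (iexp (t * y) * char \<mu> t ^ m)) / t\<^sup>2 - (1 - cos (t * y)) / t\<^sup>2 = Re (iexp (t * y) * (1 - char \<mu> t ^ m)) / t\<^sup>2" for t
    unfolding diff_divide_distrib[symmetric] right_diff_distrib minus_complex.sel by (simp add: Re_exp)
  ultimately show ?thesis by (simp only:)
qed

lemma smooth_crossing_measurable [measurable]: "(\<lambda>(s, r). smooth_crossing h s r) \<in> borel_measurable (borel \<Otimes>\<^sub>M borel)"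
  unfolding smooth_crossing_def by measurable

lemma walk_measurable_hist: "j \<le> k \<Longrightarrow> (\<lambda>w. y + T j w) \<in> borel_measurable (hist k)"
  using T_measurable_hist by (intro borel_measurable_add) auto

text \<open>A smoothed crossing is a mixed second difference of the absolute value, in the step and
  in the width h. Under the Fourier integral each difference becomes a factor iexp - 1, and the
  independence of step and position splits the mean into \<beta> and the transform of the
  position.\<close>

lemma expectation_smooth_crossing:
  assumes h: "h > 0"
  shows "has_bochner_integral lborel
     (\<lambda>t. Re (- (iexp (t * h) - 1) * \<beta> t / of_real (2 * h) * (iexp (t * y) * char \<mu> t ^ i)) / t\<^sup>2)
     (pi * expectation (\<lambda>w. smooth_crossing h (y + T i w) (X (Suc i) w)))"
proof -
  interpret MP: pair_sigma_finite M lborel ..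
  define g where "g u t = (1 - cos (t * u)) / t\<^sup>2" for u t :: real
  have g0: "g u t \<ge> 0" for u t by (simp add: g_def)
  have g: "has_bochner_integral lborel (g u) (pi * \<bar>u\<bar>)" for u
    unfolding g_def[abs_def] by (rule has_bochner_integral_one_minus_cos_over_square)
  have gi: "integrable lborel (g u)" for u using g by (simp add: has_bochner_integral_iff)
  define F where "F s r t = side r / (2 * h) * (g (s + r + h) t - g (s + r) t - g (s + h) t + g s t)" for s r t
  have F1: "has_bochner_integral lborel (F s r) (pi * smooth_crossing h s r)" for s r
  proof -
    have "has_bochner_integral lborel (F s r) (side r / (2 * h) * (pi * \<bar>s + r + h\<bar> - pi * \<bar>s + r\<bar> - pi * \<bar>s + h\<bar> + pi * \<bar>s\<bar>))"
      unfolding F_def[abs_def]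
      by (intro has_bochner_integral_mult_right has_bochner_integral_add has_bochner_integral_diff g)
    also have "side r / (2 * h) * (pi * \<bar>s + r + h\<bar> - pi * \<bar>s + r\<bar> - pi * \<bar>s + h\<bar> + pi * \<bar>s\<bar>) = pi * smooth_crossing h s r"
      by (simp add: smooth_crossing_def algebra_simps add_divide_distrib diff_divide_distrib)
    finally show ?thesis .
  qed
  define f where "f w = F (y + T i w) (X (Suc i) w)" for w
  have [measurable]: "case_prod f \<in> borel_measurable (M \<Otimes>\<^sub>M lborel)"
    unfolding f_def F_def g_def by measurable
  define B where "B w = pi / (2 * h) * (\<bar>y + T i w + X (Suc i) w + h\<bar> + \<bar>y + T i w + X (Suc i) w\<bar> + \<bar>y + T i w + h\<bar> + \<bar>y + T i w\<bar>)" for w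
  have X: "integrable M (\<lambda>w. X (Suc i) w)"
    by (subst integrable_mu_step[symmetric, of "\<lambda>r. r" i]) auto
  have Bi: "integrable M B"
    unfolding B_def[abs_def]
    by (intro integrable_mult_right Bochner_Integration.integrable_add integrable_abs integrable_T X) auto
  have Fn: "norm (F s r t) \<le> 1 / (2 * h) * (g (s + r + h) t + g (s + r) t + g (s + h) t + g s t)" for s r t
  proof -
    have "norm (F s r t) = 1 / (2 * h) * \<bar>g (s + r + h) t - g (s + r) t - g (s + h) t + g s t\<bar>"
      using h by (simp add: F_def abs_mult side_def)
    also have "\<dots> \<le> 1 / (2 * h) * (g (s + r + h) t + g (s + r) t + g (s + h) t + g s t)"
      using h g0[of "s + r + h" t] g0[of "s + r" t] g0[of "s + h" t] g0[of s t] by (intro mult_left_mono) auto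
    finally show ?thesis .
  qed
  have int: "integrable (M \<Otimes>\<^sub>M lborel) (case_prod f)"
  proof (rule MP.Fubini_integrable)
    show "integrable M (\<lambda>w. LBINT t. norm (case_prod f (w, t)))"
    proof (rule Bochner_Integration.integrable_bound[OF Bi])
      show "AE w in M. norm (LBINT t. norm (case_prod f (w, t))) \<le> norm (B w)"
      proof (rule AE_I2)
        fix w
        let ?s = "y + T i w" and ?r = "X (Suc i) w"
        have "(LBINT t. norm (f w t)) \<le> (LBINT t. 1 / (2 * h) * (g (?s + ?r + h) t + g (?s + ?r) t + g (?s + h) t + g ?s t))"
        proof (rule integral_mono)
          show "integrable lborel (\<lambda>t. norm (f w t))"
            unfolding f_def using F1 by (intro integrable_norm) (simp add: has_bochner_integral_iff)
          show "integrable lborel (\<lambda>t. 1 / (2 * h) * (g (?s + ?r + h) t + g (?s + ?r) t + g (?s + h) t + g ?s t))"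
            by (intro integrable_mult_right Bochner_Integration.integrable_add gi)
          show "norm (f w t) \<le> 1 / (2 * h) * (g (?s + ?r + h) t + g (?s + ?r) t + g (?s + h) t + g ?s t)" for t
            unfolding f_def by (rule Fn)
        qed
        also have "\<dots> = 1 / (2 * h) * (pi * \<bar>?s + ?r + h\<bar> + pi * \<bar>?s + ?r\<bar> + pi * \<bar>?s + h\<bar> + pi * \<bar>?s\<bar>)"
          by (rule has_bochner_integral_integral_eq, intro has_bochner_integral_mult_right has_bochner_integral_add g)
        also have "\<dots> = B w" by (simp add: B_def algebra_simps add_divide_distrib)
        finally have "(LBINT t. norm (f w t)) \<le> B w" .
        moreover have "0 \<le> (LBINT t. norm (f w t))" by (intro Bochner_Integration.integral_nonneg) auto
        ultimately show "norm (LBINT t. norm (case_prod f (w, t))) \<le> norm (B w)" by simp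
      qed
    qed measurable
    show "AE w in M. integrable lborel (\<lambda>t. case_prod f (w, t))"
      using F1 by (simp add: has_bochner_integral_iff f_def)
  qed measurable
  have f2: "expectation (\<lambda>w. f w t) = Re (- (iexp (t * h) - 1) * \<beta> t / of_real (2 * h) * (iexp (t * y) * char \<mu> t ^ i)) / t\<^sup>2" for t
  proof -
    define c where "c = - (iexp (t * h) - 1) / of_real (2 * h)"
    define \<Phi> where "\<Phi> s r = Re (c * iexp (t * s) * (of_real (side r) * (iexp (t * r) - 1)))" for s r
    have FP: "F s r t = \<Phi> s r / t\<^sup>2" for s r
    proof -
      have e: "c * iexp (t * s) * (of_real (side r) * (iexp (t * r) - 1)) =
         of_real (side r / (2 * h)) * (- iexp (t * (s + r + h)) + iexp (t * (s + r)) + iexp (t * (s + h)) - iexp (t * s))"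
        by (simp add: c_def exp_add distrib_left algebra_simps add_divide_distrib diff_divide_distrib)
      have "\<Phi> s r = side r / (2 * h) * (- cos (t * (s + r + h)) + cos (t * (s + r)) + cos (t * (s + h)) - cos (t * s))"
        unfolding \<Phi>_def e Re_complex_of_real[symmetric] by (simp add: Re_exp)
      moreover have "F s r t = side r / (2 * h) * ((1 - cos (t * (s + r + h))) - (1 - cos (t * (s + r))) - (1 - cos (t * (s + h))) + (1 - cos (t * s))) / t\<^sup>2"
        by (simp only: F_def g_def diff_divide_distrib[symmetric] add_divide_distrib[symmetric] times_divide_eq_right)
      ultimately show ?thesis by simp
    qed
    have \<Phi>b: "\<bar>\<Phi> s r\<bar> \<le> cmod c * 2" for s r
    proof -
      have "\<bar>\<Phi> s r\<bar> \<le> cmod (c * iexp (t * s) * (of_real (side r) * (iexp (t * r) - 1)))"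
        unfolding \<Phi>_def by (rule abs_Re_le_cmod)
      also have "\<dots> = cmod c * cmod (iexp (t * r) - 1)" by (simp add: norm_mult side_def)
      also have "\<dots> \<le> cmod c * 2" by (intro mult_left_mono norm_iexp_minus_one_le) auto
      finally show ?thesis .
    qed
    have \<Phi>m: "case_prod \<Phi> \<in> borel_measurable (borel \<Otimes>\<^sub>M borel)" unfolding \<Phi>_def by measurable
    have "expectation (\<lambda>w. f w t) = expectation (\<lambda>w. \<Phi> (y + T i w) (X (Suc i) w)) / t\<^sup>2"
      unfolding f_def FP by (rule integral_divide_zero)
    also have "expectation (\<lambda>w. \<Phi> (y + T i w) (X (Suc i) w)) = expectation (\<lambda>w. \<integral>r. \<Phi> (y + T i w) r \<partial>\<mu>)"
    proof (rule expectation_step(1)[OF walk_measurable_hist \<Phi>m])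
      show "integrable M (\<lambda>w. \<Phi> (y + T i w) (X (Suc i) w))"
      proof (rule integrable_const_bound[where B="cmod c * 2", OF AE_I2])
        show "(\<lambda>w. \<Phi> (y + T i w) (X (Suc i) w)) \<in> borel_measurable M"
          using measurable_compose[OF _ \<Phi>m, of "\<lambda>w. (y + T i w, X (Suc i) w)" M] by simp
      qed (simp only: real_norm_def \<Phi>b)
    qed simp
    also have "(\<lambda>s. \<integral>r. \<Phi> s r \<partial>\<mu>) = (\<lambda>s. Re (c * \<beta> t * iexp (t * s)))"
    proof
      fix s
      have "integrable \<mu> (\<lambda>r. c * iexp (t * s) * (of_real (side r) * (iexp (t * r) - 1)))"
        by (intro integrable_mult_right integrable_iexp_diff)
      from integral_Re[OF this] show "(\<integral>r. \<Phi> s r \<partial>\<mu>) = Re (c * \<beta> t * iexp (t * s))"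
        unfolding \<Phi>_def integral_mult_right_zero \<beta>_def[symmetric] by (simp only: mult_ac)
    qed
    finally show ?thesis
      unfolding expectation_Re_iexp by (simp add: c_def)
  qed
  have "(LBINT t. expectation (\<lambda>w. f w t)) = expectation (\<lambda>w. LBINT t. f w t)"
    by (rule MP.Fubini_integral[OF int])
  also have "\<dots> = pi * expectation (\<lambda>w. smooth_crossing h (y + T i w) (X (Suc i) w))"
    unfolding f_def has_bochner_integral_integral_eq[OF F1] by simp
  finally show ?thesis
    using MP.integrable_snd[OF int] unfolding f2 by (simp add: has_bochner_integral_iff)
qed

text \<open>Summation over i gives both integrands the common factor \<open>char_sum m t\<close>;
  the remaining factor is the symbol, times a phase that carries the start. The phase disappears
  with the modulus, so the bound is uniform in y.\<close>

lemma smooth_drift_le: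
  assumes h: "h > 0"
  shows "\<bar>(\<Sum>i<m. expectation (\<lambda>w. smooth_crossing h (y + T i w) (X (Suc i) w))) - \<kappa> * (expectation (\<lambda>w. \<bar>y + T m w\<bar>) - \<bar>y\<bar>)\<bar>
     \<le> (LBINT t. cmod (char_sum m t) * cmod (symbol h t))"
proof -
  let ?c = "\<lambda>t. - (iexp (t * h) - 1) * \<beta> t / of_real (2 * h)"
  let ?D = "(\<Sum>i<m. expectation (\<lambda>w. smooth_crossing h (y + T i w) (X (Suc i) w))) - \<kappa> * (expectation (\<lambda>w. \<bar>y + T m w\<bar>) - \<bar>y\<bar>)"
  have "has_bochner_integral lborel (\<lambda>t. (\<Sum>i<m. Re (?c t * (iexp (t * y) * char \<mu> t ^ i)) / t\<^sup>2)
      - \<kappa> * (Re (iexp (t * y) * (1 - char \<mu> t ^ m)) / t\<^sup>2))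
     ((\<Sum>i<m. pi * expectation (\<lambda>w. smooth_crossing h (y + T i w) (X (Suc i) w))) - \<kappa> * (pi * (expectation (\<lambda>w. \<bar>y + T m w\<bar>) - \<bar>y\<bar>)))"
    by (intro has_bochner_integral_diff has_bochner_integral_sum has_bochner_integral_mult_right
        expectation_smooth_crossing expectation_abs_walk h)
  also have "(\<Sum>i<m. pi * expectation (\<lambda>w. smooth_crossing h (y + T i w) (X (Suc i) w))) - \<kappa> * (pi * (expectation (\<lambda>w. \<bar>y + T m w\<bar>) - \<bar>y\<bar>)) = pi * ?D"
    by (simp add: sum_distrib_left[symmetric] algebra_simps)
  also have "(\<lambda>t. (\<Sum>i<m. Re (?c t * (iexp (t * y) * char \<mu> t ^ i)) / t\<^sup>2)
      - \<kappa> * (Re (iexp (t * y) * (1 - char \<mu> t ^ m)) / t\<^sup>2)) = (\<lambda>t. Re (iexp (t * y) * (char_sum m t * symbol h t)))"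
  proof
    fix t
    define c where "c = ?c t"
    have "iexp (t * y) * (char_sum m t * symbol h t) = ((\<Sum>i<m. c * (iexp (t * y) * char \<mu> t ^ i)) - of_real \<kappa> * (iexp (t * y) * (1 - char \<mu> t ^ m))) / of_real (t\<^sup>2)"
    proof -
      have alg: "e * (g * ((a - k * d) / q)) = (a * (e * g) - k * (e * (d * g))) / q" for e g a k d q :: complex
        by (simp add: algebra_simps diff_divide_distrib)
      have "(\<Sum>i<m. c * (iexp (t * y) * char \<mu> t ^ i)) = c * (iexp (t * y) * char_sum m t)"
        by (simp only: char_sum_def sum_distrib_left)
      then show ?thesis
        unfolding char_sum_mult[symmetric] symbol_def c_def by (simp only: alg)
    qed
    then have "Re (iexp (t * y) * (char_sum m t * symbol h t)) = (Re (\<Sum>i<m. c * (iexp (t * y) * char \<mu> t ^ i)) - \<kappa> * Re (iexp (t * y) * (1 - char \<mu> t ^ m))) / t\<^sup>2"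
      by (simp only: Re_divide_of_real minus_complex.sel) simp
    then show "(\<Sum>i<m. Re (?c t * (iexp (t * y) * char \<mu> t ^ i)) / t\<^sup>2) - \<kappa> * (Re (iexp (t * y) * (1 - char \<mu> t ^ m)) / t\<^sup>2) = Re (iexp (t * y) * (char_sum m t * symbol h t))"
      unfolding c_def[symmetric] by (simp only: Re_sum sum_divide_distrib diff_divide_distrib times_divide_eq_right)
  qed
  finally have D: "has_bochner_integral lborel (\<lambda>t. Re (iexp (t * y) * (char_sum m t * symbol h t))) (pi * ?D)" .
  have "pi * \<bar>?D\<bar> = \<bar>LBINT t. Re (iexp (t * y) * (char_sum m t * symbol h t))\<bar>"
    using has_bochner_integral_integral_eq[OF D] by (simp only: abs_mult) simp
  also have "\<dots> \<le> (LBINT t. cmod (char_sum m t) * cmod (symbol h t))"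
  proof (rule order_trans[OF integral_abs_bound], rule integral_mono)
    show "integrable lborel (\<lambda>t. \<bar>Re (iexp (t * y) * (char_sum m t * symbol h t))\<bar>)"
      using D by (intro integrable_abs) (simp only: has_bochner_integral_iff)
    show "\<bar>Re (iexp (t * y) * (char_sum m t * symbol h t))\<bar> \<le> cmod (char_sum m t) * cmod (symbol h t)" for t
      by (rule order_trans[OF abs_Re_le_cmod]) (simp add: norm_mult)
  qed (rule integral_norm_char_sum_symbol(1)[OF h])
  finally have "pi * \<bar>?D\<bar> \<le> (LBINT t. cmod (char_sum m t) * cmod (symbol h t))" .
  moreover have "1 * \<bar>?D\<bar> \<le> pi * \<bar>?D\<bar>" using pi_gt3 by (intro mult_right_mono) auto
  ultimately have "1 * \<bar>?D\<bar> \<le> (LBINT t. cmod (char_sum m t) * cmod (symbol h t))" by (rule order_trans[rotated])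
  then show ?thesis by (simp only: mult_1_left)
qed

text \<open>By Tanaka's formula the bracket is the mean of twice the total overshoot, so this is the
  mean of crossings minus 2 * \<kappa> times overshoots from y. The form with absolute values is the
  one accessible to the Fourier bound.\<close>

definition drift :: "nat \<Rightarrow> real \<Rightarrow> real" where
  "drift m y = (\<Sum>i<m. expectation (\<lambda>w. level_crossing (y + T i w) (y + T (Suc i) w)))
     - \<kappa> * (expectation (\<lambda>w. \<bar>y + T m w\<bar>) - \<bar>y\<bar>)"

text \<open>The regularity needed of the starting points: visits just below the level are rare. It holds for all
  points if the walk is nonlattice, and for lattice points if the walk is lattice.\<close>

definition regular_starts :: "real set \<Rightarrow> bool" where
  "regular_starts A \<longleftrightarrow> (\<forall>\<epsilon>>0. \<exists>h>0. \<exists>C. \<forall>y\<in>A. \<forall>m. (\<Sum>i<m. prob {w \<in> space M. - h < y + T i w \<and> y + T i w < 0}) \<le> \<epsilon> * sqrt (real m) + C)"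

text \<open>Exchanging the indicator for its smoothed version costs visits of either end of a step
  to (- h, 0), which \<open>regular_starts\<close> makes rare; what remains is bounded through the
  symbol.\<close>

lemma drift_le:
  assumes A: "regular_starts A" and \<epsilon>: "\<epsilon> > 0"
  shows "\<exists>C. \<forall>y\<in>A. \<forall>m. \<bar>drift m y\<bar> \<le> \<epsilon> * sqrt (real m) + C"
proof -
  \<comment> \<open>Three shares of sqrt m arise, two from the ends of the steps and one from the
    symbol; a quarter of \<epsilon> for each is enough.\<close>
  define e where "e = \<epsilon> / 4"
  have e: "e > 0" using \<epsilon> by (simp add: e_def)
  obtain h C where h: "h > 0" and C: "\<And>y m. y \<in> A \<Longrightarrow> (\<Sum>i<m. prob {w \<in> space M. - h < y + T i w \<and> y + T i w < 0}) \<le> e * sqrt (real m) + C"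
    using A e unfolding regular_starts_def by meson
  obtain C' where C': "\<And>m. (LBINT t. cmod (char_sum m t) * cmod (symbol h t)) \<le> e * sqrt (real m) + C'"
    using integral_norm_char_sum_symbol(2)[OF h e] by blast
  have "\<bar>drift m y\<bar> \<le> \<epsilon> * sqrt (real m) + (2 * e + 2 * C + C')" if y: "y \<in> A" for y m
  proof -
    let ?p = "\<lambda>i. prob {w \<in> space M. - h < y + T i w \<and> y + T i w < 0}"
    let ?l = "\<lambda>i w. level_crossing (y + T i w) (y + T (Suc i) w)" and ?s = "\<lambda>i w. smooth_crossing h (y + T i w) (X (Suc i) w)"
    have near: "\<bar>?l i w - ?s i w\<bar> \<le> of_bool (- h < y + T i w \<and> y + T i w < 0) + of_bool (- h < y + T (Suc i) w \<and> y + T (Suc i) w < 0)" for i w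
      using smooth_crossing_approx[OF h, of "y + T i w" "X (Suc i) w"] by (simp add: T_Suc add.assoc)
    have li: "integrable M (?l i)" for i
      by (rule integrable_const_bound[of _ 1]) (auto simp: level_crossing_def)
    have ob: "integrable M (\<lambda>w. of_bool (- h < y + T i w \<and> y + T i w < 0) :: real)" for i
      by (rule integrable_const_bound[of _ 1]) auto
    have si: "integrable M (?s i)" for i
    proof (rule Bochner_Integration.integrable_bound)
      show "integrable M (\<lambda>w. (?l i w) + (of_bool (- h < y + T i w \<and> y + T i w < 0) + of_bool (- h < y + T (Suc i) w \<and> y + T (Suc i) w < 0)) :: real)"
        by (intro Bochner_Integration.integrable_add li ob)
      show "AE w in M. norm (?s i w) \<le> norm (?l i w + (of_bool (- h < y + T i w \<and> y + T i w < 0) + of_bool (- h < y + T (Suc i) w \<and> y + T (Suc i) w < 0)))"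
      proof (rule AE_I2)
        fix w show "norm (?s i w) \<le> norm (?l i w + (of_bool (- h < y + T i w \<and> y + T i w < 0) + of_bool (- h < y + T (Suc i) w \<and> y + T (Suc i) w < 0)))"
          using near[of i w] level_crossing_bounds[of "y + T i w" "y + T (Suc i) w"] unfolding real_norm_def by linarith
      qed
    qed measurable
    have "\<bar>expectation (?l i) - expectation (?s i)\<bar> \<le> ?p i + ?p (Suc i)" for i
    proof -
      have "\<bar>expectation (?l i) - expectation (?s i)\<bar> = \<bar>expectation (\<lambda>w. ?l i w - ?s i w)\<bar>"
        by (subst Bochner_Integration.integral_diff[OF li si]) simp
      also have "\<dots> \<le> expectation (\<lambda>w. of_bool (- h < y + T i w \<and> y + T i w < 0) + of_bool (- h < y + T (Suc i) w \<and> y + T (Suc i) w < 0))"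
        by (rule order_trans[OF integral_abs_bound], rule integral_mono)
          (use li si ob near in \<open>auto intro!: integrable_abs Bochner_Integration.integrable_diff Bochner_Integration.integrable_add simp del: T_Suc\<close>)
      also have "\<dots> = ?p i + ?p (Suc i)"
        unfolding prob_eq_expectation_of_bool by (rule Bochner_Integration.integral_add[OF ob ob])
      finally show ?thesis .
    qed
    then have "\<bar>(\<Sum>i<m. expectation (?l i)) - (\<Sum>i<m. expectation (?s i))\<bar> \<le> (\<Sum>i<m. ?p i + ?p (Suc i))"
      unfolding sum_subtractf[symmetric] by (intro order_trans[OF sum_abs] sum_mono)
    also have "\<dots> = (\<Sum>i<m. ?p i) + (\<Sum>i<m. ?p (Suc i))" by (rule sum.distrib)
    \<comment> \<open>The right ends are positions at times 1, ..., m, so both sums are extended to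
      \<open>Suc m\<close> terms.\<close>
    also have "\<dots> \<le> (\<Sum>i<Suc m. ?p i) + (\<Sum>i<Suc m. ?p i)"
    proof (rule add_mono)
      show "(\<Sum>i<m. ?p i) \<le> (\<Sum>i<Suc m. ?p i)" by simp
      show "(\<Sum>i<m. ?p (Suc i)) \<le> (\<Sum>i<Suc m. ?p i)"
        unfolding sum.lessThan_Suc_shift[of ?p] by simp
    qed
    also have "\<dots> \<le> 2 * (e * sqrt (real (Suc m)) + C)" using C[OF y, of "Suc m"] by simp
    also have "\<dots> \<le> 2 * (e * (sqrt (real m) + 1) + C)"
      using e sqrt_add_le_add_sqrt[of "real m" 1] by (auto simp: add.commute)
    finally have 1: "\<bar>(\<Sum>i<m. expectation (?l i)) - (\<Sum>i<m. expectation (?s i))\<bar> \<le> 2 * (e * (sqrt (real m) + 1) + C)" .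
    have 2: "\<bar>(\<Sum>i<m. expectation (?s i)) - \<kappa> * (expectation (\<lambda>w. \<bar>y + T m w\<bar>) - \<bar>y\<bar>)\<bar> \<le> e * sqrt (real m) + C'"
      by (rule order_trans[OF smooth_drift_le[OF h] C'])
    have "\<bar>drift m y\<bar> \<le> 2 * (e * (sqrt (real m) + 1) + C) + (e * sqrt (real m) + C')"
      using 1 2 unfolding drift_def by linarith
    also have "\<dots> = 3 * (e * sqrt (real m)) + 2 * e + 2 * C + C'" by (simp add: algebra_simps)
    also have "\<dots> \<le> \<epsilon> * sqrt (real m) + (2 * e + 2 * C + C')"
      using e by (simp add: e_def)
    finally show ?thesis .
  qed
  then show ?thesis by blast
qed

end

section \<open>Crossings and overshoots are asymptotically proportional\<close>

text \<open>Cross terms are grouped by the earlier index, and the later one is counted from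
  \<open>Suc j\<close>: the inner sum is then a functional of the walk restarted at time
  \<open>Suc j\<close>.\<close>

lemma power2_sum_lessThan:
  fixes a :: "nat \<Rightarrow> real"
  shows "(\<Sum>k<n. a k)\<^sup>2 = (\<Sum>k<n. (a k)\<^sup>2) + 2 * (\<Sum>j<n. a j * (\<Sum>i<n - Suc j. a (Suc j + i)))"
proof (induction n)
  case (Suc n)
  have "(\<Sum>j<Suc n. a j * (\<Sum>i<Suc n - Suc j. a (Suc j + i))) = (\<Sum>j<n. a j * (\<Sum>i<Suc n - Suc j. a (Suc j + i)))"
    by simp
  also have "\<dots> = (\<Sum>j<n. a j * (\<Sum>i<n - Suc j. a (Suc j + i)) + a j * a n)"
  proof (rule sum.cong[OF refl])
    fix j assume "j \<in> {..<n}"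
    then have "Suc n - Suc j = Suc (n - Suc j)" "Suc j + (n - Suc j) = n" by auto
    then show "a j * (\<Sum>i<Suc n - Suc j. a (Suc j + i)) = a j * (\<Sum>i<n - Suc j. a (Suc j + i)) + a j * a n"
      by (simp only: sum.lessThan_Suc distrib_left)
  qed
  also have "\<dots> = (\<Sum>j<n. a j * (\<Sum>i<n - Suc j. a (Suc j + i))) + (\<Sum>j<n. a j) * a n"
    by (simp only: sum.distrib sum_distrib_right)
  finally have *: "(\<Sum>j<Suc n. a j * (\<Sum>i<Suc n - Suc j. a (Suc j + i))) = (\<Sum>j<n. a j * (\<Sum>i<n - Suc j. a (Suc j + i))) + (\<Sum>j<n. a j) * a n" .
  have "(\<Sum>k<Suc n. a k)\<^sup>2 = (\<Sum>k<n. a k)\<^sup>2 + (a n)\<^sup>2 + 2 * ((\<Sum>k<n. a k) * a n)"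
    by (simp add: power2_sum)
  then show ?case unfolding * Suc.IH by simp
qed simp

context centered_walk
begin

section \<open>Steps long enough to reach the origin\<close>

lemma integrable_step_k: "integrable M (X (Suc k))" "integrable M (\<lambda>w. \<bar>X (Suc k) w\<bar>)" "integrable M (\<lambda>w. (X (Suc k) w)\<^sup>2)"
proof -
  show "integrable M (X (Suc k))"
    by (subst integrable_mu_step[symmetric, of "\<lambda>r. r" k]) auto
  then show "integrable M (\<lambda>w. \<bar>X (Suc k) w\<bar>)" by (rule integrable_abs)
  show "integrable M (\<lambda>w. (X (Suc k) w)\<^sup>2)"
    by (subst integrable_mu_step[symmetric, of "\<lambda>r. r\<^sup>2" k]) auto
qed

text \<open>A step can cross zero only if it is at least as long as the distance to zero. The weight
  1 + r^2 serves both the second moment of a crossing step and the Taylor error of a reflected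
  one.\<close>

definition long_steps :: "real \<Rightarrow> nat \<Rightarrow> real" where
  "long_steps x k = expectation (\<lambda>w. (1 + (X (Suc k) w)\<^sup>2) * of_bool (\<bar>x + T k w\<bar> \<le> \<bar>X (Suc k) w\<bar>))"

lemma integrable_long_steps: "integrable M (\<lambda>w. (1 + (X (Suc k) w)\<^sup>2) * of_bool (\<bar>x + T k w\<bar> \<le> \<bar>X (Suc k) w\<bar>))"
proof (rule Bochner_Integration.integrable_bound)
  show "integrable M (\<lambda>w. 1 + (X (Suc k) w)\<^sup>2)" using integrable_step_k by auto
qed (auto simp: abs_mult)

lemma long_steps_eq: "long_steps x k = (\<integral>r. (1 + r\<^sup>2) * prob {w \<in> space M. \<bar>x + T k w\<bar> \<le> \<bar>r\<bar>} \<partial>\<mu>)"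
proof -
  interpret MP: pair_sigma_finite M \<mu> ..
  define f where "f w r = (1 + r\<^sup>2) * of_bool (\<bar>x + T k w\<bar> \<le> \<bar>r\<bar>)" for w r
  have [measurable]: "case_prod f \<in> borel_measurable (M \<Otimes>\<^sub>M \<mu>)" unfolding f_def by measurable
  have r2: "integrable \<mu> (\<lambda>r. 1 + r\<^sup>2)" by auto
  have fb: "norm (f w r) \<le> 1 + r\<^sup>2" for w r by (simp add: f_def)
  have fi: "integrable \<mu> (f w)" for w
  proof (rule Bochner_Integration.integrable_bound[OF r2])
    show "AE r in \<mu>. norm (f w r) \<le> norm (1 + r\<^sup>2)" using fb by auto
  qed (unfold f_def, measurable)
  have int: "integrable (M \<Otimes>\<^sub>M \<mu>) (case_prod f)"
  proof (rule MP.Fubini_integrable)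
    show "integrable M (\<lambda>w. \<integral>r. norm (case_prod f (w, r)) \<partial>\<mu>)"
    proof (rule integrable_const_bound[where B="\<integral>r. 1 + r\<^sup>2 \<partial>\<mu>", OF AE_I2])
      fix w
      have "(\<integral>r. norm (f w r) \<partial>\<mu>) \<le> (\<integral>r. 1 + r\<^sup>2 \<partial>\<mu>)"
        by (rule integral_mono[OF integrable_norm[OF fi] r2 fb])
      then show "norm (\<integral>r. norm (case_prod f (w, r)) \<partial>\<mu>) \<le> (\<integral>r. 1 + r\<^sup>2 \<partial>\<mu>)" by simp
    qed measurable
    show "AE w in M. integrable \<mu> (\<lambda>r. case_prod f (w, r))" using fi by simp
  qed measurable
  have "long_steps x k = expectation (\<lambda>w. (\<lambda>s r. (1 + r\<^sup>2) * of_bool (\<bar>s\<bar> \<le> \<bar>r\<bar>)) (x + T k w) (X (Suc k) w))"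
    by (simp add: long_steps_def)
  also have "\<dots> = expectation (\<lambda>w. \<integral>r. f w r \<partial>\<mu>)"
    unfolding f_def using integrable_long_steps by (intro expectation_step(1)[OF walk_measurable_hist]) auto
  also have "\<dots> = (\<integral>r. expectation (\<lambda>w. f w r) \<partial>\<mu>)"
    by (rule MP.Fubini_integral[OF int, symmetric])
  also have "\<dots> = (\<integral>r. (1 + r\<^sup>2) * prob {w \<in> space M. \<bar>x + T k w\<bar> \<le> \<bar>r\<bar>} \<partial>\<mu>)"
    unfolding f_def integral_mult_right_zero prob_eq_expectation_of_bool ..
  finally show ?thesis .
qed

text \<open>For a fixed step r the average probability of being within |r| of zero is of order 1 /
  sqrt n; the second moment makes 1 + r^2 an integrable majorant.\<close>

lemma long_steps_average_tendsto_zero: "(\<lambda>n. (\<Sum>k<n. long_steps x k) / real n) \<longlonglongrightarrow> 0"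
proof -
  define p where "p n r = (\<Sum>k<n. prob {\<omega> \<in> space M. \<bar>x + T k \<omega>\<bar> \<le> \<bar>r\<bar>}) / real n" for n and r :: real
  have p01: "0 \<le> p n r" "p n r \<le> 1" for n r
  proof -
    show "0 \<le> p n r" unfolding p_def by (intro divide_nonneg_nonneg sum_nonneg) auto
    have "(\<Sum>k<n. prob {\<omega> \<in> space M. \<bar>x + T k \<omega>\<bar> \<le> \<bar>r\<bar>}) \<le> (\<Sum>k<n. 1)" by (intro sum_mono) auto
    then show "p n r \<le> 1" unfolding p_def by (cases "n = 0") (auto simp: divide_le_eq)
  qed
  have pm: "(\<lambda>r. prob {\<omega> \<in> space M. \<bar>x + T k \<omega>\<bar> \<le> \<bar>r\<bar>}) \<in> borel_measurable borel" for k
    unfolding prob_eq_expectation_of_bool by measurable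
  have [measurable]: "p n \<in> borel_measurable borel" for n
    unfolding p_def[abs_def] using pm by measurable
  have r2: "integrable \<mu> (\<lambda>r. 1 + r\<^sup>2)" by auto
  have "(\<Sum>k<n. long_steps x k) / real n = (\<integral>r. (1 + r\<^sup>2) * p n r \<partial>\<mu>)" for n
  proof -
    have "integrable \<mu> (\<lambda>r. (1 + r\<^sup>2) * prob {\<omega> \<in> space M. \<bar>x + T k \<omega>\<bar> \<le> \<bar>r\<bar>})" for k
    proof (rule Bochner_Integration.integrable_bound[OF r2])
      show "AE r in \<mu>. norm ((1 + r\<^sup>2) * prob {\<omega> \<in> space M. \<bar>x + T k \<omega>\<bar> \<le> \<bar>r\<bar>}) \<le> norm (1 + r\<^sup>2)"
        by (auto simp: abs_mult mult_left_le)
    qed (use pm in measurable)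
    then have "(\<Sum>k<n. long_steps x k) = (\<integral>r. (\<Sum>k<n. (1 + r\<^sup>2) * prob {\<omega> \<in> space M. \<bar>x + T k \<omega>\<bar> \<le> \<bar>r\<bar>}) \<partial>\<mu>)"
      unfolding long_steps_eq by (subst Bochner_Integration.integral_sum) simp_all
    then show ?thesis
      unfolding p_def times_divide_eq_right integral_divide_zero sum_distrib_left by simp
  qed
  moreover have "(\<lambda>n. \<integral>r. (1 + r\<^sup>2) * p n r \<partial>\<mu>) \<longlonglongrightarrow> integral\<^sup>L \<mu> (\<lambda>r. 0)"
  proof (rule integral_dominated_convergence[where w="\<lambda>r. 1 + r\<^sup>2"])
    show "AE r in \<mu>. norm ((1 + r\<^sup>2) * p n r) \<le> 1 + r\<^sup>2" for n
      using p01 by (auto simp: abs_mult mult_left_le)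
    show "AE r in \<mu>. (\<lambda>n. (1 + r\<^sup>2) * p n r) \<longlonglongrightarrow> 0"
    proof (rule AE_I2)
      fix r
      obtain C where C: "C > 0" "\<And>m. (\<Sum>i<m. prob {\<omega> \<in> space M. \<bar>x + T i \<omega>\<bar> \<le> \<bar>r\<bar>}) \<le> C * sqrt (real m)"
        using sum_prob_ball_le_sqrt by blast
      have "(\<lambda>n. p n r) \<longlonglongrightarrow> 0"
      proof (rule Lim_null_comparison)
        show "\<forall>\<^sub>F n in sequentially. norm (p n r) \<le> C * sqrt (real n) / real n"
        proof (intro always_eventually allI)
          fix n
          have "p n r \<le> C * sqrt (real n) / real n" unfolding p_def by (intro divide_right_mono C(2)) simp
          then show "norm (p n r) \<le> C * sqrt (real n) / real n" using p01(1)[of n r] by simp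
        qed
        show "(\<lambda>n. C * sqrt (real n) / real n) \<longlonglongrightarrow> 0" using C(1) by real_asymp
      qed
      from tendsto_mult_right_zero[OF this, of "1 + r\<^sup>2"] show "(\<lambda>n. (1 + r\<^sup>2) * p n r) \<longlonglongrightarrow> 0" .
    qed
  qed (use r2 in measurable)
  ultimately show ?thesis by simp
qed

section \<open>Second moment of the imbalance between crossings and overshoots\<close>

definition imbalance_step :: "real \<Rightarrow> real \<Rightarrow> real" where
  "imbalance_step s t = level_crossing s t - 2 * \<kappa> * overshoot s t"

lemma imbalance_step_measurable [measurable]: "case_prod imbalance_step \<in> borel_measurable (borel \<Otimes>\<^sub>M borel)"
  unfolding imbalance_step_def by measurable

lemma abs_imbalance_step_le: "\<bar>imbalance_step s (s + r)\<bar> \<le> 1 + 2 * \<kappa> * \<bar>r\<bar>"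
proof -
  have "overshoot s (s + r) \<le> \<bar>r\<bar>" by (auto simp: overshoot_def level_crossing_def)
  then have "2 * \<kappa> * overshoot s (s + r) \<le> 2 * \<kappa> * \<bar>r\<bar>" using \<kappa>_nonneg by (intro mult_left_mono) auto
  moreover have "0 \<le> 2 * \<kappa> * overshoot s (s + r)" using \<kappa>_nonneg overshoot_nonneg by simp
  ultimately show ?thesis using level_crossing_bounds[of s "s + r"] unfolding imbalance_step_def by linarith
qed

text \<open>A crossing forces |s| <= |r|, and (a + b)^2 <= 2 a^2 + 2 b^2 applied to 1 + 2 \<kappa>
  |r| gives the constant; the bound is the integrand of \<open>long_steps\<close>.\<close>

lemma imbalance_step_square_le: "(imbalance_step s (s + r))\<^sup>2 \<le> (2 + 8 * \<kappa>\<^sup>2) * ((1 + r\<^sup>2) * of_bool (\<bar>s\<bar> \<le> \<bar>r\<bar>))"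
proof (cases "\<bar>s\<bar> \<le> \<bar>r\<bar>")
  case False
  then have "imbalance_step s (s + r) = 0" by (auto simp: imbalance_step_def overshoot_def level_crossing_def)
  then show ?thesis by simp
next
  case True
  have "\<bar>imbalance_step s (s + r)\<bar>\<^sup>2 \<le> (1 + 2 * \<kappa> * \<bar>r\<bar>)\<^sup>2"
    by (rule power_mono[OF abs_imbalance_step_le]) simp
  also have "\<dots> \<le> 2 + 8 * \<kappa>\<^sup>2 * r\<^sup>2"
    using sum_squares_bound[of 1 "2 * \<kappa> * \<bar>r\<bar>"] by (simp add: power2_sum power_mult_distrib mult_ac)
  also have "\<dots> \<le> (2 + 8 * \<kappa>\<^sup>2) * (1 + r\<^sup>2)" by (simp add: algebra_simps)
  finally show ?thesis using True by simp
qed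

definition imbalance_at :: "real \<Rightarrow> nat \<Rightarrow> 'a \<Rightarrow> real" where
  "imbalance_at x k w = imbalance_step (x + T k w) (x + T (Suc k) w)"

lemma imbalance_at_eq: "imbalance_at x k w = imbalance_step (x + T k w) (x + T k w + X (Suc k) w)"
  by (simp add: imbalance_at_def T_Suc add.assoc)

lemma imbalance_at_measurable_hist: "Suc k \<le> n \<Longrightarrow> imbalance_at x k \<in> borel_measurable (hist n)"
  using measurable_compose[OF measurable_Pair[OF walk_measurable_hist[of k n x] walk_measurable_hist[of "Suc k" n x]] imbalance_step_measurable]
  by (simp add: imbalance_at_def[abs_def])

lemma imbalance_at_measurable [measurable]: "imbalance_at x k \<in> borel_measurable M"
  by (rule hist_measurable_imp[OF imbalance_at_measurable_hist[of k "Suc k"]]) simp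

lemma integrable_imbalance_at:
  "integrable M (imbalance_at x k)" "integrable M (\<lambda>w. (imbalance_at x k w)\<^sup>2)"
  "expectation (\<lambda>w. (imbalance_at x k w)\<^sup>2) \<le> (2 + 8 * \<kappa>\<^sup>2) * long_steps x k"
proof -
  have b: "integrable M (\<lambda>w. (2 + 8 * \<kappa>\<^sup>2) * ((1 + (X (Suc k) w)\<^sup>2) * of_bool (\<bar>x + T k w\<bar> \<le> \<bar>X (Suc k) w\<bar>)))"
    by (intro integrable_mult_right integrable_long_steps)
  have le: "(imbalance_at x k w)\<^sup>2 \<le> (2 + 8 * \<kappa>\<^sup>2) * ((1 + (X (Suc k) w)\<^sup>2) * of_bool (\<bar>x + T k w\<bar> \<le> \<bar>X (Suc k) w\<bar>))" for w
    unfolding imbalance_at_eq by (rule imbalance_step_square_le)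
  show i2: "integrable M (\<lambda>w. (imbalance_at x k w)\<^sup>2)"
    by (rule Bochner_Integration.integrable_bound[OF b]) (use le in \<open>auto intro!: AE_I2 order_trans[OF le] simp del: of_bool_eq_0_iff\<close>)
  then show "integrable M (imbalance_at x k)" by (rule square_integrable_imp_integrable[rotated]) simp
  show "expectation (\<lambda>w. (imbalance_at x k w)\<^sup>2) \<le> (2 + 8 * \<kappa>\<^sup>2) * long_steps x k"
    unfolding long_steps_def by (subst integral_mult_right_zero[symmetric]) (rule integral_mono[OF i2 b le])
qed

definition imbalance_mean :: "real \<Rightarrow> real" where "imbalance_mean s = (\<integral>r. imbalance_step s (s + r) \<partial>\<mu>)"

lemma imbalance_mean_measurable [measurable]: "imbalance_mean \<in> borel_measurable borel"
  unfolding imbalance_mean_def[abs_def] by measurable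

lemma abs_imbalance_mean_le: "\<bar>imbalance_mean s\<bar> \<le> 1 + 2 * \<kappa> * (\<integral>r. \<bar>r\<bar> \<partial>\<mu>)"
proof -
  have b: "integrable \<mu> (\<lambda>r. 1 + 2 * \<kappa> * \<bar>r\<bar>)" by auto
  have "integrable \<mu> (\<lambda>r. imbalance_step s (s + r))"
    by (rule Bochner_Integration.integrable_bound[OF b]) (use abs_imbalance_step_le in \<open>auto intro!: AE_I2 order_trans[OF abs_imbalance_step_le]\<close>)
  then have "\<bar>imbalance_mean s\<bar> \<le> (\<integral>r. 1 + 2 * \<kappa> * \<bar>r\<bar> \<partial>\<mu>)"
    unfolding imbalance_mean_def by (intro order_trans[OF integral_abs_bound] integral_mono b integrable_abs abs_imbalance_step_le)
  also have "\<dots> = 1 + 2 * \<kappa> * (\<integral>r. \<bar>r\<bar> \<partial>\<mu>)" using mu.prob_space by simp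
  finally show ?thesis .
qed

text \<open>In the one-step Tanaka formula the term \<open>side\<close> times step has mean zero,
  since the side is known before the centered step is drawn.\<close>

lemma expectation_overshoot:
  "integrable M (\<lambda>w. overshoot (x + T k w) (x + T (Suc k) w))"
  "2 * expectation (\<lambda>w. overshoot (x + T k w) (x + T (Suc k) w)) = expectation (\<lambda>w. \<bar>x + T (Suc k) w\<bar>) - expectation (\<lambda>w. \<bar>x + T k w\<bar>)"
proof -
  have sX: "integrable M (\<lambda>w. side (x + T k w) * X (Suc k) w)"
    by (rule Bochner_Integration.integrable_bound[OF integrable_step_k(2)[of k]]) (auto simp: side_def)
  have eq: "overshoot (x + T k w) (x + T (Suc k) w) = (\<bar>x + T (Suc k) w\<bar> - \<bar>x + T k w\<bar> - side (x + T k w) * X (Suc k) w) / 2" for w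
    using abs_eq_side_plus_overshoot[of "x + T (Suc k) w" "x + T k w"] by (simp add: T_Suc)
  show i: "integrable M (\<lambda>w. overshoot (x + T k w) (x + T (Suc k) w))"
    unfolding eq by (intro integrable_divide Bochner_Integration.integrable_diff integrable_abs_walk sX)
  have "expectation (\<lambda>w. (\<lambda>s r. side s * r) (x + T k w) (X (Suc k) w)) = expectation (\<lambda>w. \<integral>r. side (x + T k w) * r \<partial>\<mu>)"
    using sX by (intro expectation_step(1)[OF walk_measurable_hist]) auto
  then have "expectation (\<lambda>w. side (x + T k w) * X (Suc k) w) = 0" by simp
  then show "2 * expectation (\<lambda>w. overshoot (x + T k w) (x + T (Suc k) w)) = expectation (\<lambda>w. \<bar>x + T (Suc k) w\<bar>) - expectation (\<lambda>w. \<bar>x + T k w\<bar>)"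
    unfolding eq integral_divide_zero
    by (simp add: Bochner_Integration.integral_diff[OF Bochner_Integration.integrable_diff[OF integrable_abs_walk integrable_abs_walk] sX]
       Bochner_Integration.integral_diff[OF integrable_abs_walk integrable_abs_walk])
qed

lemma sum_expectation_overshoot:
  "(\<Sum>k<n. 2 * expectation (\<lambda>w. overshoot (x + T k w) (x + T (Suc k) w))) = expectation (\<lambda>w. \<bar>x + T n w\<bar>) - \<bar>x\<bar>"
  unfolding expectation_overshoot(2)
  using sum_lessThan_telescope[of "\<lambda>k. expectation (\<lambda>w. \<bar>x + T k w\<bar>)" n] by (simp add: prob_space)

lemma integrable_level_crossing: "integrable M (\<lambda>w. level_crossing (x + T k w) (x + T (Suc k) w))"
  by (rule integrable_const_bound[of _ 1]) (auto simp: level_crossing_def)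

lemma drift_eq: "drift m y = (\<Sum>i<m. expectation (\<lambda>w. imbalance_mean (y + T i w)))"
proof -
  have "expectation (\<lambda>w. imbalance_mean (y + T i w)) = expectation (\<lambda>w. level_crossing (y + T i w) (y + T (Suc i) w))
     - \<kappa> * (2 * expectation (\<lambda>w. overshoot (y + T i w) (y + T (Suc i) w)))" for i
  proof -
    have "expectation (\<lambda>w. imbalance_mean (y + T i w)) = expectation (\<lambda>w. (\<lambda>s r. imbalance_step s (s + r)) (y + T i w) (X (Suc i) w))"
      unfolding imbalance_mean_def using integrable_imbalance_at(1)[of y i]
      by (intro expectation_step(1)[OF walk_measurable_hist, symmetric]) (auto simp: imbalance_at_eq[abs_def])
    also have "\<dots> = expectation (imbalance_at y i)" by (simp add: imbalance_at_eq[abs_def])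
    also have "\<dots> = expectation (\<lambda>w. level_crossing (y + T i w) (y + T (Suc i) w)) - expectation (\<lambda>w. 2 * \<kappa> * overshoot (y + T i w) (y + T (Suc i) w))"
      unfolding imbalance_at_def[abs_def] imbalance_step_def
      by (rule Bochner_Integration.integral_diff[OF integrable_level_crossing integrable_mult_right[OF expectation_overshoot(1)]])
    finally show ?thesis by simp
  qed
  then show ?thesis
    unfolding drift_def sum_expectation_overshoot[symmetric] by (simp add: sum_subtractf sum_distrib_left)
qed

lemma integrable_imbalance_at_mult: "integrable M (\<lambda>w. imbalance_at x j w * imbalance_at x k w)"
proof (rule Bochner_Integration.integrable_bound)
  show "integrable M (\<lambda>w. (imbalance_at x j w)\<^sup>2 + (imbalance_at x k w)\<^sup>2)"
    by (intro Bochner_Integration.integrable_add integrable_imbalance_at)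
  have "\<bar>a * b\<bar> \<le> \<bar>a\<^sup>2 + b\<^sup>2\<bar>" for a b :: real
  proof -
    have "2 * (\<bar>a\<bar> * \<bar>b\<bar>) \<le> a\<^sup>2 + b\<^sup>2" using sum_squares_bound[of "\<bar>a\<bar>" "\<bar>b\<bar>"] by (simp add: mult.assoc)
    moreover have "0 \<le> \<bar>a\<bar> * \<bar>b\<bar>" by simp
    ultimately show ?thesis unfolding abs_mult by linarith
  qed
  then show "AE w in M. norm (imbalance_at x j w * imbalance_at x k w) \<le> norm ((imbalance_at x j w)\<^sup>2 + (imbalance_at x k w)\<^sup>2)" by simp
qed measurable

text \<open>Two conditionings: integrating out the last step turns the later term into a bounded
  function of the position, and only then does the Markov property at \<open>Suc j\<close>, stated
  for bounded functions, apply.\<close>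

lemma expectation_imbalance_at_mult:
  "expectation (\<lambda>w. imbalance_at x j w * imbalance_at x (Suc j + i) w)
   = expectation (\<lambda>w. imbalance_at x j w * expectation (\<lambda>w'. imbalance_mean (x + T (Suc j) w + T i w')))"
proof -
  let ?k = "Suc j + i"
  have pr: "(\<lambda>w. (imbalance_at x j w, x + T ?k w)) \<in> measurable (hist ?k) (borel \<Otimes>\<^sub>M borel)"
    by (intro measurable_Pair imbalance_at_measurable_hist walk_measurable_hist) auto
  have m: "(\<lambda>(p, r). fst p * imbalance_step (snd p) (snd p + r)) \<in> borel_measurable ((borel \<Otimes>\<^sub>M borel) \<Otimes>\<^sub>M borel)"
    by measurable
  have "expectation (\<lambda>w. imbalance_at x j w * imbalance_at x ?k w) = expectation (\<lambda>w. \<integral>r. imbalance_at x j w * imbalance_step (x + T ?k w) (x + T ?k w + r) \<partial>\<mu>)"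
    using expectation_step(1)[OF pr, of "\<lambda>p r. fst p * imbalance_step (snd p) (snd p + r)", OF m] integrable_imbalance_at_mult[of x j ?k]
    unfolding imbalance_at_eq[of x ?k] by simp
  also have "\<dots> = expectation (\<lambda>w. imbalance_at x j w * imbalance_mean (x + T ?k w))"
    by (simp add: imbalance_mean_def)
  also have "\<dots> = expectation (\<lambda>w. imbalance_at x j w * expectation (\<lambda>w'. imbalance_mean (x + T (Suc j) w + T i w')))"
    by (rule expectation_transition[OF imbalance_mean_measurable abs_imbalance_mean_le imbalance_at_measurable_hist integrable_imbalance_at(1)]) simp
  finally show ?thesis .
qed

definition imbalance :: "real \<Rightarrow> nat \<Rightarrow> 'a \<Rightarrow> real" where "imbalance x n w = (\<Sum>k<n. imbalance_at x k w)"

lemma expectation_imbalance_square: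
  \<comment> \<open>Summing the Markov identity over the later index collects the one-step means
    into the drift of the restarted walk over the remaining steps.\<close>
  "integrable M (\<lambda>w. (imbalance x n w)\<^sup>2)"
  "expectation (\<lambda>w. (imbalance x n w)\<^sup>2) = (\<Sum>k<n. expectation (\<lambda>w. (imbalance_at x k w)\<^sup>2))
     + 2 * (\<Sum>j<n. expectation (\<lambda>w. imbalance_at x j w * drift (n - Suc j) (x + T (Suc j) w)))"
proof -
  have e: "(imbalance x n w)\<^sup>2 = (\<Sum>k<n. (imbalance_at x k w)\<^sup>2) + 2 * (\<Sum>j<n. \<Sum>i<n - Suc j. imbalance_at x j w * imbalance_at x (Suc j + i) w)" for w
    unfolding imbalance_def power2_sum_lessThan by (simp only: sum_distrib_left)
  show "integrable M (\<lambda>w. (imbalance x n w)\<^sup>2)"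
    unfolding e by (intro Bochner_Integration.integrable_add Bochner_Integration.integrable_sum integrable_mult_right integrable_imbalance_at integrable_imbalance_at_mult)
  have inner: "(\<Sum>i<m. expectation (\<lambda>w. imbalance_at x j w * imbalance_at x (Suc j + i) w)) = expectation (\<lambda>w. imbalance_at x j w * drift m (x + T (Suc j) w))" for m j
  proof -
    have "integrable M (\<lambda>w. imbalance_at x j w * expectation (\<lambda>w'. imbalance_mean (x + T (Suc j) w + T i w')))" for i
    proof (rule Bochner_Integration.integrable_bound)
      let ?B = "1 + 2 * \<kappa> * (\<integral>r. \<bar>r\<bar> \<partial>\<mu>)"
      show "integrable M (\<lambda>w. imbalance_at x j w * ?B)" by (intro integrable_mult_left integrable_imbalance_at)
      have "\<bar>expectation (\<lambda>w'. imbalance_mean (s + T i w'))\<bar> \<le> \<bar>?B\<bar>" for s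
      proof -
        have zi: "integrable M (\<lambda>w'. imbalance_mean (s + T i w'))"
          by (rule integrable_const_bound[where B="?B", OF AE_I2]) (simp only: real_norm_def abs_imbalance_mean_le, measurable)
        have "\<bar>expectation (\<lambda>w'. imbalance_mean (s + T i w'))\<bar> \<le> expectation (\<lambda>w'. ?B)"
          by (rule order_trans[OF integral_abs_bound], rule integral_mono[OF integrable_abs[OF zi]]) (use abs_imbalance_mean_le in auto)
        then show ?thesis by (simp add: prob_space)
      qed
      then show "AE w in M. norm (imbalance_at x j w * expectation (\<lambda>w'. imbalance_mean (x + T (Suc j) w + T i w'))) \<le> norm (imbalance_at x j w * ?B)"
        unfolding real_norm_def abs_mult by (intro AE_I2 mult_left_mono) auto
    qed measurable
    then show ?thesis
      unfolding expectation_imbalance_at_mult drift_eq sum_distrib_left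
      by (subst Bochner_Integration.integral_sum) auto
  qed
  show "expectation (\<lambda>w. (imbalance x n w)\<^sup>2) = (\<Sum>k<n. expectation (\<lambda>w. (imbalance_at x k w)\<^sup>2))
     + 2 * (\<Sum>j<n. expectation (\<lambda>w. imbalance_at x j w * drift (n - Suc j) (x + T (Suc j) w)))"
    unfolding e inner[symmetric]
    by (subst Bochner_Integration.integral_add;
        (intro Bochner_Integration.integrable_sum integrable_mult_right integrable_imbalance_at integrable_imbalance_at_mult)?)
      (simp add: Bochner_Integration.integral_sum integrable_imbalance_at integrable_imbalance_at_mult Bochner_Integration.integrable_sum)
qed

text \<open>By the triangle inequality crossings and overshoots are added. The mean number of
  crossings is the drift plus \<kappa> (E|S_n| - |x|), the overshoots contribute the latter once
  more, and E|S_n| - |x| is at most \<sigma> sqrt n.\<close>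

lemma sum_expectation_abs_imbalance_step_le:
  "(\<Sum>j<n. expectation (\<lambda>w. \<bar>imbalance_at x j w\<bar>)) \<le> \<bar>drift n x\<bar> + 2 * \<kappa> * \<sigma> * sqrt (real n)"
proof -
  let ?l = "\<lambda>j. expectation (\<lambda>w. level_crossing (x + T j w) (x + T (Suc j) w))"
  let ?o = "\<lambda>j. 2 * expectation (\<lambda>w. overshoot (x + T j w) (x + T (Suc j) w))"
  have "expectation (\<lambda>w. \<bar>imbalance_at x j w\<bar>) \<le> ?l j + \<kappa> * ?o j" for j
  proof -
    have i: "integrable M (\<lambda>w. level_crossing (x + T j w) (x + T (Suc j) w) + 2 * \<kappa> * overshoot (x + T j w) (x + T (Suc j) w))"
      by (intro Bochner_Integration.integrable_add integrable_mult_right integrable_level_crossing expectation_overshoot(1))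
    have "\<bar>imbalance_step s t\<bar> \<le> level_crossing s t + 2 * \<kappa> * overshoot s t" for s t
      using level_crossing_bounds[of s t] overshoot_nonneg[of s t] \<kappa>_nonneg mult_nonneg_nonneg[of "2 * \<kappa>" "overshoot s t"]
      unfolding imbalance_step_def by linarith
    then have "expectation (\<lambda>w. \<bar>imbalance_at x j w\<bar>) \<le> expectation (\<lambda>w. level_crossing (x + T j w) (x + T (Suc j) w) + 2 * \<kappa> * overshoot (x + T j w) (x + T (Suc j) w))"
      unfolding imbalance_at_def by (intro integral_mono i integrable_abs integrable_imbalance_at(1)[unfolded imbalance_at_def[abs_def]])
    also have "\<dots> = ?l j + \<kappa> * ?o j"
      by (subst Bochner_Integration.integral_add[OF integrable_level_crossing integrable_mult_right[OF expectation_overshoot(1)]]) simp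
    finally show ?thesis .
  qed
  then have "(\<Sum>j<n. expectation (\<lambda>w. \<bar>imbalance_at x j w\<bar>)) \<le> (\<Sum>j<n. ?l j + \<kappa> * ?o j)" by (intro sum_mono)
  also have "\<dots> = (\<Sum>j<n. ?l j) + \<kappa> * (expectation (\<lambda>w. \<bar>x + T n w\<bar>) - \<bar>x\<bar>)"
    unfolding sum_expectation_overshoot[symmetric] sum.distrib by (simp only: sum_distrib_left)
  also have "\<dots> = drift n x + 2 * (\<kappa> * (expectation (\<lambda>w. \<bar>x + T n w\<bar>) - \<bar>x\<bar>))" by (simp add: drift_def)
  finally have le: "(\<Sum>j<n. expectation (\<lambda>w. \<bar>imbalance_at x j w\<bar>)) \<le> drift n x + 2 * (\<kappa> * (expectation (\<lambda>w. \<bar>x + T n w\<bar>) - \<bar>x\<bar>))" .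
  have "\<kappa> * (expectation (\<lambda>w. \<bar>x + T n w\<bar>) - \<bar>x\<bar>) \<le> \<kappa> * (\<sigma> * sqrt (real n))"
  proof (rule mult_left_mono[OF _ \<kappa>_nonneg])
    have "expectation (\<lambda>w. \<bar>x + T n w\<bar>) \<le> expectation (\<lambda>w. \<bar>x\<bar> + \<bar>T n w\<bar>)"
      by (intro integral_mono integrable_abs_walk Bochner_Integration.integrable_add integrable_T) auto
    also have "\<dots> = \<bar>x\<bar> + expectation (\<lambda>w. \<bar>T n w\<bar>)"
      by (subst Bochner_Integration.integral_add) (auto simp: prob_space)
    finally show "expectation (\<lambda>w. \<bar>x + T n w\<bar>) - \<bar>x\<bar> \<le> \<sigma> * sqrt (real n)"
      using expectation_abs_T_le[of n] by linarith
  qed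
  with le abs_ge_self[of "drift n x"] show ?thesis by simp
qed

text \<open>The diagonal is o(n) through \<open>long_steps\<close>. In the cross terms the drift
  from the restarted position is at most a small multiple of sqrt n plus a constant, because the
  walk stays in \<open>A\<close>, where the drift bound is uniform; the absolute values it
  multiplies sum to order sqrt n.\<close>

lemma imbalance_second_moment_tendsto_zero:
  assumes A: "regular_starts A" and x: "x \<in> A" and inA: "AE w in M. \<forall>k. x + T k w \<in> A"
  shows "(\<lambda>n. expectation (\<lambda>w. (imbalance x n w)\<^sup>2) / real n) \<longlonglongrightarrow> 0"
proof (rule LIMSEQ_I)
  fix e :: real assume e: "e > 0"
  define b where "b = 2 * \<kappa> * \<sigma>"
  have b: "b \<ge> 0" using \<kappa>_nonneg sigma_pos by (simp add: b_def)
  \<comment> \<open>Chosen so that the limit 2 * \<epsilon> * (\<epsilon> + b) of the bound is below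
    e; the cap 1 allows the inner \<epsilon> to be replaced by 1.\<close>
  define \<epsilon> where "\<epsilon> = min 1 (e / (4 * (1 + b)))"
  have \<epsilon>: "\<epsilon> > 0" "\<epsilon> \<le> 1" "\<epsilon> \<le> e / (4 * (1 + b))"
    using e b by (auto simp: \<epsilon>_def)
  have \<epsilon>b: "2 * \<epsilon> * (1 + b) \<le> e / 2"
  proof -
    have "\<epsilon> * (4 * (1 + b)) \<le> e" using \<epsilon>(3) b by (subst (asm) pos_le_divide_eq) auto
    then show ?thesis by (simp add: algebra_simps)
  qed
  obtain C0 where C0: "\<And>y m. y \<in> A \<Longrightarrow> \<bar>drift m y\<bar> \<le> \<epsilon> * sqrt (real m) + C0" using drift_le[OF A \<epsilon>(1)] by blast
  define C where "C = max C0 0"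
  have C: "C \<ge> 0" "\<And>y m. y \<in> A \<Longrightarrow> \<bar>drift m y\<bar> \<le> \<epsilon> * sqrt (real m) + C"
  proof -
    show "C \<ge> 0" by (simp add: C_def)
    have "C0 \<le> C" by (simp add: C_def)
    then show "\<bar>drift m y\<bar> \<le> \<epsilon> * sqrt (real m) + C" if "y \<in> A" for y m using C0[OF that, of m] by linarith
  qed
  define W where "W n = (2 + 8 * \<kappa>\<^sup>2) * ((\<Sum>k<n. long_steps x k) / real n)" for n
  define U where "U n = W n + 2 * ((\<epsilon> + C / sqrt (real n)) * (\<epsilon> + C / sqrt (real n) + b))" for n
  have le: "expectation (\<lambda>w. (imbalance x n w)\<^sup>2) / real n \<le> U n" if n: "n > 0" for n
  proof -
    let ?d = "\<epsilon> * sqrt (real n) + C"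
    have d0: "?d \<ge> 0" using \<epsilon> C by simp
    have "expectation (\<lambda>w. imbalance_at x j w * drift (n - Suc j) (x + T (Suc j) w)) \<le> ?d * expectation (\<lambda>w. \<bar>imbalance_at x j w\<bar>)" for j
    proof -
      have ae: "AE w in M. \<bar>imbalance_at x j w * drift (n - Suc j) (x + T (Suc j) w)\<bar> \<le> ?d * \<bar>imbalance_at x j w\<bar>"
        using inA
      proof eventually_elim
        case (elim w)
        have "\<bar>drift (n - Suc j) (x + T (Suc j) w)\<bar> \<le> \<epsilon> * sqrt (real (n - Suc j)) + C" using elim by (intro C(2)) auto
        also have "\<dots> \<le> ?d" using \<epsilon> by (intro add_right_mono mult_left_mono) auto
        finally show ?case unfolding abs_mult by (subst mult.commute) (rule mult_right_mono, auto)
      qed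
      have "(\<lambda>y. drift m y) \<in> borel_measurable borel" for m unfolding drift_eq by measurable
      then have [measurable]: "drift m \<in> borel_measurable borel" for m by simp
      have i0: "integrable M (\<lambda>w. ?d * \<bar>imbalance_at x j w\<bar>)" using integrable_imbalance_at by (intro integrable_mult_right integrable_abs)
      have i1: "integrable M (\<lambda>w. imbalance_at x j w * drift (n - Suc j) (x + T (Suc j) w))"
        by (rule Bochner_Integration.integrable_bound[OF i0]) (use ae d0 in \<open>auto simp: abs_mult\<close>)
      have "expectation (\<lambda>w. imbalance_at x j w * drift (n - Suc j) (x + T (Suc j) w)) \<le> expectation (\<lambda>w. ?d * \<bar>imbalance_at x j w\<bar>)"
        using ae by (intro integral_mono_AE[OF i1 i0]) auto
      then show ?thesis by simp
    qed
    then have "(\<Sum>j<n. expectation (\<lambda>w. imbalance_at x j w * drift (n - Suc j) (x + T (Suc j) w))) \<le> ?d * (\<Sum>j<n. expectation (\<lambda>w. \<bar>imbalance_at x j w\<bar>))"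
      unfolding sum_distrib_left by (intro sum_mono)
    also have "\<dots> \<le> ?d * (?d + b * sqrt (real n))"
      using C(2)[OF x, of n] sum_expectation_abs_imbalance_step_le[of x n] d0 by (intro mult_left_mono) (auto simp: b_def)
    finally have 1: "(\<Sum>j<n. expectation (\<lambda>w. imbalance_at x j w * drift (n - Suc j) (x + T (Suc j) w))) \<le> ?d * (?d + b * sqrt (real n))" .
    have 2: "(\<Sum>k<n. expectation (\<lambda>w. (imbalance_at x k w)\<^sup>2)) \<le> (2 + 8 * \<kappa>\<^sup>2) * (\<Sum>k<n. long_steps x k)"
      unfolding sum_distrib_left by (intro sum_mono integrable_imbalance_at(3))
    have "expectation (\<lambda>w. (imbalance x n w)\<^sup>2) \<le> (2 + 8 * \<kappa>\<^sup>2) * (\<Sum>k<n. long_steps x k) + 2 * (?d * (?d + b * sqrt (real n)))"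
      using 1 2 unfolding expectation_imbalance_square(2) by linarith
    then have "expectation (\<lambda>w. (imbalance x n w)\<^sup>2) / real n \<le> ((2 + 8 * \<kappa>\<^sup>2) * (\<Sum>k<n. long_steps x k) + 2 * (?d * (?d + b * sqrt (real n)))) / real n"
      by (rule divide_right_mono) simp
    also have "\<dots> = U n"
    proof -
      have q: "?d = sqrt (real n) * (\<epsilon> + C / sqrt (real n))" "?d + b * sqrt (real n) = sqrt (real n) * (\<epsilon> + C / sqrt (real n) + b)"
        using n by (simp_all add: distrib_left mult.commute)
      have "?d * (?d + b * sqrt (real n)) = real n * ((\<epsilon> + C / sqrt (real n)) * (\<epsilon> + C / sqrt (real n) + b))"
      proof -
        have "?d * (?d + b * sqrt (real n)) = (sqrt (real n) * (\<epsilon> + C / sqrt (real n))) * (sqrt (real n) * (\<epsilon> + C / sqrt (real n) + b))"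
          by (rule arg_cong2[where f="(*)", OF q])
        also have "\<dots> = (sqrt (real n) * sqrt (real n)) * ((\<epsilon> + C / sqrt (real n)) * (\<epsilon> + C / sqrt (real n) + b))"
          by (simp only: mult_ac)
        finally show ?thesis by simp
      qed
      then show ?thesis using n by (simp add: U_def W_def add_divide_distrib)
    qed
    finally show ?thesis .
  qed
  have "(\<lambda>n. C / sqrt (real n)) \<longlonglongrightarrow> 0"
    by (rule tendsto_inverse_sqrt)
  then have "U \<longlonglongrightarrow> (2 + 8 * \<kappa>\<^sup>2) * 0 + 2 * ((\<epsilon> + 0) * (\<epsilon> + 0 + b))"
    unfolding U_def[abs_def] W_def by (intro tendsto_intros long_steps_average_tendsto_zero)
  moreover have "(2 + 8 * \<kappa>\<^sup>2) * 0 + 2 * ((\<epsilon> + 0) * (\<epsilon> + 0 + b)) < e"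
  proof -
    have "2 * (\<epsilon> * (\<epsilon> + b)) \<le> 2 * (\<epsilon> * (1 + b))" using \<epsilon> by (intro mult_left_mono) auto
    then show ?thesis using \<epsilon>b e by simp
  qed
  ultimately have "\<forall>\<^sub>F n in sequentially. U n < e" by (rule order_tendstoD)
  then have "\<forall>\<^sub>F n in sequentially. U n < e \<and> n > 0" using eventually_gt_at_top[of 0] by eventually_elim auto
  then obtain N where N: "\<And>n. n \<ge> N \<Longrightarrow> U n < e \<and> n > 0" by (auto simp: eventually_sequentially)
  have "norm (expectation (\<lambda>w. (imbalance x n w)\<^sup>2) / real n - 0) < e" if "n \<ge> N" for n
    using N[OF that] le[of n] by (auto simp: abs_of_nonneg)
  then show "\<exists>N. \<forall>n\<ge>N. norm (expectation (\<lambda>w. (imbalance x n w)\<^sup>2) / real n - 0) < e" by blast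
qed

end

section \<open>The limit of the overshoots\<close>

lemma abs_reflected_mode_deriv_le: "l > 0 \<Longrightarrow> \<bar>reflected_mode_deriv l m x\<bar> \<le> l + \<bar>m\<bar>"
  unfolding reflected_mode_deriv_def
  by (rule order_trans[OF abs_triangle_ineq4], rule add_mono) (auto simp: abs_mult intro: mult_left_le)

text \<open>The argument on the left is c times \<open>side s * t\<close>, which is negative exactly
  when the step lands strictly beyond zero; then the exponential in
  \<open>reflected_mode_ext\<close> supplies the weight of twice the overshoot. One function of the
  unreflected displacement thus encodes the new position and the growth of the local time.\<close>

lemma reflected_mode_ext_step:
  assumes c: "c > 0"
  shows "reflected_mode_ext l m (c * \<bar>s\<bar> + c * side s * (t - s)) = exp (- l * (2 * c * overshoot s t)) * reflected_mode l m (c * \<bar>t\<bar>)"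
proof -
  have u: "c * \<bar>s\<bar> + c * side s * (t - s) = c * (side s * t)"
    by (simp add: side_def algebra_simps)
  show ?thesis
  proof (cases "side s * t < 0")
    case True
    then have "overshoot s t = - (side s * t)" "\<bar>t\<bar> = - (side s * t)"
      by (auto simp: overshoot_def level_crossing_def side_def split: if_splits)
    moreover have "c * (side s * t) < 0" using True c by (simp add: mult_pos_neg)
    ultimately show ?thesis unfolding u by (simp add: reflected_mode_ext_def mult_ac)
  next
    case False
    then have "overshoot s t = 0" "\<bar>t\<bar> = side s * t"
      by (auto simp: overshoot_def level_crossing_def side_def split: if_splits)
    moreover have "\<not> c * (side s * t) < 0" using False c by (simp add: mult_less_0_iff)
    ultimately show ?thesis unfolding u by (simp add: reflected_mode_ext_def)
  qed
qed

text \<open>Earlier errors are not amplified, because |q| is at most 1.\<close>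

lemma perturbed_geometric_recursion:
  fixes F e :: "nat \<Rightarrow> real"
  assumes "\<And>k. \<bar>F (Suc k) - q * F k\<bar> \<le> e k" "\<bar>q\<bar> \<le> 1"
  shows "\<bar>F n - q ^ n * F 0\<bar> \<le> (\<Sum>k<n. e k)"
proof (induction n)
  case (Suc n)
  have "F (Suc n) - q ^ Suc n * F 0 = (F (Suc n) - q * F n) + q * (F n - q ^ n * F 0)" by (simp add: algebra_simps)
  then have "\<bar>F (Suc n) - q ^ Suc n * F 0\<bar> \<le> \<bar>F (Suc n) - q * F n\<bar> + \<bar>q\<bar> * \<bar>F n - q ^ n * F 0\<bar>"
    by (metis abs_mult abs_triangle_ineq)
  also have "\<dots> \<le> e n + 1 * (\<Sum>k<n. e k)"
    using assms Suc.IH by (intro add_mono mult_mono) auto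
  finally show ?case by simp
qed simp

context centered_walk
begin

definition total_overshoot :: "real \<Rightarrow> nat \<Rightarrow> 'a \<Rightarrow> real" where
  "total_overshoot x n w = (\<Sum>k<n. overshoot (x + T k w) (x + T (Suc k) w))"

lemma total_overshoot_nonneg: "total_overshoot x n w \<ge> 0"
  unfolding total_overshoot_def by (intro sum_nonneg overshoot_nonneg)

lemma total_overshoot_measurable_hist:
  assumes "n \<le> k"
  shows "total_overshoot x n \<in> borel_measurable (hist k)"
  unfolding total_overshoot_def[abs_def]
proof (rule borel_measurable_sum)
  fix j assume "j \<in> {..<n}"
  then have "j \<le> k" "Suc j \<le> k" using assms by auto
  from measurable_compose[OF measurable_Pair[OF walk_measurable_hist[OF this(1)] walk_measurable_hist[OF this(2)]] overshoot_measurable]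
  show "(\<lambda>w. overshoot (x + T j w) (x + T (Suc j) w)) \<in> borel_measurable (hist k)"
    by (simp only: prod.case)
qed

lemma total_overshoot_measurable [measurable]: "total_overshoot x n \<in> borel_measurable M"
  by (rule hist_measurable_imp[OF total_overshoot_measurable_hist[of n n]]) simp

text \<open>The part of the Taylor error that every step incurs; the minimum keeps it finite without
  a third moment.\<close>

definition step_error :: "real \<Rightarrow> real" where
  "step_error c = (\<integral>r. min (c\<^sup>2 * r\<^sup>2) (c ^ 3 * \<bar>r\<bar> ^ 3) \<partial>\<mu>)"

text \<open>The Taylor coefficients at the old position are known at time k: the linear term has
  mean zero and the quadratic one gives the factor 1 - m^2 c^2 \<sigma>^2 / 2. The remainder splits
  into the error of every step and that of steps able to reach zero. The constant is chosen before
  c, so that c may tend to 0.\<close>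

lemma reflected_mode_step:
  assumes l: "l > 0" and m: "m \<noteq> 0"
  obtains C where "C > 0"
    "\<And>c x k. c > 0 \<Longrightarrow> \<bar>expectation (\<lambda>w. exp (- l * (2 * c * total_overshoot x (Suc k) w)) * reflected_mode l m (c * \<bar>x + T (Suc k) w\<bar>))
      - (1 - m\<^sup>2 * c\<^sup>2 * \<sigma>\<^sup>2 / 2) * expectation (\<lambda>w. exp (- l * (2 * c * total_overshoot x k w)) * reflected_mode l m (c * \<bar>x + T k w\<bar>))\<bar>
      \<le> C * (step_error c + c\<^sup>2 * long_steps x k)"
proof -
  obtain C where C: "C > 0"
    "\<And>x h. x \<ge> 0 \<Longrightarrow> \<bar>reflected_mode_ext l m (x + h) - reflected_mode l m x - h * reflected_mode_deriv l m x
        + h\<^sup>2 * m\<^sup>2 * reflected_mode l m x / 2\<bar> \<le> C * (min (h\<^sup>2) (\<bar>h\<bar> ^ 3) + h\<^sup>2 * of_bool (x \<le> \<bar>h\<bar>))"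
    using reflected_mode_ext_taylor[OF m l] by blast
  let ?K = "reflected_mode l m" and ?K' = "reflected_mode_deriv l m"
  have "\<bar>expectation (\<lambda>w. exp (- l * (2 * c * total_overshoot x (Suc k) w)) * ?K (c * \<bar>x + T (Suc k) w\<bar>))
      - (1 - m\<^sup>2 * c\<^sup>2 * \<sigma>\<^sup>2 / 2) * expectation (\<lambda>w. exp (- l * (2 * c * total_overshoot x k w)) * ?K (c * \<bar>x + T k w\<bar>))\<bar>
      \<le> C * (step_error c + c\<^sup>2 * long_steps x k)" if c: "c > 0" for c x k
  proof -
    define E where "E w = exp (- l * (2 * c * total_overshoot x k w))" for w
    define s where "s w = x + T k w" for w
    define h where "h w = c * side (s w) * X (Suc k) w" for w
    define Y1 where "Y1 w = E w * ?K (c * \<bar>s w\<bar>)" for w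
    define Y2 where "Y2 w = E w * ?K' (c * \<bar>s w\<bar>) * (c * side (s w))" for w
    have E: "0 \<le> E w" "E w \<le> 1" for w using total_overshoot_nonneg[of x k w] c l by (auto simp: E_def)
    have Eh: "E \<in> borel_measurable (hist k)" unfolding E_def[abs_def] using total_overshoot_measurable_hist[of k k x] by measurable
    have sh: "s \<in> borel_measurable (hist k)" unfolding s_def[abs_def] by (rule walk_measurable_hist) simp
    have Y1h: "Y1 \<in> borel_measurable (hist k)" unfolding Y1_def[abs_def] using Eh sh by measurable
    have Y2h: "Y2 \<in> borel_measurable (hist k)" unfolding Y2_def[abs_def] using Eh sh by measurable
    note [measurable] = hist_measurable_imp[OF Y1h] hist_measurable_imp[OF Y2h] hist_measurable_imp[OF Eh] hist_measurable_imp[OF sh]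
    have hm[measurable]: "h \<in> borel_measurable M" unfolding h_def[abs_def] by measurable
    let ?B = "1 + l / \<bar>m\<bar>"
    have Y1b: "\<bar>Y1 w\<bar> \<le> 1 * ?B" for w
      unfolding Y1_def abs_mult using E[of w] abs_reflected_mode_le(1)[OF m l] by (intro mult_mono) auto
    have Y2b: "\<bar>Y2 w\<bar> \<le> 1 * (l + \<bar>m\<bar>) * c" for w
      unfolding Y2_def abs_mult using E[of w] abs_reflected_mode_deriv_le[OF l] c l by (intro mult_mono) (auto simp: side_def)
    have Y1i: "integrable M Y1" by (rule integrable_const_bound[where B="1 * ?B"]) (use Y1b in auto)
    have Y2X: "integrable M (\<lambda>w. Y2 w * X (Suc k) w)"
    proof (rule Bochner_Integration.integrable_bound)
      show "integrable M (\<lambda>w. (1 * (l + \<bar>m\<bar>) * c) * \<bar>X (Suc k) w\<bar>)" by (intro integrable_mult_right integrable_step_k)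
      show "AE w in M. norm (Y2 w * X (Suc k) w) \<le> norm ((1 * (l + \<bar>m\<bar>) * c) * \<bar>X (Suc k) w\<bar>)"
      proof (rule AE_I2)
        fix w
        have "\<bar>Y2 w\<bar> \<le> \<bar>1 * (l + \<bar>m\<bar>) * c\<bar>" using Y2b[of w] by linarith
        from mult_right_mono[OF this, of "\<bar>X (Suc k) w\<bar>"]
        show "norm (Y2 w * X (Suc k) w) \<le> norm ((1 * (l + \<bar>m\<bar>) * c) * \<bar>X (Suc k) w\<bar>)"
          by (simp only: real_norm_def abs_mult abs_abs abs_ge_zero)
      qed
    qed measurable
    have Y1X: "integrable M (\<lambda>w. Y1 w * (X (Suc k) w)\<^sup>2)"
    proof (rule Bochner_Integration.integrable_bound)
      show "integrable M (\<lambda>w. (1 * ?B) * (X (Suc k) w)\<^sup>2)" by (intro integrable_mult_right integrable_step_k)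
      show "AE w in M. norm (Y1 w * (X (Suc k) w)\<^sup>2) \<le> norm ((1 * ?B) * (X (Suc k) w)\<^sup>2)"
      proof (rule AE_I2)
        fix w
        have "\<bar>Y1 w\<bar> \<le> \<bar>1 * ?B\<bar>" using Y1b[of w] by linarith
        from mult_right_mono[OF this, of "\<bar>(X (Suc k) w)\<^sup>2\<bar>"]
        show "norm (Y1 w * (X (Suc k) w)\<^sup>2) \<le> norm ((1 * ?B) * (X (Suc k) w)\<^sup>2)"
          by (simp only: real_norm_def abs_mult abs_ge_zero)
      qed
    qed measurable
    have e2: "expectation (\<lambda>w. Y2 w * X (Suc k) w) = 0"
    proof -
      have "expectation (\<lambda>w. (\<lambda>y r. y * r) (Y2 w) (X (Suc k) w)) = expectation (\<lambda>w. \<integral>r. Y2 w * r \<partial>\<mu>)"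
        by (rule expectation_step(1)[OF Y2h]) (use Y2X in simp_all)
      then show ?thesis by simp
    qed
    have e1: "expectation (\<lambda>w. Y1 w * (X (Suc k) w)\<^sup>2) = \<sigma>\<^sup>2 * expectation Y1"
    proof -
      have "expectation (\<lambda>w. (\<lambda>y r. y * r\<^sup>2) (Y1 w) (X (Suc k) w)) = expectation (\<lambda>w. \<integral>r. Y1 w * r\<^sup>2 \<partial>\<mu>)"
        by (rule expectation_step(1)[OF Y1h]) (use Y1X in simp_all)
      then show ?thesis by simp
    qed
    define N where "N w = exp (- l * (2 * c * total_overshoot x (Suc k) w)) * ?K (c * \<bar>x + T (Suc k) w\<bar>)" for w
    have N: "N w = E w * reflected_mode_ext l m (c * \<bar>s w\<bar> + h w)" for w
    proof -
      have "c * side (s w) * (x + T (Suc k) w - s w) = h w" by (simp add: s_def h_def T_Suc)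
      then have "reflected_mode_ext l m (c * \<bar>s w\<bar> + h w) = exp (- l * (2 * c * overshoot (s w) (x + T (Suc k) w))) * ?K (c * \<bar>x + T (Suc k) w\<bar>)"
        using reflected_mode_ext_step[OF c, of l m "s w" "x + T (Suc k) w"] by simp
      then show ?thesis
        by (simp add: N_def E_def total_overshoot_def s_def exp_add[symmetric] algebra_simps)
    qed
    have Nb: "\<bar>N w\<bar> \<le> 1 * ?B" for w
      unfolding N_def abs_mult using total_overshoot_nonneg[of x "Suc k" w] c l abs_reflected_mode_le(1)[OF m l] by (intro mult_mono) auto
    have Nm[measurable]: "N \<in> borel_measurable M" unfolding N_def[abs_def] by measurable
    have Ni: "integrable M N" by (rule integrable_const_bound[where B="1 * ?B"]) (use Nb in auto)
    define D where "D w = N w - Y1 w - Y2 w * X (Suc k) w + c\<^sup>2 * m\<^sup>2 / 2 * (Y1 w * (X (Suc k) w)\<^sup>2)" for w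
    have Di: "integrable M D" unfolding D_def[abs_def]
      by (intro Bochner_Integration.integrable_add Bochner_Integration.integrable_diff Ni Y1i Y2X integrable_mult_right Y1X)
    have eD: "expectation D = expectation N - (1 - m\<^sup>2 * c\<^sup>2 * \<sigma>\<^sup>2 / 2) * expectation Y1"
    proof -
      have "expectation D = expectation N - expectation Y1 - 0 + c\<^sup>2 * m\<^sup>2 / 2 * (\<sigma>\<^sup>2 * expectation Y1)"
        unfolding D_def e1[symmetric] e2[symmetric]
        unfolding Bochner_Integration.integral_add[OF Bochner_Integration.integrable_diff[OF Bochner_Integration.integrable_diff[OF Ni Y1i] Y2X] integrable_mult_right[OF Y1X]]
          Bochner_Integration.integral_diff[OF Bochner_Integration.integrable_diff[OF Ni Y1i] Y2X] Bochner_Integration.integral_diff[OF Ni Y1i]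
          integral_mult_right_zero ..
      then show ?thesis by (simp add: algebra_simps)
    qed
    let ?min = "\<lambda>r. min (c\<^sup>2 * r\<^sup>2) (c ^ 3 * \<bar>r\<bar> ^ 3)"
    let ?ls = "\<lambda>w. (1 + (X (Suc k) w)\<^sup>2) * of_bool (\<bar>x + T k w\<bar> \<le> \<bar>X (Suc k) w\<bar>)"
    have Db: "\<bar>D w\<bar> \<le> C * (?min (X (Suc k) w) + c\<^sup>2 * ?ls w)" for w
    proof -
      have hX: "\<bar>h w\<bar> = c * \<bar>X (Suc k) w\<bar>" using c by (simp add: h_def abs_mult side_def)
      have h2: "(h w)\<^sup>2 = c\<^sup>2 * (X (Suc k) w)\<^sup>2" by (simp add: h_def power_mult_distrib side_def)
      have ob: "(c * \<bar>s w\<bar> \<le> c * \<bar>X (Suc k) w\<bar>) = (\<bar>x + T k w\<bar> \<le> \<bar>X (Suc k) w\<bar>)" using c by (simp add: s_def)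
      have "D w = E w * (reflected_mode_ext l m (c * \<bar>s w\<bar> + h w) - ?K (c * \<bar>s w\<bar>) - h w * ?K' (c * \<bar>s w\<bar>)
        + (h w)\<^sup>2 * m\<^sup>2 * ?K (c * \<bar>s w\<bar>) / 2)"
        unfolding D_def N h2 Y1_def Y2_def by (simp add: h_def algebra_simps)
      then have "\<bar>D w\<bar> = E w * \<bar>reflected_mode_ext l m (c * \<bar>s w\<bar> + h w) - ?K (c * \<bar>s w\<bar>) - h w * ?K' (c * \<bar>s w\<bar>)
        + (h w)\<^sup>2 * m\<^sup>2 * ?K (c * \<bar>s w\<bar>) / 2\<bar>"
        using E[of w] by (simp add: abs_mult)
      also have "\<dots> \<le> 1 * (C * (min ((h w)\<^sup>2) (\<bar>h w\<bar> ^ 3) + (h w)\<^sup>2 * of_bool (c * \<bar>s w\<bar> \<le> \<bar>h w\<bar>)))"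
        using E[of w] c by (intro mult_mono C(2)) auto
      also have "\<dots> = C * (?min (X (Suc k) w) + c\<^sup>2 * ((X (Suc k) w)\<^sup>2 * of_bool (\<bar>x + T k w\<bar> \<le> \<bar>X (Suc k) w\<bar>)))"
        unfolding hX h2 ob by (simp add: power_mult_distrib)
      also have "\<dots> \<le> C * (?min (X (Suc k) w) + c\<^sup>2 * ?ls w)"
        using C(1) by (intro mult_left_mono add_left_mono mult_right_mono) auto
      finally show ?thesis .
    qed
    have mi: "integrable M (\<lambda>w. ?min (X (Suc k) w))"
    proof (rule Bochner_Integration.integrable_bound)
      show "integrable M (\<lambda>w. c\<^sup>2 * (X (Suc k) w)\<^sup>2)" by (intro integrable_mult_right integrable_step_k)
      show "AE w in M. norm (?min (X (Suc k) w)) \<le> norm (c\<^sup>2 * (X (Suc k) w)\<^sup>2)"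
      proof (rule AE_I2)
        fix w
        have "0 \<le> c ^ 3 * \<bar>X (Suc k) w\<bar> ^ 3" "0 \<le> c\<^sup>2 * (X (Suc k) w)\<^sup>2" using c by simp_all
        moreover have "\<bar>min a b\<bar> \<le> \<bar>a\<bar>" if "0 \<le> b" "0 \<le> a" for a b :: real using that by (simp add: min_def)
        ultimately show "norm (?min (X (Suc k) w)) \<le> norm (c\<^sup>2 * (X (Suc k) w)\<^sup>2)" unfolding real_norm_def by blast
      qed
    qed measurable
    have Bi: "integrable M (\<lambda>w. C * (?min (X (Suc k) w) + c\<^sup>2 * ?ls w))"
      by (intro integrable_mult_right Bochner_Integration.integrable_add mi integrable_long_steps)
    have se: "expectation (\<lambda>w. ?min (X (Suc k) w)) = step_error c"
      unfolding step_error_def by (rule integral_mu_step[symmetric]) measurable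
    have "\<bar>expectation D\<bar> \<le> expectation (\<lambda>w. C * (?min (X (Suc k) w) + c\<^sup>2 * ?ls w))"
      by (rule order_trans[OF integral_abs_bound], rule integral_mono[OF integrable_abs[OF Di] Bi Db])
    also have "\<dots> = C * (step_error c + c\<^sup>2 * long_steps x k)"
      unfolding integral_mult_right_zero Bochner_Integration.integral_add[OF mi integrable_mult_right[OF integrable_long_steps]] se long_steps_def ..
    finally show ?thesis unfolding eD N_def[abs_def] Y1_def[abs_def] E_def s_def .
  qed
  with C(1) show ?thesis using that by blast
qed

text \<open>After multiplication by n the first entry of the minimum is r^2 / \<sigma>^2 and serves
  as majorant; the second is of order |r|^3 / sqrt n and gives the pointwise limit.\<close>

lemma step_error_tendsto: "(\<lambda>n. real n * step_error (1 / (\<sigma> * sqrt (real n)))) \<longlonglongrightarrow> 0"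
proof -
  have "(\<lambda>n. \<integral>r. real n * min ((1 / (\<sigma> * sqrt (real n)))\<^sup>2 * r\<^sup>2) ((1 / (\<sigma> * sqrt (real n))) ^ 3 * \<bar>r\<bar> ^ 3) \<partial>\<mu>) \<longlonglongrightarrow> integral\<^sup>L \<mu> (\<lambda>r. 0)"
  proof (rule integral_dominated_convergence[where w="\<lambda>r. r\<^sup>2 / \<sigma>\<^sup>2"])
    have c2: "real n * (1 / (\<sigma> * sqrt (real n)))\<^sup>2 \<le> 1 / \<sigma>\<^sup>2" for n
      by (cases "n = 0") (auto simp: power_divide power_mult_distrib)
    show "AE r in \<mu>. norm (real n * min ((1 / (\<sigma> * sqrt (real n)))\<^sup>2 * r\<^sup>2) ((1 / (\<sigma> * sqrt (real n))) ^ 3 * \<bar>r\<bar> ^ 3)) \<le> r\<^sup>2 / \<sigma>\<^sup>2" for n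
    proof (rule AE_I2)
      fix r
      let ?c = "1 / (\<sigma> * sqrt (real n))"
      have c: "?c \<ge> 0" using sigma_pos by simp
      have "0 \<le> min (?c\<^sup>2 * r\<^sup>2) (?c ^ 3 * \<bar>r\<bar> ^ 3)"
            by (intro min.boundedI mult_nonneg_nonneg[OF zero_le_power2 zero_le_power2]
                mult_nonneg_nonneg[OF zero_le_power[OF c] zero_le_power[OF abs_ge_zero]])
      then have "norm (real n * min (?c\<^sup>2 * r\<^sup>2) (?c ^ 3 * \<bar>r\<bar> ^ 3)) = real n * min (?c\<^sup>2 * r\<^sup>2) (?c ^ 3 * \<bar>r\<bar> ^ 3)" by (simp only: real_norm_def abs_mult abs_of_nat abs_of_nonneg)
      also have "\<dots> \<le> real n * (?c\<^sup>2 * r\<^sup>2)" by (intro mult_left_mono) auto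
      also have "\<dots> \<le> 1 / \<sigma>\<^sup>2 * r\<^sup>2" using mult_right_mono[OF c2[of n], of "r\<^sup>2"] by (simp add: mult_ac)
      finally show "norm (real n * min (?c\<^sup>2 * r\<^sup>2) (?c ^ 3 * \<bar>r\<bar> ^ 3)) \<le> r\<^sup>2 / \<sigma>\<^sup>2" by simp
    qed
    show "AE r in \<mu>. (\<lambda>n. real n * min ((1 / (\<sigma> * sqrt (real n)))\<^sup>2 * r\<^sup>2) ((1 / (\<sigma> * sqrt (real n))) ^ 3 * \<bar>r\<bar> ^ 3)) \<longlonglongrightarrow> 0"
    proof (rule AE_I2)
      fix r
      show "(\<lambda>n. real n * min ((1 / (\<sigma> * sqrt (real n)))\<^sup>2 * r\<^sup>2) ((1 / (\<sigma> * sqrt (real n))) ^ 3 * \<bar>r\<bar> ^ 3)) \<longlonglongrightarrow> 0"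
      proof (rule Lim_null_comparison[OF always_eventually])
        show "\<forall>n. norm (real n * min ((1 / (\<sigma> * sqrt (real n)))\<^sup>2 * r\<^sup>2) ((1 / (\<sigma> * sqrt (real n))) ^ 3 * \<bar>r\<bar> ^ 3)) \<le> \<bar>r\<bar> ^ 3 / \<sigma> ^ 3 * (1 / sqrt (real n))"
        proof
          fix n
          let ?c = "1 / (\<sigma> * sqrt (real n))"
          have c: "?c \<ge> 0" using sigma_pos by simp
          have "0 \<le> min (?c\<^sup>2 * r\<^sup>2) (?c ^ 3 * \<bar>r\<bar> ^ 3)"
            by (intro min.boundedI mult_nonneg_nonneg[OF zero_le_power2 zero_le_power2]
                mult_nonneg_nonneg[OF zero_le_power[OF c] zero_le_power[OF abs_ge_zero]])
          then have "norm (real n * min (?c\<^sup>2 * r\<^sup>2) (?c ^ 3 * \<bar>r\<bar> ^ 3)) = real n * min (?c\<^sup>2 * r\<^sup>2) (?c ^ 3 * \<bar>r\<bar> ^ 3)" by (simp only: real_norm_def abs_mult abs_of_nat abs_of_nonneg)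
          also have "\<dots> \<le> real n * (?c ^ 3 * \<bar>r\<bar> ^ 3)" by (intro mult_left_mono) auto
          also have "\<dots> = \<bar>r\<bar> ^ 3 / \<sigma> ^ 3 * (1 / sqrt (real n))"
          proof (cases "n = 0")
            case False
            define w where "w = sqrt (real n)"
            have w: "w > 0" "real n = w * w" using False by (auto simp: w_def)
            show ?thesis unfolding w_def[symmetric] w(2) using w(1) sigma_pos by (simp add: field_simps power3_eq_cube)
          qed simp
          finally show "norm (real n * min (?c\<^sup>2 * r\<^sup>2) (?c ^ 3 * \<bar>r\<bar> ^ 3)) \<le> \<bar>r\<bar> ^ 3 / \<sigma> ^ 3 * (1 / sqrt (real n))" .
        qed
        have "(\<lambda>n. 1 / sqrt (real n)) \<longlonglongrightarrow> 0" by real_asymp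
        from tendsto_mult_right_zero[OF this] show "(\<lambda>n. \<bar>r\<bar> ^ 3 / \<sigma> ^ 3 * (1 / sqrt (real n))) \<longlonglongrightarrow> 0" .
      qed
    qed
    show "integrable \<mu> (\<lambda>r. r\<^sup>2 / \<sigma>\<^sup>2)" by (rule integrable_divide) (rule mu_integrable)
  qed measurable
  then show ?thesis unfolding step_error_def by (simp only: integral_mult_right_zero integral_zero)
qed

text \<open>With c = 1 / (\<sigma> sqrt n) each step multiplies the mean by 1 - m^2 / (2 n), up to
  errors that add up to n times \<open>step_error\<close> and the average of
  \<open>long_steps\<close>. The initial value tends to the mode at 0, which is 1.\<close>

lemma reflected_mode_tendsto:
  assumes l: "l > 0" and m: "m \<noteq> 0"
  shows "(\<lambda>n. expectation (\<lambda>w. exp (- l * (2 * (1 / (\<sigma> * sqrt (real n))) * total_overshoot x n w)) * reflected_mode l m (1 / (\<sigma> * sqrt (real n)) * \<bar>x + T n w\<bar>)))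
     \<longlonglongrightarrow> exp (- m\<^sup>2 / 2)"
proof -
  define c where "c n = 1 / (\<sigma> * sqrt (real n))" for n
  define F where "F n k = expectation (\<lambda>w. exp (- l * (2 * c n * total_overshoot x k w)) * reflected_mode l m (c n * \<bar>x + T k w\<bar>))" for n k
  define q where "q n = 1 + (- m\<^sup>2 / 2) / real n" for n
  obtain C where C: "C > 0"
    "\<And>c x k. c > 0 \<Longrightarrow> \<bar>expectation (\<lambda>w. exp (- l * (2 * c * total_overshoot x (Suc k) w)) * reflected_mode l m (c * \<bar>x + T (Suc k) w\<bar>))
      - (1 - m\<^sup>2 * c\<^sup>2 * \<sigma>\<^sup>2 / 2) * expectation (\<lambda>w. exp (- l * (2 * c * total_overshoot x k w)) * reflected_mode l m (c * \<bar>x + T k w\<bar>))\<bar>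
      \<le> C * (step_error c + c\<^sup>2 * long_steps x k)"
    using reflected_mode_step[OF l m] by blast
  define e where "e n = C * (real n * step_error (c n) + 1 / \<sigma>\<^sup>2 * ((\<Sum>k<n. long_steps x k) / real n))" for n
  have c2: "(c n)\<^sup>2 = 1 / (\<sigma>\<^sup>2 * real n)" for n by (simp add: c_def power_divide power_mult_distrib)
  \<comment> \<open>The condition m^2 / 4 <= n says that q n >= - 1, so that errors do not grow
    along the recursion.\<close>
  have bound: "\<bar>F n n - q n ^ n * F n 0\<bar> \<le> e n" if n: "n > 0" "m\<^sup>2 / 4 \<le> real n" for n
  proof -
    have cn: "c n > 0" using n sigma_pos by (simp add: c_def)
    have qe: "1 - m\<^sup>2 * (c n)\<^sup>2 * \<sigma>\<^sup>2 / 2 = q n" using n sigma_pos unfolding c2 q_def by (simp add: field_simps)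
    have "\<bar>F n n - q n ^ n * F n 0\<bar> \<le> (\<Sum>k<n. C * (step_error (c n) + (c n)\<^sup>2 * long_steps x k))"
    proof (rule perturbed_geometric_recursion)
      show "\<bar>F n (Suc k) - q n * F n k\<bar> \<le> C * (step_error (c n) + (c n)\<^sup>2 * long_steps x k)" for k
        using C(2)[OF cn, of x k] unfolding F_def qe .
      show "\<bar>q n\<bar> \<le> 1" using n unfolding q_def by (simp add: abs_le_iff field_simps)
    qed
    also have "\<dots> = e n"
      unfolding e_def c2 by (simp add: sum_distrib_left[symmetric] sum.distrib sum_divide_distrib[symmetric])
    finally show ?thesis .
  qed
  have c0: "c \<longlonglongrightarrow> 0"
    unfolding c_def[abs_def] using sigma_pos by real_asymp
  have "e \<longlonglongrightarrow> C * (0 + 1 / \<sigma>\<^sup>2 * 0)"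
    unfolding e_def[abs_def] c_def by (intro tendsto_intros step_error_tendsto long_steps_average_tendsto_zero)
  then have e0: "e \<longlonglongrightarrow> 0" by simp
  have "(\<lambda>n. F n n - q n ^ n * F n 0) \<longlonglongrightarrow> 0"
  proof (rule Lim_null_comparison[OF _ e0])
    show "\<forall>\<^sub>F n in sequentially. norm (F n n - q n ^ n * F n 0) \<le> e n"
      using eventually_gt_at_top[of 0] eventually_ge_at_top[of "nat \<lceil>m\<^sup>2 / 4\<rceil>"]
    proof eventually_elim
      case (elim n)
      then have "m\<^sup>2 / 4 \<le> real n" by linarith
      then show ?case using bound[OF elim(1)] by simp
    qed
  qed
  moreover have "(\<lambda>n. q n ^ n * F n 0) \<longlonglongrightarrow> exp (- m\<^sup>2 / 2) * 1"
  proof (rule tendsto_mult)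
    show "(\<lambda>n. q n ^ n) \<longlonglongrightarrow> exp (- m\<^sup>2 / 2)" unfolding q_def by (rule tendsto_exp_limit_sequentially)
    have "F n 0 = reflected_mode l m (c n * \<bar>x\<bar>)" for n by (simp add: F_def total_overshoot_def prob_space)
    moreover have "(\<lambda>n. reflected_mode l m (c n * \<bar>x\<bar>)) \<longlonglongrightarrow> cos (m * (0 * \<bar>x\<bar>)) + l * sin (m * (0 * \<bar>x\<bar>)) / m"
      unfolding reflected_mode_def using m by (intro tendsto_intros c0)
    ultimately show "(\<lambda>n. F n 0) \<longlonglongrightarrow> 1" by simp
  qed
  ultimately have "(\<lambda>n. (F n n - q n ^ n * F n 0) + q n ^ n * F n 0) \<longlonglongrightarrow> 0 + exp (- m\<^sup>2 / 2) * 1"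
    by (rule tendsto_add)
  then show ?thesis by (simp add: F_def c_def)
qed

end

section \<open>The limit law\<close>

text \<open>The cosine part contributes exp (- l * s) and the sine part its complement to 1, so the
  position disappears pathwise.\<close>

lemma has_bochner_integral_reflected_mode:
  assumes l: "l > 0" and s: "s \<ge> 0"
  shows "has_bochner_integral lborel (\<lambda>m. reflected_mode l m s * (l / (pi * (l\<^sup>2 + m\<^sup>2)))) 1"
proof -
  have "has_bochner_integral lborel (\<lambda>m. cos (m * s) * (l / (pi * (l\<^sup>2 + m\<^sup>2))) + l * sin (m * s) / m * (l / (pi * (l\<^sup>2 + m\<^sup>2))))
    (exp (- l * s) + (1 - exp (- l * s)))"
    by (intro has_bochner_integral_add has_bochner_integral_cos_cauchy_density has_bochner_integral_sin_cauchy_density l s)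
  then show ?thesis
    unfolding reflected_mode_def distrib_right by simp
qed

text \<open>Since exp (- m^2 / 2) is the normal mean of cos (m * w), Fubini reduces the claim to the
  transform of the Cauchy density.\<close>

lemma integral_gaussian_cauchy_density:
  assumes l: "l > 0"
  shows "(LBINT m. exp (- m\<^sup>2 / 2) * (l / (pi * (l\<^sup>2 + m\<^sup>2)))) = (\<integral>w. exp (- l * \<bar>w\<bar>) \<partial>std_normal_distribution)"
proof -
  interpret N: real_distribution std_normal_distribution by (rule real_dist_normal_dist)
  interpret P: pair_sigma_finite std_normal_distribution lborel ..
  define d where "d m = l / (pi * (l\<^sup>2 + m\<^sup>2))" for m :: real
  have d: "integrable lborel d" "\<And>m. d m \<ge> 0"
    using has_bochner_integral_cos_cauchy_density[OF l, of 0] l by (auto simp: d_def[abs_def] has_bochner_integral_iff)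
  have [measurable]: "d \<in> borel_measurable borel" unfolding d_def[abs_def] by measurable
  define f where "f w m = cos (m * w) * d m" for w m :: real
  have fb: "norm (f w m) \<le> d m" for w m unfolding f_def using d(2)[of m] by (simp add: abs_mult mult_left_le_one_le)
  have fm: "case_prod f \<in> borel_measurable (std_normal_distribution \<Otimes>\<^sub>M lborel)"
    unfolding f_def by measurable
  have fi: "integrable lborel (f w)" for w
    by (rule Bochner_Integration.integrable_bound[OF d(1)]) (use fb d(2) in \<open>auto simp: f_def[abs_def]\<close>)
  have int: "integrable (std_normal_distribution \<Otimes>\<^sub>M lborel) (case_prod f)"
  proof (rule P.Fubini_integrable[OF fm])
    show "integrable std_normal_distribution (\<lambda>w. LBINT m. norm (case_prod f (w, m)))"
    proof (rule N.integrable_const_bound[where B="LBINT m. d m", OF AE_I2])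
      fix w
      have "(LBINT m. norm (f w m)) \<le> (LBINT m. d m)"
        by (rule integral_mono[OF integrable_norm[OF fi] d(1) fb])
      then show "norm (LBINT m. norm (case_prod f (w, m))) \<le> (LBINT m. d m)" by simp
    qed (use fm in measurable)
    show "AE w in std_normal_distribution. integrable lborel (\<lambda>m. case_prod f (w, m))" using fi by simp
  qed
  have ch: "(\<integral>w. cos (m * w) \<partial>std_normal_distribution) = exp (- m\<^sup>2 / 2)" for m
  proof -
    have "(\<integral>w. cos (m * w) \<partial>std_normal_distribution) = (\<integral>w. Re (iexp (m * w)) \<partial>std_normal_distribution)" by (simp add: Re_exp)
    also have "\<dots> = Re (char std_normal_distribution m)"
      unfolding char_def by (rule integral_Re[OF N.integrable_iexp]) auto
    also have "\<dots> = exp (- m\<^sup>2 / 2)" unfolding char_std_normal_distribution by simp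
    finally show ?thesis .
  qed
  have "(LBINT m. exp (- m\<^sup>2 / 2) * d m) = (LBINT m. \<integral>w. f w m \<partial>std_normal_distribution)"
    unfolding f_def integral_mult_left_zero ch ..
  also have "\<dots> = (\<integral>w. (LBINT m. f w m) \<partial>std_normal_distribution)"
    by (rule P.Fubini_integral[OF int])
  also have "(\<lambda>w. LBINT m. f w m) = (\<lambda>w. exp (- l * \<bar>w\<bar>))"
  proof
    fix w
    have "(LBINT m. cos (m * \<bar>w\<bar>) * d m) = exp (- l * \<bar>w\<bar>)"
      using has_bochner_integral_cos_cauchy_density[OF l, of "\<bar>w\<bar>"] unfolding d_def by (simp only: has_bochner_integral_iff abs_ge_zero)
    moreover have "cos (m * \<bar>w\<bar>) = cos (m * w)" for m by (cases "w \<ge> 0") auto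
    ultimately show "(LBINT m. f w m) = exp (- l * \<bar>w\<bar>)" by (simp only: f_def)
  qed
  finally show ?thesis by (simp only: d_def)
qed

section \<open>From Laplace transforms to distribution functions\<close>

lemma abs_exp_diff_le:
  fixes u v :: real
  assumes "l > 0" "u \<ge> 0" "v \<ge> 0"
  shows "\<bar>exp (- l * u) - exp (- l * v)\<bar> \<le> l * \<bar>u - v\<bar>"
proof -
  have *: "exp (- l * a) - exp (- l * b) \<le> l * (b - a)" if "0 \<le> a" "a \<le> b" for a b
  proof -
    have "exp (- l * a) - exp (- l * b) = exp (- l * a) * (1 - exp (- l * (b - a)))"
      by (simp add: right_diff_distrib exp_add[symmetric] algebra_simps)
    also have "\<dots> \<le> 1 * (1 - exp (- l * (b - a)))"
      using assms that by (intro mult_right_mono) auto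
    also have "\<dots> \<le> l * (b - a)"
      using exp_ge_add_one_self[of "- l * (b - a)"] by simp
    finally show ?thesis .
  qed
  show ?thesis
  proof (cases "u \<le> v")
    case True
    then have "exp (- l * v) \<le> exp (- l * u)" using assms by simp
    with *[of u v] True assms show ?thesis by (simp add: abs_if)
  next
    case False
    then have "exp (- l * u) \<le> exp (- l * v)" using assms by simp
    with *[of v u] False assms show ?thesis by (simp add: abs_if)
  qed
qed

text \<open>Convergence of the Laplace transforms at the positive integers is convergence of the moments of
  \<open>exp (- V n)\<close>, which determine the law on a bounded interval.\<close>

lemma (in prob_space) laplace_imp_cdf_tendsto:
  fixes V :: "nat \<Rightarrow> 'a \<Rightarrow> real" and W :: "'b \<Rightarrow> real"
  assumes N: "prob_space N" and V[measurable]: "\<And>n. V n \<in> borel_measurable M" and W[measurable]: "W \<in> borel_measurable N"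
    and V0: "\<And>n w. V n w \<ge> 0" and W0: "\<And>w. W w \<ge> 0"
    and lap: "\<And>l::real. l > 0 \<Longrightarrow> (\<lambda>n. expectation (\<lambda>w. exp (- l * V n w))) \<longlonglongrightarrow> (\<integral>w. exp (- l * W w) \<partial>N)"
    and atom: "measure N {w \<in> space N. W w = y} = 0"
  shows "(\<lambda>n. prob {w \<in> space M. V n w \<le> y}) \<longlonglongrightarrow> measure N {w \<in> space N. W w \<le> y}"
proof -
  interpret N: prob_space N by (rule N)
  \<comment> \<open>The minus sign makes the map increasing, so that the event V <= y becomes a
    lower half-line; the image lies in the compact interval [- 1, 0], where polynomials approximate
    continuous functions uniformly.\<close>
  define DV where "DV n = distr M borel (\<lambda>w. - exp (- V n w))" for n
  define DW where "DW = distr N borel (\<lambda>w. - exp (- W w))"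
  have rV: "real_distribution (DV n)" for n unfolding DV_def by (rule real_distribution_distr) measurable
  have rW: "real_distribution DW" unfolding DW_def by (rule N.real_distribution_distr) measurable
  have Vr: "- exp (- V n w) \<in> {-1..0}" for n w using V0[of n w] by simp
  have Wr: "- exp (- W w) \<in> {-1..0}" for w using W0[of w] by simp
  have powV: "(- exp (- V n w)) ^ k = (-1) ^ k * exp (- real k * V n w)" for n w k
    by (subst power_minus) (simp add: exp_of_nat_mult[symmetric])
  have powW: "(- exp (- W w)) ^ k = (-1) ^ k * exp (- real k * W w)" for w k
    by (subst power_minus) (simp add: exp_of_nat_mult[symmetric])
  have expV: "integrable M (\<lambda>w. exp (- real k * V n w))" for n k
    by (rule integrable_const_bound[of _ 1]) (use V0 in auto)
  have expW: "integrable N (\<lambda>w. exp (- real k * W w))" for k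
    by (rule N.integrable_const_bound[of _ 1]) (use W0 in auto)
  \<comment> \<open>The exponent k = 0 belongs to constant terms of polynomials; there both sides
    are 1.\<close>
  have lapn: "(\<lambda>n. expectation (\<lambda>w. exp (- real k * V n w))) \<longlonglongrightarrow> (\<integral>w. exp (- real k * W w) \<partial>N)" for k
    using lap[of "real k"] by (cases "k = 0") (auto simp: prob_space N.prob_space)
  have poly: "(\<lambda>n. expectation (\<lambda>w. \<Sum>i\<le>d. a i * (- exp (- V n w)) ^ i)) \<longlonglongrightarrow> (\<integral>w. (\<Sum>i\<le>d. a i * (- exp (- W w)) ^ i) \<partial>N)" for a :: "nat \<Rightarrow> real" and d
  proof -
    have "expectation (\<lambda>w. \<Sum>i\<le>d. a i * (- exp (- V n w)) ^ i) = (\<Sum>i\<le>d. a i * (-1) ^ i * expectation (\<lambda>w. exp (- real i * V n w)))" for n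
      unfolding powV mult.assoc[symmetric]
      by (subst Bochner_Integration.integral_sum) (simp_all only: integrable_mult_right[OF expV] integral_mult_right_zero)
    moreover have "(\<integral>w. (\<Sum>i\<le>d. a i * (- exp (- W w)) ^ i) \<partial>N) = (\<Sum>i\<le>d. a i * (-1) ^ i * (\<integral>w. exp (- real i * W w) \<partial>N))"
      unfolding powW mult.assoc[symmetric]
      by (subst Bochner_Integration.integral_sum) (simp_all only: integrable_mult_right[OF expW] integral_mult_right_zero)
    moreover have "(\<lambda>n. \<Sum>i\<le>d. a i * (-1) ^ i * expectation (\<lambda>w. exp (- real i * V n w))) \<longlonglongrightarrow> (\<Sum>i\<le>d. a i * (-1) ^ i * (\<integral>w. exp (- real i * W w) \<partial>N))"
      by (intro tendsto_sum tendsto_mult tendsto_const lapn)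
    ultimately show ?thesis by (simp only:)
  qed
  have "weak_conv_m DV DW"
  proof (rule integral_bdd_continuous_conv_imp_weak_conv[OF rV rW])
    fix f :: "real \<Rightarrow> real" assume f: "\<And>x. isCont f x" "\<And>x. \<bar>f x\<bar> \<le> 1"
    have fc: "continuous_on UNIV f" using f(1) by (simp add: continuous_at_imp_continuous_on)
    have [measurable]: "f \<in> borel_measurable borel" by (rule borel_measurable_continuous_onI[OF fc])
    define fV where "fV n = expectation (\<lambda>w. f (- exp (- V n w)))" for n
    define fW where "fW = (\<integral>w. f (- exp (- W w)) \<partial>N)"
    have "fV \<longlonglongrightarrow> fW"
    proof (rule LIMSEQ_I)
      fix e :: real assume e: "e > 0"
      have "continuous_on {-1..0} f" using fc continuous_on_subset by blast
      then obtain g where g: "real_polynomial_function g" "\<And>x. x \<in> {-1..0} \<Longrightarrow> \<bar>f x - g x\<bar> < e / 3"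
        using Stone_Weierstrass_real_polynomial_function[of "{-1..0}" f "e / 3"] e by auto
      then obtain a d where gd: "g = (\<lambda>x. \<Sum>i\<le>d. a i * x ^ i)"
        unfolding real_polynomial_function_iff_sum by blast
      have gc: "continuous_on UNIV g" unfolding gd by (intro continuous_intros)
      have [measurable]: "g \<in> borel_measurable borel" by (rule borel_measurable_continuous_onI[OF gc])
      obtain B where B: "\<And>x. x \<in> {-1..0} \<Longrightarrow> \<bar>g x\<bar> \<le> B"
      proof -
        have "\<bar>g x\<bar> \<le> 1 + e / 3" if "x \<in> {-1..0}" for x using g(2)[OF that] f(2)[of x] by linarith
        then show ?thesis using that by blast
      qed
      have 1: "\<bar>fV n - expectation (\<lambda>w. g (- exp (- V n w)))\<bar> \<le> e / 3" for n
      proof -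
        have i1: "integrable M (\<lambda>w. f (- exp (- V n w)))" by (rule integrable_const_bound[of _ 1]) (use f(2) in auto)
        have i2: "integrable M (\<lambda>w. g (- exp (- V n w)))" by (rule integrable_const_bound[of _ B]) (use B[OF Vr] in auto)
        have "\<bar>expectation (\<lambda>w. f (- exp (- V n w)) - g (- exp (- V n w)))\<bar> \<le> expectation (\<lambda>w. e / 3)"
          by (rule order_trans[OF integral_abs_bound], rule integral_mono[OF integrable_abs[OF Bochner_Integration.integrable_diff[OF i1 i2]]])
            (use g(2)[OF Vr] in \<open>auto intro: less_imp_le\<close>)
        then show ?thesis unfolding fV_def Bochner_Integration.integral_diff[OF i1 i2] by (simp add: prob_space)
      qed
      have 2: "\<bar>fW - (\<integral>w. g (- exp (- W w)) \<partial>N)\<bar> \<le> e / 3"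
      proof -
        have i1: "integrable N (\<lambda>w. f (- exp (- W w)))" by (rule N.integrable_const_bound[of _ 1]) (use f(2) in auto)
        have i2: "integrable N (\<lambda>w. g (- exp (- W w)))" by (rule N.integrable_const_bound[of _ B]) (use B[OF Wr] in auto)
        have "\<bar>(\<integral>w. f (- exp (- W w)) - g (- exp (- W w)) \<partial>N)\<bar> \<le> (\<integral>w. e / 3 \<partial>N)"
          by (rule order_trans[OF integral_abs_bound], rule integral_mono[OF integrable_abs[OF Bochner_Integration.integrable_diff[OF i1 i2]]])
            (use g(2)[OF Wr] in \<open>auto intro: less_imp_le\<close>)
        then show ?thesis unfolding fW_def Bochner_Integration.integral_diff[OF i1 i2] by (simp add: N.prob_space)
      qed
      have "(\<lambda>n. expectation (\<lambda>w. g (- exp (- V n w)))) \<longlonglongrightarrow> (\<integral>w. g (- exp (- W w)) \<partial>N)"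
        unfolding gd by (rule poly)
      from LIMSEQ_D[OF this, of "e / 3"] e obtain n0 where
        n0: "\<And>n. n \<ge> n0 \<Longrightarrow> norm (expectation (\<lambda>w. g (- exp (- V n w))) - (\<integral>w. g (- exp (- W w)) \<partial>N)) < e / 3" by auto
      have "norm (fV n - fW) < e" if "n \<ge> n0" for n
        using 1[of n] 2 n0[OF that] unfolding real_norm_def by linarith
      then show "\<exists>n0. \<forall>n\<ge>n0. norm (fV n - fW) < e" by blast
    qed
    then show "(\<lambda>n. integral\<^sup>L (DV n) f) \<longlonglongrightarrow> integral\<^sup>L DW f"
      unfolding fV_def fW_def DV_def DW_def by (simp add: integral_distr)
  qed
  moreover have cV: "cdf (DV n) (- exp (- y)) = prob {w \<in> space M. V n w \<le> y}" for n
    unfolding cdf_def DV_def by (subst measure_distr) (auto intro!: arg_cong[where f=prob])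
  moreover have cW: "cdf DW (- exp (- y)) = measure N {w \<in> space N. W w \<le> y}"
    unfolding cdf_def DW_def by (subst measure_distr) (auto intro!: arg_cong[where f="measure N"])
  moreover have "isCont (cdf DW) (- exp (- y))"
  proof -
    interpret DW: real_distribution DW by (rule rW)
    have "measure DW {- exp (- y)} = measure N {w \<in> space N. W w = y}"
      unfolding DW_def by (subst measure_distr) (auto intro!: arg_cong[where f="measure N"])
    then show ?thesis using atom by (simp add: DW.isCont_cdf)
  qed
  ultimately show ?thesis
    unfolding weak_conv_m_def weak_conv_def by force
qed

lemma std_normal_atom: "measure std_normal_distribution {x} = 0"
proof -
  have "emeasure std_normal_distribution {x} = 0"
    by (subst emeasure_density) (auto simp: nn_integral_0_iff_AE intro!: AE_mp[OF AE_lborel_singleton[of x]])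
  then show ?thesis by (simp add: measure_def)
qed

text \<open>Symmetry of the density gives the lower tail, and the absence of atoms lets the closed
  interval be treated like a half-open one.\<close>

lemma std_normal_abs_le:
  assumes y: "y \<ge> 0"
  shows "measure std_normal_distribution {w. \<bar>w\<bar> \<le> y} = 2 * cdf std_normal_distribution y - 1"
proof -
  interpret N: real_distribution std_normal_distribution by (rule real_dist_normal_dist)
  have sym: "emeasure std_normal_distribution {..-y} = emeasure std_normal_distribution {y..}"
  proof -
    have "emeasure std_normal_distribution {..-y} = (\<integral>\<^sup>+w. ennreal (std_normal_density w) * indicator {..-y} w \<partial>lborel)"
      by (subst emeasure_density) auto
    also have "\<dots> = (\<integral>\<^sup>+w. ennreal (std_normal_density (0 + (-1) * w)) * indicator {..-y} (0 + (-1) * w) \<partial>lborel)"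
      by (subst nn_integral_real_affine[where c="-1" and t=0]) auto
    also have "\<dots> = (\<integral>\<^sup>+w. ennreal (std_normal_density w) * indicator {y..} w \<partial>lborel)"
      by (intro nn_integral_cong) (auto simp: std_normal_density_def indicator_def)
    also have "\<dots> = emeasure std_normal_distribution {y..}"
      by (subst emeasure_density) auto
    finally show ?thesis .
  qed
  then have sym': "measure std_normal_distribution {..-y} = measure std_normal_distribution {y..}" by (simp add: measure_def)
  have 1: "measure std_normal_distribution {y..} = 1 - cdf std_normal_distribution y"
  proof -
    have "measure std_normal_distribution {y..} = measure std_normal_distribution {y} + measure std_normal_distribution {y<..}"
      by (subst N.finite_measure_Union[symmetric]) (auto intro!: arg_cong[where f="measure _"])
    moreover have "measure std_normal_distribution {y<..} = 1 - measure std_normal_distribution {..y}"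
      using N.prob_compl[of "{..y}"] by (simp add: Compl_eq_Diff_UNIV[symmetric])
    ultimately show ?thesis by (simp add: std_normal_atom cdf_def)
  qed
  have "{w::real. \<bar>w\<bar> \<le> y} = {-y<..y} \<union> {-y}" using y by auto
  then have "measure std_normal_distribution {w. \<bar>w\<bar> \<le> y} = measure std_normal_distribution {-y<..y} + measure std_normal_distribution {-y}"
    by (simp only:) (subst N.finite_measure_Union, auto)
  also have "measure std_normal_distribution {-y<..y} = cdf std_normal_distribution y - cdf std_normal_distribution (- y)"
  proof (cases "y = 0")
    case False
    then show ?thesis using y by (subst N.cdf_diff_eq[symmetric]) auto
  qed simp
  also have "cdf std_normal_distribution (- y) = 1 - cdf std_normal_distribution y"
    using sym' 1 by (simp add: cdf_def)
  finally show ?thesis by (simp add: std_normal_atom)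
qed

section \<open>Laplace transforms of the rescaled overshoots and crossings\<close>

context centered_walk
begin

text \<open>Fubini over the Cauchy density gives the transform exactly for every n, so only a limit
  under the integral over m remains. Its majorant uses the mode bound without singularity at m = 0;
  that bound grows linearly in the position, which the estimate of the mean position by order sqrt n
  compensates.\<close>

lemma laplace_overshoots:
  assumes l: "l > 0"
  shows "(\<lambda>n. expectation (\<lambda>\<omega>. exp (- l * (2 * (1 / (\<sigma> * sqrt (real n))) * total_overshoot x n \<omega>)))) \<longlonglongrightarrow> (\<integral>w. exp (- l * \<bar>w\<bar>) \<partial>std_normal_distribution)"
proof -
  interpret MP: pair_sigma_finite M lborel ..
  define c where "c n = 1 / (\<sigma> * sqrt (real n))" for n
  have c0: "c n \<ge> 0" for n using sigma_pos by (simp add: c_def)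
  define d where "d m = l / (pi * (l\<^sup>2 + m\<^sup>2))" for m :: real
  have d: "integrable lborel d" "\<And>m. d m \<ge> 0"
    using has_bochner_integral_cos_cauchy_density[OF l, of 0] l by (auto simp: d_def[abs_def] has_bochner_integral_iff)
  have [measurable]: "d \<in> borel_measurable borel" unfolding d_def[abs_def] by measurable
  define E where "E n \<omega> = exp (- l * (2 * c n * total_overshoot x n \<omega>))" for n \<omega>
  define s where "s n \<omega> = c n * \<bar>x + T n \<omega>\<bar>" for n \<omega>
  have E: "0 \<le> E n \<omega>" "E n \<omega> \<le> 1" for n \<omega> using total_overshoot_nonneg[of x n \<omega>] c0 l by (auto simp: E_def)
  have s0: "s n \<omega> \<ge> 0" for n \<omega> using c0 by (simp add: s_def)
  have [measurable]: "E n \<in> borel_measurable M" "s n \<in> borel_measurable M" for n unfolding E_def[abs_def] s_def[abs_def] by measurable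
  have si: "integrable M (s n)" for n unfolding s_def[abs_def] by (intro integrable_mult_right integrable_abs_walk)
  define f where "f n \<omega> m = E n \<omega> * reflected_mode l m (s n \<omega>) * d m" for n \<omega> m
  have fm[measurable]: "case_prod (f n) \<in> borel_measurable (M \<Otimes>\<^sub>M lborel)" for n
    unfolding f_def reflected_mode_def by measurable
  have fb: "norm (f n \<omega> m) \<le> (1 + l * s n \<omega>) * d m" if "m \<noteq> 0" for n \<omega> m
  proof -
    have "norm (f n \<omega> m) = E n \<omega> * \<bar>reflected_mode l m (s n \<omega>)\<bar> * d m" using E d(2) by (simp add: f_def abs_mult)
    also have "\<dots> \<le> 1 * (1 + l * \<bar>s n \<omega>\<bar>) * d m"
      using E d(2) abs_reflected_mode_le(2)[OF that l, of "s n \<omega>"] by (intro mult_right_mono mult_mono) auto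
    finally show ?thesis using s0 by simp
  qed
  have f1: "has_bochner_integral lborel (f n \<omega>) (E n \<omega>)" for n \<omega>
    using has_bochner_integral_mult_right[OF has_bochner_integral_reflected_mode[OF l s0[of n \<omega>]], of "E n \<omega>"]
    unfolding f_def[abs_def] d_def by (simp add: mult.assoc)
  have int: "integrable (M \<Otimes>\<^sub>M lborel) (case_prod (f n))" for n
  proof (rule MP.Fubini_integrable[OF fm])
    have Bi: "integrable M (\<lambda>\<omega>. (1 + l * s n \<omega>) * (LBINT m. d m))"
      by (intro integrable_mult_left Bochner_Integration.integrable_add integrable_mult_right si) auto
    show "integrable M (\<lambda>\<omega>. LBINT m. norm (case_prod (f n) (\<omega>, m)))"
    proof (rule Bochner_Integration.integrable_bound[OF Bi _ AE_I2])
      fix \<omega>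
      have "(LBINT m. norm (f n \<omega> m)) \<le> (LBINT m. (1 + l * s n \<omega>) * d m)"
      proof (rule integral_mono_AE)
        show "integrable lborel (\<lambda>m. norm (f n \<omega> m))" using f1 by (intro integrable_norm) (simp add: has_bochner_integral_iff)
        show "integrable lborel (\<lambda>m. (1 + l * s n \<omega>) * d m)" using d(1) by (rule integrable_mult_right)
        show "AE m in lborel. norm (f n \<omega> m) \<le> (1 + l * s n \<omega>) * d m"
          using AE_lborel_singleton[of 0] by eventually_elim (rule fb)
      qed
      also have "\<dots> = (1 + l * s n \<omega>) * (LBINT m. d m)" by (rule integral_mult_right_zero)
      finally have "(LBINT m. norm (f n \<omega> m)) \<le> (1 + l * s n \<omega>) * (LBINT m. d m)" .
      moreover have "0 \<le> (LBINT m. norm (f n \<omega> m))" by (intro Bochner_Integration.integral_nonneg) auto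
      ultimately show "norm (LBINT m. norm (case_prod (f n) (\<omega>, m))) \<le> norm ((1 + l * s n \<omega>) * (LBINT m. d m))"
        unfolding prod.case real_norm_def by linarith
    qed measurable
    show "AE \<omega> in M. integrable lborel (\<lambda>m. case_prod (f n) (\<omega>, m))" using f1 by (simp add: has_bochner_integral_iff)
  qed
  define \<phi> where "\<phi> n m = expectation (\<lambda>\<omega>. E n \<omega> * reflected_mode l m (s n \<omega>))" for n m
  have fubini: "expectation (E n) = (LBINT m. \<phi> n m * d m)" for n
  proof -
    have "expectation (E n) = expectation (\<lambda>\<omega>. LBINT m. f n \<omega> m)" by (simp only: has_bochner_integral_integral_eq[OF f1])
    also have "\<dots> = (LBINT m. expectation (\<lambda>\<omega>. f n \<omega> m))" by (rule MP.Fubini_integral[OF int, symmetric])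
    finally show ?thesis unfolding f_def \<phi>_def integral_mult_left_zero .
  qed
  define B where "B = 1 + l * (\<bar>x\<bar> / \<sigma> + 1)"
  have sB: "expectation (s n) \<le> \<bar>x\<bar> / \<sigma> + 1" for n
  proof (cases "n = 0")
    case True then show ?thesis using sigma_pos by (simp add: s_def[abs_def] c_def)
  next
    case False
    have "expectation (\<lambda>\<omega>. \<bar>x + T n \<omega>\<bar>) \<le> expectation (\<lambda>\<omega>. \<bar>x\<bar> + \<bar>T n \<omega>\<bar>)"
      by (intro integral_mono integrable_abs_walk Bochner_Integration.integrable_add integrable_T) auto
    also have "\<dots> = \<bar>x\<bar> + expectation (\<lambda>\<omega>. \<bar>T n \<omega>\<bar>)"
      by (subst Bochner_Integration.integral_add) (auto simp: prob_space)
    also have "\<dots> \<le> \<bar>x\<bar> + \<sigma> * sqrt (real n)" using expectation_abs_T_le[of n] by simp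
    finally have "c n * expectation (\<lambda>\<omega>. \<bar>x + T n \<omega>\<bar>) \<le> c n * (\<bar>x\<bar> + \<sigma> * sqrt (real n))" using c0 by (intro mult_left_mono)
    also have "\<dots> = \<bar>x\<bar> / (\<sigma> * sqrt (real n)) + 1" using False sigma_pos by (simp add: c_def field_simps)
    also have "\<dots> \<le> \<bar>x\<bar> / \<sigma> + 1"
      using False sigma_pos by (intro add_right_mono divide_left_mono) auto
    finally show ?thesis by (simp add: s_def[abs_def])
  qed
  have \<phi>b: "\<bar>\<phi> n m\<bar> \<le> B" if "m \<noteq> 0" for n m
  proof -
    have b: "\<bar>E n \<omega> * reflected_mode l m (s n \<omega>)\<bar> \<le> 1 + l * s n \<omega>" for \<omega>
    proof -
      have "\<bar>E n \<omega> * reflected_mode l m (s n \<omega>)\<bar> \<le> 1 * (1 + l * \<bar>s n \<omega>\<bar>)"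
        unfolding abs_mult using E abs_reflected_mode_le(2)[OF that l, of "s n \<omega>"] by (intro mult_mono) auto
      then show ?thesis using s0 by simp
    qed
    have i: "integrable M (\<lambda>\<omega>. 1 + l * s n \<omega>)" by (intro Bochner_Integration.integrable_add integrable_mult_right si) auto
    have i': "integrable M (\<lambda>\<omega>. E n \<omega> * reflected_mode l m (s n \<omega>))"
    proof (rule Bochner_Integration.integrable_bound[OF i _ AE_I2])
      fix \<omega> show "norm (E n \<omega> * reflected_mode l m (s n \<omega>)) \<le> norm (1 + l * s n \<omega>)"
        using b[of \<omega>] unfolding real_norm_def by linarith
    qed measurable
    have "\<bar>\<phi> n m\<bar> \<le> expectation (\<lambda>\<omega>. 1 + l * s n \<omega>)"
      unfolding \<phi>_def by (rule order_trans[OF integral_abs_bound], rule integral_mono[OF integrable_abs[OF i'] i b])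
    also have "\<dots> = 1 + l * expectation (s n)"
      by (subst Bochner_Integration.integral_add) (use si in \<open>auto simp: prob_space\<close>)
    also have "\<dots> \<le> B" unfolding B_def using sB[of n] l by simp
    finally show ?thesis .
  qed
  have \<phi>m: "(\<lambda>m. \<phi> n m) \<in> borel_measurable borel" for n unfolding \<phi>_def reflected_mode_def by measurable
  have "(\<lambda>n. LBINT m. \<phi> n m * d m) \<longlonglongrightarrow> (LBINT m. exp (- m\<^sup>2 / 2) * d m)"
  proof (rule integral_dominated_convergence[where w="\<lambda>m. B * d m"])
    show "integrable lborel (\<lambda>m. B * d m)" using d(1) by (rule integrable_mult_right)
    show "AE m in lborel. (\<lambda>n. \<phi> n m * d m) \<longlonglongrightarrow> exp (- m\<^sup>2 / 2) * d m"
      using AE_lborel_singleton[of 0]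
    proof eventually_elim
      case (elim m)
      show ?case using reflected_mode_tendsto[OF l elim, of x]
        unfolding \<phi>_def E_def s_def c_def by (rule tendsto_mult_right)
    qed
    show "AE m in lborel. norm (\<phi> n m * d m) \<le> B * d m" for n
      using AE_lborel_singleton[of 0]
    proof eventually_elim
      case (elim m)
      show ?case unfolding real_norm_def abs_mult using \<phi>b[OF elim, of n] d(2)[of m] by (simp add: mult_right_mono)
    qed
  qed (use \<phi>m in measurable)
  then show ?thesis
    unfolding fubini[symmetric] unfolding E_def[abs_def] c_def d_def integral_gaussian_cauchy_density[OF l] .
qed

lemma expectation_abs_step_pos: "(\<integral>r. \<bar>r\<bar> \<partial>\<mu>) > 0"
proof -
  have "(\<integral>r. \<bar>r\<bar> \<partial>\<mu>) \<noteq> 0"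
  proof
    assume "(\<integral>r. \<bar>r\<bar> \<partial>\<mu>) = 0"
    then have "AE r in \<mu>. \<bar>r\<bar> = 0" by (subst (asm) integral_nonneg_eq_0_iff_AE) auto
    then have "(\<integral>r. r\<^sup>2 \<partial>\<mu>) = (\<integral>r. 0 \<partial>\<mu>)" by (intro integral_cong_AE) auto
    then show False using sigma_pos by simp
  qed
  moreover have "(\<integral>r. \<bar>r\<bar> \<partial>\<mu>) \<ge> 0" by (rule Bochner_Integration.integral_nonneg) simp
  ultimately show ?thesis by linarith
qed

text \<open>The rescaled crossings and overshoots differ by a multiple of the imbalance over sqrt n,
  which tends to 0 in mean square. As exp (- l * v) is Lipschitz on v >= 0, their Laplace transforms
  share a limit.\<close>

lemma crossings_cdf_tendsto:
  assumes reg: "regular_starts S" and x: "x \<in> S" and inS: "AE \<omega> in M. \<forall>k. x + T k \<omega> \<in> S" and y: "y \<ge> 0"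
  shows "(\<lambda>n. prob {\<omega> \<in> space M. \<sigma> * (\<Sum>k<n. level_crossing (x + T k \<omega>) (x + T (Suc k) \<omega>)) / ((\<integral>r. \<bar>r\<bar> \<partial>\<mu>) * sqrt (real n)) \<le> y})
    \<longlonglongrightarrow> 2 * cdf std_normal_distribution y - 1"
proof -
  define a where "a = (\<integral>r. \<bar>r\<bar> \<partial>\<mu>)"
  have a: "a > 0" using expectation_abs_step_pos by (simp add: a_def)
  define V where "V n \<omega> = \<sigma> * (\<Sum>k<n. level_crossing (x + T k \<omega>) (x + T (Suc k) \<omega>)) / (a * sqrt (real n))" for n \<omega>
  define U where "U n \<omega> = 2 * (1 / (\<sigma> * sqrt (real n))) * total_overshoot x n \<omega>" for n \<omega>
  have V0: "V n \<omega> \<ge> 0" for n \<omega>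
    using a sigma_pos by (auto simp: V_def intro!: divide_nonneg_nonneg mult_nonneg_nonneg sum_nonneg level_crossing_bounds)
  have U0: "U n \<omega> \<ge> 0" for n \<omega> using sigma_pos total_overshoot_nonneg[of x n \<omega>] by (simp add: U_def)
  have Vm[measurable]: "V n \<in> borel_measurable M" for n unfolding V_def[abs_def] by measurable
  have Um[measurable]: "U n \<in> borel_measurable M" for n unfolding U_def[abs_def] by measurable
  have VU: "V n \<omega> - U n \<omega> = \<sigma> / a * (imbalance x n \<omega> / sqrt (real n))" for n \<omega>
  proof -
    have "(\<Sum>k<n. level_crossing (x + T k \<omega>) (x + T (Suc k) \<omega>)) = imbalance x n \<omega> + 2 * \<kappa> * total_overshoot x n \<omega>"
      by (simp add: imbalance_def imbalance_at_def imbalance_step_def total_overshoot_def sum_subtractf sum_distrib_left)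
    moreover have "\<kappa> = a / \<sigma>\<^sup>2" by (simp add: \<kappa>_def a_def)
    \<comment> \<open>With \<kappa> = a / \<sigma>^2 the overshoot terms cancel. The case w = 0
      corresponds to n = 0, where all quotients are 0 by convention.\<close>
    moreover have "\<sigma> * (z + 2 * (a / \<sigma>\<^sup>2) * b) / (a * w) - 2 * (1 / (\<sigma> * w)) * b = \<sigma> / a * (z / w)" for z b w
      using a sigma_pos by (cases "w = 0") (simp_all add: field_simps power2_eq_square)
    ultimately show ?thesis
      unfolding V_def U_def by (simp only:)
  qed
  have zl: "(\<lambda>n. sqrt (expectation (\<lambda>\<omega>. (imbalance x n \<omega>)\<^sup>2) / real n)) \<longlonglongrightarrow> sqrt 0"
    by (intro tendsto_real_sqrt imbalance_second_moment_tendsto_zero[OF reg x inS])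
  have lap: "(\<lambda>n. expectation (\<lambda>\<omega>. exp (- l * V n \<omega>))) \<longlonglongrightarrow> (\<integral>w. exp (- l * \<bar>w\<bar>) \<partial>std_normal_distribution)" if l: "l > 0" for l
  proof -
    have iV: "integrable M (\<lambda>\<omega>. exp (- l * V n \<omega>))" for n
      by (rule integrable_const_bound[of _ 1]) (use V0 l in auto)
    have iU: "integrable M (\<lambda>\<omega>. exp (- l * U n \<omega>))" for n
      by (rule integrable_const_bound[of _ 1]) (use U0 l in auto)
    have diff: "\<bar>expectation (\<lambda>\<omega>. exp (- l * V n \<omega>)) - expectation (\<lambda>\<omega>. exp (- l * U n \<omega>))\<bar>
        \<le> l * (\<sigma> / a) * sqrt (expectation (\<lambda>\<omega>. (imbalance x n \<omega>)\<^sup>2) / real n)" for n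
    proof -
      have Z2: "integrable M (\<lambda>\<omega>. \<bar>imbalance x n \<omega>\<bar>\<^sup>2)" using expectation_imbalance_square(1)[of x n] by simp
      have Zm: "imbalance x n \<in> borel_measurable M" unfolding imbalance_def[abs_def] by measurable
      have Zi: "integrable M (\<lambda>\<omega>. \<bar>imbalance x n \<omega>\<bar>)"
        by (rule square_integrable_imp_integrable[OF _ Z2]) (use Zm in measurable)
      have "(expectation (\<lambda>\<omega>. \<bar>imbalance x n \<omega>\<bar>))\<^sup>2 \<le> expectation (\<lambda>\<omega>. \<bar>imbalance x n \<omega>\<bar>\<^sup>2)"
        using variance_eq[OF Zi Z2] variance_positive[of "\<lambda>\<omega>. \<bar>imbalance x n \<omega>\<bar>"] by linarith
      then have Ez: "expectation (\<lambda>\<omega>. \<bar>imbalance x n \<omega>\<bar>) \<le> sqrt (expectation (\<lambda>\<omega>. (imbalance x n \<omega>)\<^sup>2))"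
        by (intro real_le_rsqrt) simp
      have i: "integrable M (\<lambda>\<omega>. l * (\<sigma> / a) / sqrt (real n) * \<bar>imbalance x n \<omega>\<bar>)" using Zi by (rule integrable_mult_right)
      have le: "\<bar>exp (- l * V n \<omega>) - exp (- l * U n \<omega>)\<bar> \<le> l * (\<sigma> / a) / sqrt (real n) * \<bar>imbalance x n \<omega>\<bar>" for \<omega>
      proof -
        have "\<bar>V n \<omega> - U n \<omega>\<bar> = \<sigma> / a / sqrt (real n) * \<bar>imbalance x n \<omega>\<bar>"
          unfolding VU using a sigma_pos by (simp add: abs_mult)
        then show ?thesis using abs_exp_diff_le[OF l V0[of n \<omega>] U0[of n \<omega>]] by simp
      qed
      have "\<bar>expectation (\<lambda>\<omega>. exp (- l * V n \<omega>)) - expectation (\<lambda>\<omega>. exp (- l * U n \<omega>))\<bar> \<le> expectation (\<lambda>\<omega>. l * (\<sigma> / a) / sqrt (real n) * \<bar>imbalance x n \<omega>\<bar>)"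
        unfolding Bochner_Integration.integral_diff[OF iV iU, symmetric]
        by (rule order_trans[OF integral_abs_bound], rule integral_mono[OF integrable_abs[OF Bochner_Integration.integrable_diff[OF iV iU]] i le])
      also have "\<dots> = l * (\<sigma> / a) / sqrt (real n) * expectation (\<lambda>\<omega>. \<bar>imbalance x n \<omega>\<bar>)" by (rule integral_mult_right_zero)
      also have "\<dots> \<le> l * (\<sigma> / a) / sqrt (real n) * sqrt (expectation (\<lambda>\<omega>. (imbalance x n \<omega>)\<^sup>2))"
        using l a sigma_pos by (intro mult_left_mono Ez) auto
      finally show ?thesis by (simp add: real_sqrt_divide)
    qed
    have "(\<lambda>n. expectation (\<lambda>\<omega>. exp (- l * V n \<omega>)) - expectation (\<lambda>\<omega>. exp (- l * U n \<omega>))) \<longlonglongrightarrow> 0"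
    proof (rule Lim_null_comparison[OF always_eventually])
      show "\<forall>n. norm (expectation (\<lambda>\<omega>. exp (- l * V n \<omega>)) - expectation (\<lambda>\<omega>. exp (- l * U n \<omega>))) \<le> l * (\<sigma> / a) * sqrt (expectation (\<lambda>\<omega>. (imbalance x n \<omega>)\<^sup>2) / real n)"
        using diff by simp
      show "(\<lambda>n. l * (\<sigma> / a) * sqrt (expectation (\<lambda>\<omega>. (imbalance x n \<omega>)\<^sup>2) / real n)) \<longlonglongrightarrow> 0"
        using tendsto_mult_left[OF zl, of "l * (\<sigma> / a)"] by simp
    qed
    from tendsto_add[OF this laplace_overshoots[OF l, of x, folded U_def]] show ?thesis by simp
  qed
  interpret N: real_distribution std_normal_distribution by (rule real_dist_normal_dist)
  have "(\<lambda>n. prob {\<omega> \<in> space M. V n \<omega> \<le> y}) \<longlonglongrightarrow> measure std_normal_distribution {w \<in> space std_normal_distribution. \<bar>w\<bar> \<le> y}"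
  proof (rule laplace_imp_cdf_tendsto[OF N.prob_space_axioms Vm _ V0 _ lap])
    \<comment> \<open>The limit law has no atom at y: the event consists of at most two points, each
      of normal mass 0.\<close>
    have "{w \<in> space std_normal_distribution. \<bar>w\<bar> = y} = {y} \<union> {-y}" using y by auto
    then have "measure std_normal_distribution {w \<in> space std_normal_distribution. \<bar>w\<bar> = y} \<le> measure std_normal_distribution {y} + measure std_normal_distribution {-y}"
      by (simp only:) (rule measure_Un_le, auto)
    moreover have "0 \<le> measure std_normal_distribution {w \<in> space std_normal_distribution. \<bar>w\<bar> = y}" by simp
    ultimately show "measure std_normal_distribution {w \<in> space std_normal_distribution. \<bar>w\<bar> = y} = 0"
      by (simp only: std_normal_atom)
  qed auto
  then show ?thesis using std_normal_abs_le[OF y] by (simp add: V_def a_def)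
qed

text \<open>The zero set of \<open>1 - char \<mu>\<close> decides between the nonlattice and the lattice case.\<close>

lemma regular_starts_nonlattice:
  assumes "\<And>t. t \<noteq> 0 \<Longrightarrow> char \<mu> t \<noteq> 1"
  shows "regular_starts UNIV"
  unfolding regular_starts_def
proof (intro allI impI)
  fix \<epsilon> :: real assume e: "\<epsilon> > 0"
  obtain h C where h: "h > 0" and C: "\<And>y m. (\<Sum>i<m. prob {w \<in> space M. \<bar>y + T i w\<bar> \<le> h}) \<le> \<epsilon> * sqrt (real m) + C"
    by (rule sum_prob_ball_nonlattice[OF _ e]) (rule assms, assumption, rule that)
  have "(\<Sum>i<m. prob {w \<in> space M. - h < y + T i w \<and> y + T i w < 0}) \<le> \<epsilon> * sqrt (real m) + C" for y m
    by (rule order_trans[OF _ C[of y m]], intro sum_mono finite_measure_mono) auto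
  then show "\<exists>h>0. \<exists>C. \<forall>y\<in>UNIV. \<forall>m. (\<Sum>i<m. prob {w \<in> space M. - h < y + T i w \<and> y + T i w < 0}) \<le> \<epsilon> * sqrt (real m) + C"
    using h by blast
qed

text \<open>For t other than 0 this is the group of multiples of 2 pi / |t|. In the cosine form
  closedness follows from continuity, and membership of a step from the vanishing mean of 1 -
  cos.\<close>

definition lattice :: "real \<Rightarrow> real set" where "lattice t = {s. cos (t * s) = 1}"

lemma lattice_subgroup: "closed_additive_subgroup (lattice t)"
proof -
  have "sin a = 0" if "cos a = 1" for a :: real
    using sin_cos_squared_add[of a] that by simp
  moreover have "closed (lattice t)"
    unfolding lattice_def by (intro closed_Collect_eq continuous_intros)
  ultimately show ?thesis
    unfolding closed_additive_subgroup_def by (simp add: lattice_def distrib_left cos_add)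
qed

text \<open>The function 1 - cos (t * r) is nonnegative with mean 1 - Re (char \<mu> t) = 0, so it
  vanishes almost surely.\<close>

lemma AE_lattice:
  assumes "char \<mu> t = 1"
  shows "AE r in \<mu>. r \<in> lattice t"
proof -
  have ic: "integrable \<mu> (\<lambda>r. iexp (t * r))" by (rule mu.integrable_iexp) auto
  have cc: "integrable \<mu> (\<lambda>r. cos (t * r))" by (rule mu.integrable_const_bound[where B=1]) auto
  have "(\<integral>r. cos (t * r) \<partial>\<mu>) = (\<integral>r. Re (iexp (t * r)) \<partial>\<mu>)" by (simp add: Re_exp)
  also have "\<dots> = Re (char \<mu> t)" unfolding char_def by (rule integral_Re[OF ic])
  finally have "(\<integral>r. 1 - cos (t * r) \<partial>\<mu>) = 0"
    using assms cc mu.prob_space by simp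
  moreover have "integrable \<mu> (\<lambda>r. 1 - cos (t * r))" using cc by (intro Bochner_Integration.integrable_diff) simp_all
  moreover have "AE r in \<mu>. 0 \<le> 1 - cos (t * r)" by (rule AE_I2) simp
  ultimately have "AE r in \<mu>. 1 - cos (t * r) = 0"
    by (simp only: integral_nonneg_eq_0_iff_AE)
  then show ?thesis by eventually_elim (simp add: lattice_def)
qed

lemma AE_T_lattice:
  assumes "char \<mu> t = 1"
  shows "AE w in M. \<forall>k. T k w \<in> lattice t"
proof -
  have [measurable]: "lattice t \<in> sets borel"
    using lattice_subgroup[of t] by (auto simp: closed_additive_subgroup_def intro: borel_closed)
  have "AE w in M. X (Suc k) w \<in> lattice t" for k
    using AE_lattice[OF assms] unfolding mu_eq[of k, symmetric] by (subst (asm) AE_distr_iff) auto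
  then have "AE w in M. \<forall>k. X (Suc k) w \<in> lattice t" by (simp add: AE_all_countable)
  then show ?thesis
  proof eventually_elim
    case (elim w)
    have "T k w \<in> lattice t" for k
      using elim lattice_subgroup[of t] by (induction k) (auto simp: T_Suc closed_additive_subgroup_def)
    then show ?case by blast
  qed
qed

text \<open>The complement of the lattice is open and null, so it cannot meet the support;
  minimality of the hull does the rest.\<close>

lemma walk_state_space_subset_lattice:
  assumes "char \<mu> t = 1"
  shows "walk_state_space \<mu> \<subseteq> lattice t"
  unfolding walk_state_space_def
proof (rule hull_minimal)
  show "closed_additive_subgroup (lattice t)" by (rule lattice_subgroup)
  show "topological_support \<mu> \<subseteq> lattice t"
  proof
    fix u assume u: "u \<in> topological_support \<mu>"
    show "u \<in> lattice t"
    proof (rule ccontr)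
      assume n: "u \<notin> lattice t"
      have o: "open (- lattice t)" using lattice_subgroup[of t] unfolding closed_additive_subgroup_def by (intro open_Compl) blast
      have "emeasure \<mu> (- lattice t) = 0"
      proof -
        have "- lattice t \<in> sets \<mu>" using o by simp
        then show ?thesis using AE_lattice[OF assms] by (subst (asm) AE_iff_measurable[of "- lattice t"]) auto
      qed
      then show False using u n o by (auto simp: topological_support_def)
    qed
  qed
qed

text \<open>The lattice has a gap next to zero, so a walk that starts on it almost surely never
  visits (- h, 0), and all the probabilities are 0.\<close>

lemma regular_starts_lattice:
  assumes t: "t \<noteq> 0" "char \<mu> t = 1"
  shows "regular_starts (lattice t)"
  unfolding regular_starts_def
proof (intro allI impI)
  fix \<epsilon> :: real assume e: "\<epsilon> > 0"
  \<comment> \<open>Half the lattice spacing: for - h < s < 0 the value |t * s| lies strictly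
    between 0 and pi, where the cosine is below 1.\<close>
  define h where "h = pi / \<bar>t\<bar>"
  have h: "h > 0" using t by (simp add: h_def)
  have gap: "\<not> (- h < s \<and> s < 0)" if "s \<in> lattice t" for s
  proof
    assume s: "- h < s \<and> s < 0"
    have "- s < pi / \<bar>t\<bar>" using s by (simp add: h_def)
    then have "- s * \<bar>t\<bar> < pi" using t by (subst (asm) pos_less_divide_eq) auto
    moreover have "\<bar>t * s\<bar> = - s * \<bar>t\<bar>" using s by (simp add: abs_mult)
    ultimately have "\<bar>t * s\<bar> < pi" by simp
    moreover have "\<bar>t * s\<bar> > 0" using s t by simp
    ultimately have "cos \<bar>t * s\<bar> < cos 0" by (intro cos_monotone_0_pi) auto
    then show False using that by (simp add: lattice_def)
  qed
  have "prob {w \<in> space M. - h < y + T i w \<and> y + T i w < 0} = 0" if y: "y \<in> lattice t" for y i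
  proof -
    have "AE w in M. \<not> (- h < y + T i w \<and> y + T i w < 0)"
      using AE_T_lattice[OF t(2)]
    proof eventually_elim
      case (elim w)
      then have "y + T i w \<in> lattice t" using y lattice_subgroup[of t] by (auto simp: closed_additive_subgroup_def)
      then show ?case by (rule gap)
    qed
    then show ?thesis by (subst prob_eq_0) auto
  qed
  then have "(\<Sum>i<m. prob {w \<in> space M. - h < y + T i w \<and> y + T i w < 0}) \<le> \<epsilon> * sqrt (real m) + 0" if "y \<in> lattice t" for y m
    using e that by simp
  then show "\<exists>h>0. \<exists>C. \<forall>y\<in>lattice t. \<forall>m. (\<Sum>i<m. prob {w \<in> space M. - h < y + T i w \<and> y + T i w < 0}) \<le> \<epsilon> * sqrt (real m) + C"
    using h by blast
qed

text \<open>In the lattice case, membership in the state space places the start, and with it almost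
  surely the whole walk, on the lattice; in the nonlattice case the whole line serves as the set of
  starts.\<close>

lemma exists_regular_starts:
  assumes x: "x \<in> walk_state_space \<mu>"
  obtains S where "regular_starts S" "x \<in> S" "AE w in M. \<forall>k. x + T k w \<in> S"
proof (cases "\<exists>t. t \<noteq> 0 \<and> char \<mu> t = 1")
  case False
  then show ?thesis using that[OF regular_starts_nonlattice] by auto
next
  case True
  then obtain t where t: "t \<noteq> 0" "char \<mu> t = 1" by blast
  have xL: "x \<in> lattice t" using walk_state_space_subset_lattice[OF t(2)] x by blast
  have "AE w in M. \<forall>k. x + T k w \<in> lattice t"
    using AE_T_lattice[OF t(2)]
    by eventually_elim (use xL lattice_subgroup[of t] in \<open>auto simp: closed_additive_subgroup_def\<close>)
  then show ?thesis using that[OF regular_starts_lattice[OF t] xL] by blast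
qed

end

theorem theorem6p1:
  fixes M :: "'a measure" and X :: "nat \<Rightarrow> 'a \<Rightarrow> real" and \<sigma> x y :: real
  assumes "prob_space M"
    and "prob_space.indep_vars M (\<lambda>_. borel) X {1..}"
    and "\<And>n. n \<ge> 1 \<Longrightarrow> distr M borel (X n) = distr M borel (X 1)"
    and "integrable M (X 1)"
    and "integral\<^sup>L M (X 1) = 0"
    and "integrable M (\<lambda>\<omega>. (X 1 \<omega>)\<^sup>2)"
    and "\<sigma> > 0"
    and "\<sigma>\<^sup>2 = (\<integral>\<omega>. (X 1 \<omega>)\<^sup>2 \<partial>M)"
    and "x \<in> walk_state_space (distr M borel (X 1))"
    and "y \<ge> 0"
  shows "(\<lambda>n. measure M {\<omega> \<in> space M.
            \<sigma> * real (num_crossings (\<lambda>k. random_walk x X k \<omega>) n)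
              / ((\<integral>\<omega>'. \<bar>X 1 \<omega>'\<bar> \<partial>M) * sqrt (real n)) \<le> y})
         \<longlonglongrightarrow> 2 * cdf std_normal_distribution y - 1"
proof -
  interpret centered_walk M X \<sigma>
    using assms(1-8) by (intro centered_walk.intro centered_walk_axioms.intro)
  have "x \<in> walk_state_space \<mu>" using assms(9) by (simp only: \<mu>_def)
  then obtain S where S: "regular_starts S" "x \<in> S" "AE \<omega> in M. \<forall>k. x + T k \<omega> \<in> S"
    by (rule exists_regular_starts)
  have a: "(\<integral>r. \<bar>r\<bar> \<partial>\<mu>) = (\<integral>\<omega>'. \<bar>X 1 \<omega>'\<bar> \<partial>M)"
    unfolding \<mu>_def by (rule integral_distr) measurable
  show ?thesis
    using crossings_cdf_tendsto[OF S assms(10)]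
    unfolding num_crossings_eq_sum random_walk_eq a .
qed

end
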